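(* Let $\Phi$ be a matrix function in $L^\infty(\mathbb{M}_{m,n})$ such that $\|H_\Phi\|_{\rm e}<\|\Phi\|_{L^\infty}$. Then $\Phi$ is badly approximable if and only if the following two conditions are satisfied: (i) $\|\Phi(\zeta)\|_{\mathbb{M}_{m,n}}$ is constant for almost all $\zeta\in\mathbb{T}$; (ii) there exists a function $f$ in $\operatorname{Ker}T_\Phi$ such that $f(\zeta)$ is a maximizing vector of $\Phi(\zeta)$ for almost all $\zeta\in\mathbb{T}$.
   Context: $\mathbb{T}$ is the unit circle. $\mathbb{M}_{m,n}$ is the space of $m\times n$ complex matrices with the operator norm; $L^\infty(\mathbb{M}_{m,n})$ is the space of bounded measurable $\mathbb{M}_{m,n}$-valued functions on $\mathbb{T}$ with norm $\|\Phi\|_{L^\infty}=\operatorname{ess\,sup}_{\zeta\in\mathbb{T}}\|\Phi(\zeta)\|_{\mathbb{M}_{m,n}}$, and $H^\infty(\mathbb{M}_{m,n})$ is its subspace of (boundary values of) bounded analytic matrix functions on the unit disk. $H^2(\mathbb{C}^n)$ is the Hardy space of $\mathbb{C}^n$-valued functions, and $H^2_-(\mathbb{C}^n)=L^2(\mathbb{C}^n)\ominus H^2(\mathbb{C}^n)$. The Toeplitz operator $T_\Phi:H^2(\mathbb{C}^n)\to H^2(\mathbb{C}^m)$ and the Hankel operator $H_\Phi:H^2(\mathbb{C}^n)\to H^2_-(\mathbb{C}^m)$ are defined by $T_\Phi f=\mathbb{P}_+(\Phi f)$, $H_\Phi f=\mathbb{P}_-(\Phi f)$, where $\mathbb{P}_+$,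 $\mathbb{P}_-$ are the orthogonal projections onto $H^2(\mathbb{C}^m)$, $H^2_-(\mathbb{C}^m)$. $\|\cdot\|_{\rm e}$ denotes the essential norm of an operator (distance to the compact operators). $\Phi$ is badly approximable if $\|\Phi\|_{L^\infty}=\inf\{\|\Phi-F\|_{L^\infty}:F\in H^\infty(\mathbb{M}_{m,n})\}$. A maximizing vector of a matrix (or operator) $A$ is a nonzero vector $x$ with $\|Ax\|=\|A\|\,\|x\|$. *)

theory Defs
  imports "HOL-Probability.Probability"
begin

(* Normalized arc length on the unit circle, completed: the measurable functions are the Lebesgue
   measurable functions on the circle. *)
definition circle_measure :: "complex measure" where
  "circle_measure =
     completion (distr (uniform_measure lborel {0..2 * pi}) (restrict_space borel (sphere 0 1)) cis)"

(* The elements of all function spaces below are representatives, i.e. honest functions; equality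
   in the spaces is equality almost everywhere, and L2_norm is a seminorm on representatives.
   The library norm on complex ^ 'n is the Euclidean one. *)

definition L2 :: "(complex \<Rightarrow> complex ^ 'n::finite) set" where
  "L2 = {f \<in> borel_measurable circle_measure. integrable circle_measure (\<lambda>\<zeta>. (norm (f \<zeta>))\<^sup>2)}"

definition L2_norm :: "(complex \<Rightarrow> complex ^ 'n::finite) \<Rightarrow> real" where
  "L2_norm f = sqrt (\<integral>\<zeta>. (norm (f \<zeta>))\<^sup>2 \<partial>circle_measure)"

definition L2_inner :: "(complex \<Rightarrow> complex ^ 'n::finite) \<Rightarrow> (complex \<Rightarrow> complex ^ 'n) \<Rightarrow> complex" where
  "L2_inner f g = (\<integral>\<zeta>. (\<Sum>i\<in>UNIV. f \<zeta> $ i * cnj (g \<zeta> $ i)) \<partial>circle_measure)"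

definition fourier_coeff :: "(complex \<Rightarrow> complex ^ 'n::finite) \<Rightarrow> int \<Rightarrow> complex ^ 'n" where
  "fourier_coeff f k = (\<integral>\<zeta>. (\<zeta> powi (- k)) *s f \<zeta> \<partial>circle_measure)"

definition H2 :: "(complex \<Rightarrow> complex ^ 'n::finite) set" where
  "H2 = {f \<in> L2. \<forall>k<0. fourier_coeff f k = 0}"

definition H2_minus :: "(complex \<Rightarrow> complex ^ 'n::finite) set" where
  "H2_minus = {f \<in> L2. \<forall>g\<in>H2. L2_inner f g = 0}"

(* For a closed subspace S of L2 and g in L2, the projection exists and is unique up to equality
   almost everywhere; the choice operator picks one representative. *)
definition orth_proj ::
  "(complex \<Rightarrow> complex ^ 'n::finite) set \<Rightarrow> (complex \<Rightarrow> complex ^ 'n) \<Rightarrow> (complex \<Rightarrow> complex ^ 'n)" where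
  "orth_proj S g = (SOME h. h \<in> S \<and> (\<forall>k\<in>S. L2_inner (\<lambda>\<zeta>. g \<zeta> - h \<zeta>) k = 0))"

(* The operator norm of a matrix; the norm that the library puts on matrices is the
   Hilbert-Schmidt norm. *)
definition mat_norm :: "complex ^ 'n::finite ^ 'm::finite \<Rightarrow> real" where
  "mat_norm A = onorm (\<lambda>x. A *v x)"

definition maximizing_vector :: "complex ^ 'n::finite ^ 'm::finite \<Rightarrow> complex ^ 'n \<Rightarrow> bool" where
  "maximizing_vector A x \<longleftrightarrow> x \<noteq> 0 \<and> norm (A *v x) = mat_norm A * norm x"

definition Linf :: "(complex \<Rightarrow> complex ^ 'n::finite ^ 'm::finite) set" where
  "Linf = {\<Phi> \<in> borel_measurable circle_measure. \<exists>C. AE \<zeta> in circle_measure. mat_norm (\<Phi> \<zeta>) \<le> C}"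

definition Linf_norm :: "(complex \<Rightarrow> complex ^ 'n::finite ^ 'm::finite) \<Rightarrow> real" where
  "Linf_norm \<Phi> = real_of_ereal (esssup circle_measure (\<lambda>\<zeta>. ereal (mat_norm (\<Phi> \<zeta>))))"

(* Boundary values are taken as radial limits almost everywhere. *)
definition Hinf :: "(complex \<Rightarrow> complex ^ 'n::finite ^ 'm::finite) set" where
  "Hinf = {F \<in> Linf. \<exists>G.
     (\<forall>i j. (\<lambda>z. G z $ i $ j) holomorphic_on ball 0 1) \<and>
     bounded (G ` ball 0 1) \<and>
     (AE \<zeta> in circle_measure. ((\<lambda>r. G (complex_of_real r * \<zeta>)) \<longlongrightarrow> F \<zeta>) (at_left 1))}"

definition badly_approximable :: "(complex \<Rightarrow> complex ^ 'n::finite ^ 'm::finite) \<Rightarrow> bool" where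
  "badly_approximable \<Phi> \<longleftrightarrow> Linf_norm \<Phi> = (INF F\<in>Hinf. Linf_norm (\<lambda>\<zeta>. \<Phi> \<zeta> - F \<zeta>))"

definition toeplitz ::
  "(complex \<Rightarrow> complex ^ 'n::finite ^ 'm::finite) \<Rightarrow> (complex \<Rightarrow> complex ^ 'n) \<Rightarrow> (complex \<Rightarrow> complex ^ 'm)" where
  "toeplitz \<Phi> f = orth_proj H2 (\<lambda>\<zeta>. \<Phi> \<zeta> *v f \<zeta>)"

definition hankel ::
  "(complex \<Rightarrow> complex ^ 'n::finite ^ 'm::finite) \<Rightarrow> (complex \<Rightarrow> complex ^ 'n) \<Rightarrow> (complex \<Rightarrow> complex ^ 'm)" where
  "hankel \<Phi> f = orth_proj H2_minus (\<lambda>\<zeta>. \<Phi> \<zeta> *v f \<zeta>)"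

definition ker_toeplitz ::
  "(complex \<Rightarrow> complex ^ 'n::finite ^ 'm::finite) \<Rightarrow> (complex \<Rightarrow> complex ^ 'n) set" where
  "ker_toeplitz \<Phi> = {f \<in> H2. AE \<zeta> in circle_measure. toeplitz \<Phi> f \<zeta> = 0}"

(* Bounded complex-linear operators from S to T. Linearity and boundedness together force K to
   respect equality almost everywhere, so K is an operator on equivalence classes. *)
definition L2_operator ::
  "(complex \<Rightarrow> complex ^ 'n::finite) set \<Rightarrow> (complex \<Rightarrow> complex ^ 'm::finite) set \<Rightarrow>
   ((complex \<Rightarrow> complex ^ 'n) \<Rightarrow> (complex \<Rightarrow> complex ^ 'm)) \<Rightarrow> bool" where
  "L2_operator S T K \<longleftrightarrow>
     (\<forall>f\<in>S. K f \<in> T) \<and>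
     (\<forall>f\<in>S. \<forall>g\<in>S. \<forall>a b. AE \<zeta> in circle_measure.
        K (\<lambda>\<xi>. a *s f \<xi> + b *s g \<xi>) \<zeta> = a *s K f \<zeta> + b *s K g \<zeta>) \<and>
     (\<exists>C. \<forall>f\<in>S. L2_norm (K f) \<le> C * L2_norm f)"

definition compact_operator ::
  "(complex \<Rightarrow> complex ^ 'n::finite) set \<Rightarrow> (complex \<Rightarrow> complex ^ 'm::finite) set \<Rightarrow>
   ((complex \<Rightarrow> complex ^ 'n) \<Rightarrow> (complex \<Rightarrow> complex ^ 'm)) \<Rightarrow> bool" where
  "compact_operator S T K \<longleftrightarrow>
     L2_operator S T K \<and>
     (\<forall>X. (\<forall>k::nat. X k \<in> S) \<and> (\<exists>C. \<forall>k. L2_norm (X k) \<le> C) \<longrightarrow>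
        (\<exists>g\<in>T. \<exists>r::nat \<Rightarrow> nat. strict_mono r \<and>
           (\<lambda>k. L2_norm (\<lambda>\<zeta>. K (X (r k)) \<zeta> - g \<zeta>)) \<longlonglongrightarrow> 0))"

definition operator_norm ::
  "(complex \<Rightarrow> complex ^ 'n::finite) set \<Rightarrow>
   ((complex \<Rightarrow> complex ^ 'n) \<Rightarrow> (complex \<Rightarrow> complex ^ 'm::finite)) \<Rightarrow> real" where
  "operator_norm S K = (SUP f\<in>{f \<in> S. L2_norm f \<le> 1}. L2_norm (K f))"

definition essential_norm ::
  "(complex \<Rightarrow> complex ^ 'n::finite) set \<Rightarrow> (complex \<Rightarrow> complex ^ 'm::finite) set \<Rightarrow>
   ((complex \<Rightarrow> complex ^ 'n) \<Rightarrow> (complex \<Rightarrow> complex ^ 'm)) \<Rightarrow> real" where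
  "essential_norm S T A =
     (INF K\<in>{K. compact_operator S T K}. operator_norm S (\<lambda>f \<zeta>. A f \<zeta> - K f \<zeta>))"

end

theory Submission
  imports Defs "HOL-Complex_Analysis.Cauchy_Integral_Formula"
begin

text \<open>
  The link between approximation and operators is that a bounded analytic \<open>F\<close> maps \<open>H\<^sup>2\<close> into \<open>H\<^sup>2\<close>, so
  \<open>\<Phi>\<close> and \<open>\<Phi> - F\<close> have the same Hankel operator \<open>H\<close>.

  If \<open>f\<close> satisfies (ii) and \<open>\<Phi>\<close> has constant norm \<open>c\<close>, then \<open>\<Phi> f\<close> is orthogonal to \<open>H\<^sup>2\<close>. Pairing \<open>\<Phi> f\<close> with
  \<open>\<Phi> f = (\<Phi> - F) f + F f\<close> removes the last term and gives \<open>c \<le> \<parallel>\<Phi> - F\<parallel>\<close> for every \<open>F\<close>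
  (\<open>badly_approximable_sufficient\<close>).

  Conversely, Nehari's theorem (\<open>nehari\<close>) says that the distance from \<open>\<Phi>\<close> to \<open>H\<^sup>\<infinity>\<close> is the norm of \<open>H\<close>, so for
  a badly approximable \<open>\<Phi>\<close> the norm of \<open>H\<close> is \<open>\<parallel>\<Phi>\<parallel>\<close>. Since the essential norm is smaller, the norm is attained
  at some \<open>f\<close> (\<open>hankel_norm_attained\<close>). All inequalities in \<open>\<parallel>H f\<parallel> \<le> \<parallel>\<Phi> f\<parallel> \<le> \<parallel>\<Phi>\<parallel> \<parallel>f\<parallel>\<close> are then equalities: the first
  puts \<open>f\<close> into the kernel of the Toeplitz operator, the second makes \<open>f(\<zeta>)\<close> maximizing wherever it is not zero,
  and a nonzero \<open>H\<^sup>2\<close> function vanishes almost nowhere (\<open>H2_nonvanishing\<close>).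

  Nehari's theorem is proved by prescribing the analytic Fourier coefficients one at a time. Each step
  (\<open>hankel_extension_step\<close>) is the norm-preserving extension of a vector-valued functional from the functions that vanish
  at the origin to all of \<open>H\<^sup>2\<close>, by projection with respect to a form that measures how far \<open>H\<close> is from attaining its bound.
  The bound increases a little at each step to keep that form definite. In the limit one obtains Fourier
  coefficients of a function \<open>F\<close> with \<open>\<parallel>\<Phi> - F\<parallel>\<close> bounded; that \<open>F\<close> is the radial limit of a bounded analytic function is
  Fatou's theorem (\<open>poisson_radial_limit\<close>), by the Hardy-Littlewood maximal inequality.
\<close>

section \<open>Arc length on the circle\<close>

abbreviation \<mu> :: "complex measure" where "\<mu> \<equiv> circle_measure"

lemma cis_measurable_circle [measurable]:
  "cis \<in> uniform_measure lborel {0..2*pi} \<rightarrow>\<^sub>M restrict_space borel (sphere 0 1)"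
proof (rule measurable_restrict_space2)
  have "cis \<in> borel_measurable borel"
    by (intro borel_measurable_continuous_onI continuous_intros)
  then show "cis \<in> borel_measurable (uniform_measure lborel {0..2*pi})"
    by simp
qed auto

lemma space_circle [simp]: "space \<mu> = sphere 0 1"
  by (simp add: circle_measure_def)

lemma prob_space_completion: "prob_space N \<Longrightarrow> prob_space (completion N)"
  using nn_integral_completion[of N "\<lambda>_. 1"]
  by (intro prob_spaceI) (simp add: prob_space.emeasure_space_1 del: emeasure_completion)

lemma prob_space_circle: "prob_space \<mu>"
proof -
  have "prob_space (uniform_measure lborel {0..2*pi})"
    by (intro prob_space_uniform_measure) (auto simp: ennreal_zero_less_mult_iff)
  then show ?thesis
    unfolding circle_measure_def
    by (intro prob_space_completion prob_space.prob_space_distr) measurable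
qed

interpretation circle: prob_space \<mu>
  by (rule prob_space_circle)

interpretation circle: complete_measure \<mu>
  unfolding circle_measure_def by unfold_locales

lemma measurable_circleI:
  assumes "f \<in> restrict_space borel (sphere 0 1) \<rightarrow>\<^sub>M N"
  shows "f \<in> \<mu> \<rightarrow>\<^sub>M N"
  using assms unfolding circle_measure_def by (intro measurable_completion) simp

lemma continuous_on_measurable_circle:
  fixes f :: "complex \<Rightarrow> 'a::topological_space"
  assumes "continuous_on (sphere 0 1) f"
  shows "f \<in> borel_measurable \<mu>"
  using assms by (intro measurable_circleI borel_measurable_continuous_on_restrict)

lemma borel_measurable_circle:
  "f \<in> borel_measurable borel \<Longrightarrow> f \<in> borel_measurable \<mu>"
  by (intro measurable_circleI measurable_restrict_space1)

lemma borel_sets_circle: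
  "A \<in> sets borel \<Longrightarrow> A \<inter> sphere 0 1 \<in> sets \<mu>"
  unfolding circle_measure_def
  by (intro sets_completionI_sets) (auto simp: sets_restrict_space)

lemma powi_measurable_circle [measurable]: "(\<lambda>\<zeta>. \<zeta> powi k) \<in> borel_measurable \<mu>"
  by (intro continuous_on_measurable_circle continuous_intros) auto

lemma id_measurable_circle [measurable]: "(\<lambda>\<zeta>. \<zeta>) \<in> borel_measurable \<mu>"
  by (intro continuous_on_measurable_circle continuous_intros)

lemma AE_circle_norm: "AE \<zeta> in \<mu>. norm \<zeta> = 1"
  by (rule AE_I2) simp

lemma integral_circle:
  fixes f :: "complex \<Rightarrow> 'a::{banach, second_countable_topology}"
  assumes f: "continuous_on (sphere 0 1) f"
  shows "(\<integral>\<zeta>. f \<zeta> \<partial>\<mu>) = (1 / (2*pi)) *\<^sub>R (\<integral>t. indicator {0..2*pi} t *\<^sub>R f (cis t) \<partial>lborel)"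
proof -
  have m: "f \<in> borel_measurable (restrict_space borel (sphere 0 1))"
    by (rule borel_measurable_continuous_on_restrict[OF f])
  have [measurable]: "(\<lambda>t. f (cis t)) \<in> borel_measurable borel"
    by (intro borel_measurable_continuous_onI continuous_on_compose2[OF f] continuous_intros) auto
  have "(\<integral>\<zeta>. f \<zeta> \<partial>\<mu>) = (\<integral>t. f (cis t) \<partial>uniform_measure lborel {0..2*pi})"
    unfolding circle_measure_def using m by (subst integral_completion) (auto simp: integral_distr)
  also have "\<dots> = (\<integral>t. f (cis t) \<partial>density lborel (\<lambda>t. ennreal (indicator {0..2*pi} t / (2*pi))))"
  proof -
    have "uniform_measure lborel {0..2*pi} = density lborel (\<lambda>t. ennreal (indicator {0..2*pi} t / (2*pi)))"
      unfolding uniform_measure_def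
      by (intro arg_cong[where f="density lborel"] ext) 
        (auto simp: indicator_def divide_ennreal[symmetric] ennreal_1[symmetric] simp del: ennreal_1)
    then show ?thesis by simp
  qed
  also have "\<dots> = (\<integral>t. (indicator {0..2*pi} t / (2*pi)) *\<^sub>R f (cis t) \<partial>lborel)"
    by (intro integral_density) auto
  also have "\<dots> = (\<integral>t. (1/(2*pi)) *\<^sub>R (indicator {0..2*pi} t *\<^sub>R f (cis t)) \<partial>lborel)"
    by (intro Bochner_Integration.integral_cong) auto
  also have "\<dots> = (1/(2*pi)) *\<^sub>R (\<integral>t. indicator {0..2*pi} t *\<^sub>R f (cis t) \<partial>lborel)"
    by (rule integral_scaleR_right)
  finally show ?thesis .
qed

lemma integral_powi_circle:
  "(\<integral>\<zeta>. \<zeta> powi k \<partial>\<mu>) = (if k = 0 then 1 else 0)"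
proof (cases "k = 0")
  case True
  then show ?thesis using circle.prob_space by simp
next
  case False
  define F where "F t = cis (of_int k * t) / (\<i> * of_int k)" for t
  have "has_bochner_integral lborel (\<lambda>t. indicator {0..2*pi} t *\<^sub>R cis (of_int k * t)) (F (2*pi) - F 0)"
  proof (rule has_bochner_integral_FTC_Icc)
    fix t show "(F has_vector_derivative cis (of_int k * t)) (at t within {0..2*pi})"
      unfolding F_def cis_conv_exp using False
      by (auto intro!: derivative_eq_intros has_vector_derivative_real_field simp: field_simps)
  qed (auto intro!: continuous_intros)
  moreover have "F (2*pi) - F 0 = 0"
  proof -
    have "cis (of_int k * (2*pi)) = 1"
      by (metis cis_multiple_2pi Ints_of_int mult.commute)
    then show ?thesis unfolding F_def by simp
  qed
  moreover have "continuous_on (sphere 0 1) (\<lambda>\<zeta>::complex. \<zeta> powi k)"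
    by (intro continuous_intros) auto
  ultimately show ?thesis
    using False by (simp add: integral_circle cis_power_int has_bochner_integral_integral_eq mult.commute)
qed

text \<open>Near 1 the logarithm is Lipschitz with constant 2, so a short arc is at most twice as long as its chord. This linear bound
  is the only geometric fact behind the maximal inequality.\<close>

lemma arc_measure_le:
  assumes "norm \<zeta> = 1" "0 < s"
  shows "measure \<mu> (ball \<zeta> s \<inter> sphere 0 1) \<le> 2 * s"
proof (cases "s \<le> 1/2")
  case False
  then show ?thesis
    using circle.prob_le_1[of "ball \<zeta> s \<inter> sphere 0 1"] by linarith
next
  case True
  obtain a where a: "0 \<le> a" "a < 2*pi" "\<zeta> = cis a"
    using complex_unimodular_polar[OF \<open>norm \<zeta> = 1\<close>] by (auto simp: complex_eq_iff)
  let ?B = "ball \<zeta> s \<inter> sphere 0 1"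
  let ?I = "\<lambda>n::int. {a + 2*pi*n - 2 * s .. a + 2*pi*n + 2 * s}"
  have B: "?B \<in> sets (restrict_space borel (sphere 0 1))"
    by (auto simp: sets_restrict_space)
  \<comment> \<open>An angle near that of \<open>\<zeta>\<close> modulo a full turn: inside \<open>[0, 2\<pi>]\<close> at most three turns matter.\<close>
  have sub: "{0..2*pi} \<inter> cis -` ?B \<subseteq> ?I (-1) \<union> ?I 0 \<union> ?I 1"
  proof
    fix t assume t: "t \<in> {0..2*pi} \<inter> cis -` ?B"
    define w where "w = cis (t - a)"
    have "norm (w - 1) = norm (cis a * (w - 1))"
      by (simp add: norm_mult)
    also have "cis a * (w - 1) = cis t - cis a"
      by (simp add: w_def algebra_simps cis_mult)
    finally have nw: "norm (w - 1) < s"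
      using t a by (simp add: dist_norm norm_minus_commute)
    have "norm (Ln (1 + (w - 1))) \<le> 2 * norm (w - 1)"
      using nw True by (intro norm_Ln_le) simp
    then have L: "norm (Ln w) < 2 * s" using nw by simp
    have "w \<noteq> 0" by (simp add: w_def)
    then have "exp (\<i> * of_real (t - a)) = exp (Ln w)"
      by (simp add: w_def cis_conv_exp)
    then obtain n :: int where n: "\<i> * of_real (t - a) = Ln w + (of_int (2*n)*pi)*\<i>"
      unfolding exp_eq by blast
    have "Im (\<i> * of_real (t - a)) = Im (Ln w + (of_int (2*n)*pi)*\<i>)" using n by simp
    then have "t - a - 2*pi*n = Im (Ln w)" by simp
    also have "\<bar>Im (Ln w)\<bar> \<le> norm (Ln w)" by (rule abs_Im_le_cmod)
    finally have d: "\<bar>t - a - 2*pi*n\<bar> < 2 * s" using L by simp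
    have pi3: "pi > 3" by (rule pi_gt3)
    have "\<bar>2*pi*n\<bar> < 2*pi + 1" using d t a True by auto
    also have "\<dots> < 2 * pi * 2" using pi3 by simp
    finally have "\<bar>real_of_int n\<bar> < 2" using pi_gt_zero by (simp add: abs_mult)
    then have "n = -1 \<or> n = 0 \<or> n = 1" by linarith
    then show "t \<in> ?I (-1) \<union> ?I 0 \<union> ?I 1" using d by auto
  qed
  have cm: "cis -` ?B \<in> sets borel"
  proof (rule measurable_sets_borel)
    show "cis \<in> borel_measurable borel"
      by (intro borel_measurable_continuous_onI continuous_intros)
  qed auto
  have "emeasure \<mu> ?B = emeasure lborel ({0..2*pi} \<inter> cis -` ?B) / emeasure lborel {0..2*pi}"
    unfolding circle_measure_def using B cm
    by (subst emeasure_completion) (auto simp: emeasure_distr Int_ac)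
  also have "\<dots> \<le> ennreal (12 * s) / emeasure lborel {0..2*pi}"
  proof (rule divide_right_mono_ennreal)
    have "emeasure lborel ({0..2*pi} \<inter> cis -` ?B) \<le> emeasure lborel (?I (-1) \<union> ?I 0 \<union> ?I 1)"
      using sub by (rule emeasure_mono) auto
    also have "\<dots> \<le> emeasure lborel (?I (-1)) + emeasure lborel (?I 0) + emeasure lborel (?I 1)"
      by (intro order_trans[OF emeasure_subadditive] add_mono emeasure_subadditive) auto
    also have "\<dots> = ennreal (12 * s)"
      using \<open>0 < s\<close> by (simp add: ennreal_plus[symmetric] del: ennreal_plus)
    finally show "emeasure lborel ({0..2*pi} \<inter> cis -` ?B) \<le> ennreal (12 * s)" .
  qed
  also have "\<dots> = ennreal (12 * s / (2*pi))"
    using \<open>0 < s\<close> by (simp add: divide_ennreal)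
  also have "\<dots> \<le> ennreal (2 * s)"
    using \<open>0 < s\<close> pi_gt3 by (intro ennreal_leI) (simp add: field_simps)
  finally show ?thesis
    using \<open>0 < s\<close> by (simp add: circle.emeasure_eq_measure)
qed

section \<open>Square integrable functions\<close>

lemma discriminant_nonpos:
  fixes a b c :: real
  assumes "\<And>t. 0 \<le> a + 2 * t * b + t\<^sup>2 * c"
  shows "b\<^sup>2 \<le> a * c"
proof (cases "c = 0")
  case True
  have "b = 0"
  proof (rule ccontr)
    assume "b \<noteq> 0"
    then show False
      using assms[of "- (a + 1) / (2 * b)"] True by (simp add: field_simps)
  qed
  then show ?thesis using True by simp
next
  case False
  have "0 \<le> c"
  proof (rule ccontr)
    assume "\<not> 0 \<le> c"
    define t where "t = (\<bar>a\<bar> + 2 * \<bar>b\<bar> + 1) / (- c) + 1"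
    have "0 \<le> (\<bar>a\<bar> + 2 * \<bar>b\<bar> + 1) / (- c)" using \<open>\<not> 0 \<le> c\<close> by (intro divide_nonneg_nonneg) auto
    then have t: "1 \<le> t" by (simp only: t_def)
    have "t * (- c) = \<bar>a\<bar> + 2 * \<bar>b\<bar> + 1 - c" using \<open>\<not> 0 \<le> c\<close> by (simp add: t_def field_simps)
    then have "t * (t * (- c)) = t * (\<bar>a\<bar> + 2 * \<bar>b\<bar> + 1 - c)" by simp
    moreover have "t * \<bar>a\<bar> \<ge> \<bar>a\<bar>" using t mult_right_mono[of 1 t "\<bar>a\<bar>"] by simp
    moreover have "t * b \<le> t * \<bar>b\<bar>" using t by (intro mult_left_mono) auto
    moreover have "t * (1 - c) > 0" using t \<open>\<not> 0 \<le> c\<close> by (intro mult_pos_pos) auto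
    ultimately have "a + 2 * t * b + t\<^sup>2 * c < 0"
      by (simp add: power2_eq_square algebra_simps)
    with assms[of t] show False by simp
  qed
  with False have "c > 0" by simp
  with assms[of "- b / c"] show ?thesis
    by (simp add: field_simps power2_eq_square)
qed

text \<open>Representatives of \<open>L\<^sup>2\<close> functions do not form a normed space, and the extension step below uses a second
  form that is equivalent to the inner product. Both are instances of the following setting: a positive
  semidefinite form on a space of functions.\<close>

locale semi_inner_space =
  fixes V :: "('a \<Rightarrow> 'b::real_vector) set" and b :: "('a \<Rightarrow> 'b) \<Rightarrow> ('a \<Rightarrow> 'b) \<Rightarrow> real"
  assumes lin_closed: "\<And>f g c. f \<in> V \<Longrightarrow> g \<in> V \<Longrightarrow> (\<lambda>x. f x + c *\<^sub>R g x) \<in> V"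
    and sym: "\<And>f g. f \<in> V \<Longrightarrow> g \<in> V \<Longrightarrow> b f g = b g f"
    and lin: "\<And>f g h c. f \<in> V \<Longrightarrow> g \<in> V \<Longrightarrow> h \<in> V \<Longrightarrow> b (\<lambda>x. f x + c *\<^sub>R g x) h = b f h + c * b g h"
    and nonneg: "\<And>f. f \<in> V \<Longrightarrow> 0 \<le> b f f"
begin

lemma lin_right:
  "f \<in> V \<Longrightarrow> g \<in> V \<Longrightarrow> h \<in> V \<Longrightarrow> b h (\<lambda>x. f x + c *\<^sub>R g x) = b h f + c * b h g"
  using lin[of f g h c] sym[of h f] sym[of h g] sym[of h "\<lambda>x. f x + c *\<^sub>R g x"] lin_closed[of f g c] by simp

lemma quad_expand:
  assumes "f \<in> V" "g \<in> V"
  shows "b (\<lambda>x. f x + c *\<^sub>R g x) (\<lambda>x. f x + c *\<^sub>R g x) = b f f + 2 * c * b f g + c\<^sup>2 * b g g"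
  unfolding lin[OF assms lin_closed[OF assms]] lin_right[OF assms assms(1)] lin_right[OF assms assms(2)]
  using sym[OF assms] by (simp add: power2_eq_square algebra_simps)

lemma cauchy_schwarz_square:
  assumes "f \<in> V" "g \<in> V"
  shows "(b f g)\<^sup>2 \<le> b f f * b g g"
proof (rule discriminant_nonpos)
  fix t :: real
  show "0 \<le> b f f + 2 * t * b f g + t\<^sup>2 * b g g"
    using nonneg[OF lin_closed[OF assms, of t]] by (simp only: quad_expand[OF assms])
qed

lemma cauchy_schwarz:
  assumes "f \<in> V" "g \<in> V"
  shows "\<bar>b f g\<bar> \<le> sqrt (b f f) * sqrt (b g g)"
  using cauchy_schwarz_square[OF assms] by (metis real_sqrt_abs real_sqrt_le_mono real_sqrt_mult)

lemma triangle:
  assumes "f \<in> V" "g \<in> V"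
  shows "sqrt (b (\<lambda>x. f x + c *\<^sub>R g x) (\<lambda>x. f x + c *\<^sub>R g x)) \<le> sqrt (b f f) + \<bar>c\<bar> * sqrt (b g g)"
proof (rule real_le_lsqrt)
  have "c * b f g \<le> \<bar>c\<bar> * (sqrt (b f f) * sqrt (b g g))"
    using cauchy_schwarz[OF assms] by (metis abs_ge_self abs_ge_zero abs_mult mult_left_mono order_trans)
  then show "b (\<lambda>x. f x + c *\<^sub>R g x) (\<lambda>x. f x + c *\<^sub>R g x) \<le> (sqrt (b f f) + \<bar>c\<bar> * sqrt (b g g))\<^sup>2"
    using assms nonneg by (simp add: quad_expand power2_sum power_mult_distrib mult_ac)
qed (use assms nonneg in auto)

lemma parallelogram:
  assumes "f \<in> V" "g \<in> V"
  shows "b (\<lambda>x. f x - g x) (\<lambda>x. f x - g x) + b (\<lambda>x. f x + g x) (\<lambda>x. f x + g x) = 2 * b f f + 2 * b g g"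
  using quad_expand[OF assms, of 1] quad_expand[OF assms, of "-1"] by simp

text \<open>Hilbert's projection theorem: a minimizing sequence is Cauchy by the parallelogram law.\<close>

lemma projection_exists:
  assumes M: "M \<subseteq> V" "M \<noteq> {}"
    and M_lin: "\<And>f g c. f \<in> M \<Longrightarrow> g \<in> M \<Longrightarrow> (\<lambda>x. f x + c *\<^sub>R g x) \<in> M"
    and complete: "\<And>X. (\<And>n::nat. X n \<in> M) \<Longrightarrow>
      (\<And>e. e > 0 \<Longrightarrow> \<exists>N. \<forall>m\<ge>N. \<forall>n\<ge>N. b (\<lambda>x. X m x - X n x) (\<lambda>x. X m x - X n x) < e) \<Longrightarrow>
      \<exists>g\<in>M. (\<lambda>n. b (\<lambda>x. X n x - g x) (\<lambda>x. X n x - g x)) \<longlonglongrightarrow> 0"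
    and f: "f \<in> V"
  shows "\<exists>g\<in>M. \<forall>h\<in>M. b (\<lambda>x. f x - g x) h = 0"
proof -
  define q where "q h = b h h" for h
  define D where "D m x = f x - m x" for m x
  have DV: "D m \<in> V" if "m \<in> M" for m
    using lin_closed[of f m "-1"] that M f by (auto simp: D_def[abs_def])
  define d where "d = (INF m\<in>M. q (D m))"
  have bdd: "bdd_below ((\<lambda>m. q (D m)) ` M)"
    using nonneg DV by (auto simp: q_def intro!: bdd_belowI[of _ 0])
  have d_le: "d \<le> q (D m)" if "m \<in> M" for m
    unfolding d_def using bdd that by (rule cINF_lower)
  have "\<exists>m\<in>M. q (D m) < d + 1 / real (Suc n)" for n
  proof -
    have "(INF m\<in>M. q (D m)) < d + 1 / real (Suc n)" by (simp add: d_def)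
    then show ?thesis using M(2) bdd by (subst (asm) cINF_less_iff) auto
  qed
  then obtain X where X: "\<And>n. X n \<in> M" "\<And>n. q (D (X n)) < d + 1 / real (Suc n)" by metis
  have close: "q (\<lambda>x. X i x - X j x) \<le> 2 / real (Suc i) + 2 / real (Suc j)" for i j
  proof -
    define m where "m = (\<lambda>x. (1/2) *\<^sub>R (X i x + X j x))"
    have "(\<lambda>x. X i x + (-1) *\<^sub>R X i x) \<in> M" by (intro M_lin X)
    then have "(\<lambda>x. (X i x + (-1) *\<^sub>R X i x) + (1/2) *\<^sub>R (X i x + 1 *\<^sub>R X j x)) \<in> M"
      by (intro M_lin X)
    then have mM: "m \<in> M" by (simp add: m_def)
    have e1: "(\<lambda>x. D (X j) x - D (X i) x) = (\<lambda>x. X i x - X j x)"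
      by (auto simp: D_def fun_eq_iff)
    have e2: "(\<lambda>x. D (X j) x + D (X i) x) = (\<lambda>x. D m x + 1 *\<^sub>R D m x)"
      by (auto simp: D_def m_def fun_eq_iff algebra_simps scaleR_2[symmetric])
    have "q (\<lambda>x. D m x + 1 *\<^sub>R D m x) = 4 * q (D m)"
      using quad_expand[OF DV[OF mM] DV[OF mM], of 1] by (simp add: q_def)
    moreover have "q (\<lambda>x. X i x - X j x) + q (\<lambda>x. D m x + 1 *\<^sub>R D m x) = 2 * q (D (X j)) + 2 * q (D (X i))"
      using parallelogram[OF DV[OF X(1)] DV[OF X(1)], of j i] unfolding e1 e2 by (simp add: q_def)
    ultimately show ?thesis using d_le[OF mM] X(2)[of i] X(2)[of j] by simp
  qed
  have "\<exists>g\<in>M. (\<lambda>n. q (\<lambda>x. X n x - g x)) \<longlonglongrightarrow> 0"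
    unfolding q_def
  proof (rule complete[OF X(1)])
    fix e :: real assume "e > 0"
    then obtain N :: nat where N: "4 / e < real N" using reals_Archimedean2 by blast
    have "b (\<lambda>x. X m x - X n x) (\<lambda>x. X m x - X n x) < e" if "m \<ge> N" "n \<ge> N" for m n
    proof -
      have *: "2 / real (Suc k) < e / 2" if "k \<ge> N" for k
      proof -
        have "4 / e < real (Suc k)" using N that by simp
        then show ?thesis using \<open>e > 0\<close> by (simp add: field_simps)
      qed
      from *[OF that(1)] *[OF that(2)] close[of m n] show ?thesis by (simp add: q_def)
    qed
    then show "\<exists>N. \<forall>m\<ge>N. \<forall>n\<ge>N. b (\<lambda>x. X m x - X n x) (\<lambda>x. X m x - X n x) < e" by blast
  qed
  then obtain g where g: "g \<in> M" "(\<lambda>n. q (\<lambda>x. X n x - g x)) \<longlonglongrightarrow> 0" by blast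
  have q_min: "q (D g) \<le> d"
  proof -
    have "sqrt (q (D g)) \<le> sqrt (d + 1 / real (Suc n)) + sqrt (q (\<lambda>x. X n x - g x))" for n
    proof -
      have E: "(\<lambda>x. X n x - g x) \<in> V" using lin_closed[of "X n" g "-1"] X(1)[of n] g M by auto
      have "D g = (\<lambda>x. D (X n) x + 1 *\<^sub>R (X n x - g x))" by (auto simp: D_def)
      then have "sqrt (q (D g)) \<le> sqrt (q (D (X n))) + sqrt (q (\<lambda>x. X n x - g x))"
        using triangle[OF DV[OF X(1)[of n]] E, of 1] by (simp add: q_def)
      moreover have "sqrt (q (D (X n))) \<le> sqrt (d + 1 / real (Suc n))"
        using X(2)[of n] by simp
      ultimately show ?thesis by linarith
    qed
    moreover have "(\<lambda>n. sqrt (d + 1 / real (Suc n)) + sqrt (q (\<lambda>x. X n x - g x)))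
                     \<longlonglongrightarrow> sqrt (d + 0) + sqrt 0"
      by (intro tendsto_intros g LIMSEQ_Suc lim_1_over_n)
    ultimately have "sqrt (q (D g)) \<le> sqrt (d + 0) + sqrt 0"
      by (intro LIMSEQ_le_const) auto
    then show ?thesis by simp
  qed
  have "b (D g) h = 0" if h: "h \<in> M" for h
  proof -
    have "0 \<le> 0 + 2 * t * b (D g) h + t\<^sup>2 * b h h" for t
    proof -
      have "(\<lambda>x. g x + (- t) *\<^sub>R h x) \<in> M" by (intro M_lin g h)
      from d_le[OF this] have "d \<le> q (\<lambda>x. D g x + t *\<^sub>R h x)"
        by (simp add: D_def[abs_def] algebra_simps)
      also have "\<dots> = q (D g) + 2 * t * b (D g) h + t\<^sup>2 * b h h"
        unfolding q_def using h M g by (intro quad_expand DV) auto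
      finally show ?thesis using q_min by simp
    qed
    from discriminant_nonpos[OF this] show ?thesis by simp
  qed
  then show ?thesis using g(1) by (auto simp: D_def[abs_def])
qed

end

lemma bounded_bilinear_scalar_vec: "bounded_bilinear (\<lambda>c (x::complex^'n::finite). c *s x)"
proof (subst bilinear_conv_bounded_bilinear[symmetric], unfold bilinear_def, safe)
  show "linear (\<lambda>y. c *s y)" for c :: complex
    by (intro linearI) (simp_all add: vec_eq_iff algebra_simps)
  show "linear (\<lambda>c. c *s y)" for y :: "complex^'n"
    by (intro linearI) (simp_all add: vec_eq_iff algebra_simps)
qed

lemma bounded_bilinear_matrix_vec:
  "bounded_bilinear (\<lambda>(A::complex^'n::finite^'m::finite) x. A *v x)"
proof (subst bilinear_conv_bounded_bilinear[symmetric], unfold bilinear_def, safe)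
  show "linear (\<lambda>y. A *v y)" for A :: "complex^'n^'m"
    by (intro linearI) (simp_all add: matrix_vector_mult_def vec_eq_iff algebra_simps sum.distrib scaleR_sum_right)
  show "linear (\<lambda>A. A *v y)" for y :: "complex^'n"
    by (intro linearI) (simp_all add: matrix_vector_mult_def vec_eq_iff algebra_simps sum.distrib scaleR_sum_right)
qed

lemmas scalar_vec_continuous [continuous_intros] =
  bounded_bilinear.continuous_on[OF bounded_bilinear_scalar_vec]
lemmas matrix_vec_continuous [continuous_intros] =
  bounded_bilinear.continuous_on[OF bounded_bilinear_matrix_vec]
lemmas scalar_vec_tendsto [tendsto_intros] =
  bounded_bilinear.tendsto[OF bounded_bilinear_scalar_vec]
lemmas matrix_vec_tendsto [tendsto_intros] =
  bounded_bilinear.tendsto[OF bounded_bilinear_matrix_vec]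

lemma scalar_vec_measurable [measurable]:
  fixes f :: "'a \<Rightarrow> complex^'n::finite"
  assumes [measurable]: "h \<in> borel_measurable M" "f \<in> borel_measurable M"
  shows "(\<lambda>x. h x *s f x) \<in> borel_measurable M"
proof -
  have "(\<lambda>p::complex \<times> (complex^'n). fst p *s snd p) \<in> borel_measurable borel"
    by (intro borel_measurable_continuous_onI continuous_intros)
  then have "(\<lambda>x. (\<lambda>p::complex \<times> (complex^'n). fst p *s snd p) (h x, f x)) \<in> borel_measurable M"
    by measurable
  then show ?thesis by simp
qed

lemma matrix_vec_measurable [measurable]:
  fixes f :: "'a \<Rightarrow> complex^'n::finite" and A :: "'a \<Rightarrow> complex^'n^'m::finite"
  assumes [measurable]: "A \<in> borel_measurable M" "f \<in> borel_measurable M"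
  shows "(\<lambda>x. A x *v f x) \<in> borel_measurable M"
proof -
  have "(\<lambda>p::(complex^'n^'m) \<times> (complex^'n). fst p *v snd p) \<in> borel_measurable borel"
    by (intro borel_measurable_continuous_onI continuous_intros)
  then have "(\<lambda>x. (\<lambda>p::(complex^'n^'m) \<times> (complex^'n). fst p *v snd p) (A x, f x)) \<in> borel_measurable M"
    by measurable
  then show ?thesis by simp
qed

lemma vec_nth_measurable [measurable]:
  fixes f :: "'a \<Rightarrow> 'b::euclidean_space^'n::finite"
  assumes "f \<in> borel_measurable M"
  shows "(\<lambda>x. f x $ i) \<in> borel_measurable M"
  using assms by (rule borel_measurable_continuous_on[rotated]) (intro continuous_intros)

lemma norm_scalar_vec [simp]: "norm (c *s (x::complex^'n::finite)) = norm c * norm x"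
  by (simp add: norm_vec_def L2_set_def norm_mult power_mult_distrib sum_distrib_left[symmetric] real_sqrt_mult)

lemma inner_scalar_vec:
  fixes x y :: "complex^'n::finite"
  shows "(c *s x) \<bullet> y = x \<bullet> (cnj c *s y)"
  by (auto simp: inner_vec_def inner_complex_def algebra_simps intro!: sum.cong)

lemma inner_scalar_vec_left_right:
  fixes x y :: "complex^'n::finite"
  shows "(c *s x) \<bullet> (d *s y) = (cnj d * c *s x) \<bullet> y"
  by (simp add: inner_scalar_vec vector_smult_assoc mult.commute)

lemma scaleR_as_scalar_vec: "r *\<^sub>R (x::complex^'n::finite) = of_real r *s x"
  unfolding vec_eq_iff by (simp add: scaleR_conv_of_real[symmetric])

text \<open>The real part of the complex inner product. It makes \<open>L\<^sup>2\<close> an instance of the locale above, and on complex subspaces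
  it detects the same orthogonality as the complex form.\<close>

definition ip :: "(complex \<Rightarrow> complex^'n::finite) \<Rightarrow> (complex \<Rightarrow> complex^'n) \<Rightarrow> real" where
  "ip f g = (\<integral>\<zeta>. f \<zeta> \<bullet> g \<zeta> \<partial>\<mu>)"

lemma L2_measurable [measurable_dest]: "f \<in> L2 \<Longrightarrow> f \<in> borel_measurable \<mu>"
  by (simp add: L2_def)

lemma L2_integrable: "f \<in> L2 \<Longrightarrow> integrable \<mu> (\<lambda>\<zeta>. (norm (f \<zeta>))\<^sup>2)"
  by (simp add: L2_def)

lemma L2_I_bound:
  assumes [measurable]: "f \<in> borel_measurable \<mu>" and "integrable \<mu> h"
    and "AE \<zeta> in \<mu>. (norm (f \<zeta>))\<^sup>2 \<le> h \<zeta>"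
  shows "f \<in> L2"
  unfolding L2_def using assms(2,3)
  by (auto intro!: Bochner_Integration.integrable_bound[OF assms(2)])

lemma L2_cong_AE:
  assumes "f \<in> L2" "AE \<zeta> in \<mu>. f \<zeta> = g \<zeta>" "g \<in> borel_measurable \<mu>"
  shows "g \<in> L2"
  by (rule L2_I_bound[OF assms(3) L2_integrable[OF assms(1)]]) (use assms(2) in auto)

lemma L2_lin:
  assumes [measurable]: "f \<in> L2" "g \<in> L2"
  shows "(\<lambda>x. f x + c *\<^sub>R g x) \<in> L2"
proof (rule L2_I_bound)
  show "integrable \<mu> (\<lambda>\<zeta>. 2 * (norm (f \<zeta>))\<^sup>2 + 2 * c\<^sup>2 * (norm (g \<zeta>))\<^sup>2)"
    by (intro Bochner_Integration.integrable_add integrable_mult_right L2_integrable assms)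
  show "AE \<zeta> in \<mu>. (norm (f \<zeta> + c *\<^sub>R g \<zeta>))\<^sup>2 \<le> 2 * (norm (f \<zeta>))\<^sup>2 + 2 * c\<^sup>2 * (norm (g \<zeta>))\<^sup>2"
  proof (rule AE_I2)
    fix \<zeta>
    have "(norm (f \<zeta> + c *\<^sub>R g \<zeta>))\<^sup>2 \<le> (norm (f \<zeta>) + \<bar>c\<bar> * norm (g \<zeta>))\<^sup>2"
      using norm_triangle_ineq[of "f \<zeta>" "c *\<^sub>R g \<zeta>"] by (intro power_mono) auto
    also have "\<dots> \<le> 2 * (norm (f \<zeta>))\<^sup>2 + 2 * (\<bar>c\<bar> * norm (g \<zeta>))\<^sup>2"
      using sum_squares_bound[of "norm (f \<zeta>)" "\<bar>c\<bar> * norm (g \<zeta>)"] by (simp add: power2_sum)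
    finally show "(norm (f \<zeta> + c *\<^sub>R g \<zeta>))\<^sup>2 \<le> 2 * (norm (f \<zeta>))\<^sup>2 + 2 * c\<^sup>2 * (norm (g \<zeta>))\<^sup>2"
      by (simp add: power_mult_distrib)
  qed
qed measurable

lemma L2_add: "f \<in> L2 \<Longrightarrow> g \<in> L2 \<Longrightarrow> (\<lambda>x. f x + g x) \<in> L2"
  using L2_lin[of f g 1] by simp

lemma L2_diff: "f \<in> L2 \<Longrightarrow> g \<in> L2 \<Longrightarrow> (\<lambda>x. f x - g x) \<in> L2"
  using L2_lin[of f g "-1"] by simp

lemma L2_zero [simp]: "(\<lambda>_. 0) \<in> L2"
  by (simp add: L2_def)

lemma L2_const [simp]: "(\<lambda>_. c) \<in> L2"
  by (simp add: L2_def)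

lemma L2_mult:
  assumes f[measurable]: "f \<in> L2" and h[measurable]: "h \<in> borel_measurable \<mu>"
    and B: "AE \<zeta> in \<mu>. norm (h \<zeta>) \<le> C"
  shows "(\<lambda>\<zeta>. h \<zeta> *s f \<zeta>) \<in> L2"
proof (rule L2_I_bound)
  show "integrable \<mu> (\<lambda>\<zeta>. C\<^sup>2 * (norm (f \<zeta>))\<^sup>2)" using L2_integrable[OF f] by simp
  show "AE \<zeta> in \<mu>. (norm (h \<zeta> *s f \<zeta>))\<^sup>2 \<le> C\<^sup>2 * (norm (f \<zeta>))\<^sup>2"
    using B by eventually_elim (auto simp: power_mult_distrib intro!: mult_right_mono power_mono)
qed measurable

lemma L2_mult_powi: "f \<in> L2 \<Longrightarrow> (\<lambda>\<zeta>. (\<zeta> powi k) *s f \<zeta>) \<in> L2"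
  by (rule L2_mult[where C=1]) (auto simp: norm_power_int)

lemma L2_cmult: "f \<in> L2 \<Longrightarrow> (\<lambda>\<zeta>. c *s f \<zeta>) \<in> L2"
  by (rule L2_mult[where C="norm c"]) auto

lemma L2_sum: "(\<And>i. i \<in> A \<Longrightarrow> f i \<in> L2) \<Longrightarrow> (\<lambda>\<zeta>. \<Sum>i\<in>A. f i \<zeta>) \<in> L2"
  by (induction A rule: infinite_finite_induct) (auto intro: L2_add)

lemma L2_matrix_mult:
  assumes f[measurable]: "f \<in> L2" and h[measurable]: "\<Phi> \<in> borel_measurable \<mu>"
    and B: "AE \<zeta> in \<mu>. \<forall>x. norm (\<Phi> \<zeta> *v x) \<le> C * norm x"
  shows "(\<lambda>\<zeta>. \<Phi> \<zeta> *v f \<zeta>) \<in> L2"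
proof (rule L2_I_bound)
  show "integrable \<mu> (\<lambda>\<zeta>. C\<^sup>2 * (norm (f \<zeta>))\<^sup>2)" using L2_integrable[OF f] by simp
  show "AE \<zeta> in \<mu>. (norm (\<Phi> \<zeta> *v f \<zeta>))\<^sup>2 \<le> C\<^sup>2 * (norm (f \<zeta>))\<^sup>2"
    using B by eventually_elim (metis norm_ge_zero power_mono power_mult_distrib)
qed measurable

lemma ip_integrable:
  assumes f[measurable]: "f \<in> L2" and g[measurable]: "g \<in> L2"
  shows "integrable \<mu> (\<lambda>\<zeta>. f \<zeta> \<bullet> g \<zeta>)"
proof (rule Bochner_Integration.integrable_bound)
  show "integrable \<mu> (\<lambda>\<zeta>. (norm (f \<zeta>))\<^sup>2 + (norm (g \<zeta>))\<^sup>2)"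
    using assms by (auto intro: L2_integrable)
  have "\<bar>x \<bullet> y\<bar> \<le> (norm x)\<^sup>2 + (norm y)\<^sup>2" for x y :: "complex^'n"
    using Cauchy_Schwarz_ineq2[of x y] sum_squares_bound[of "norm x" "norm y"]
      mult_nonneg_nonneg[of "norm x" "norm y"] by simp
  then show "AE \<zeta> in \<mu>. norm (f \<zeta> \<bullet> g \<zeta>) \<le> norm ((norm (f \<zeta>))\<^sup>2 + (norm (g \<zeta>))\<^sup>2)"
    by (intro AE_I2) simp
qed measurable

lemma L2_integrable_vec:
  assumes f[measurable]: "f \<in> L2"
  shows "integrable \<mu> f"
proof (rule Bochner_Integration.integrable_bound)
  show "integrable \<mu> (\<lambda>\<zeta>. 1 + (norm (f \<zeta>))\<^sup>2)"
    using assms by (auto intro: L2_integrable)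
  have "norm x \<le> 1 + (norm x)\<^sup>2" for x :: "complex^'n"
    using sum_squares_bound[of 1 "norm x"] norm_ge_zero[of x] unfolding power_one by linarith
  then show "AE \<zeta> in \<mu>. norm (f \<zeta>) \<le> norm (1 + (norm (f \<zeta>))\<^sup>2)"
    by (intro AE_I2) simp
qed measurable

lemma ip_self: "ip f f = (L2_norm f)\<^sup>2"
  by (simp add: ip_def L2_norm_def dot_square_norm integral_nonneg_AE)

lemma L2_norm_sqrt: "L2_norm f = sqrt (ip f f)"
  by (simp add: ip_def L2_norm_def dot_square_norm)

lemma L2_norm_nonneg [simp]: "0 \<le> L2_norm f"
  by (simp add: L2_norm_def)

interpretation L2: semi_inner_space L2 ip
proof
  fix f g h :: "complex \<Rightarrow> complex^'n" and c :: real
  assume L: "f \<in> L2" "g \<in> L2"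
  show "(\<lambda>x. f x + c *\<^sub>R g x) \<in> L2" by (rule L2_lin[OF L])
  show "ip f g = ip g f" by (simp add: ip_def inner_commute)
  assume h: "h \<in> L2"
  show "ip (\<lambda>x. f x + c *\<^sub>R g x) h = ip f h + c * ip g h"
    using L h by (simp add: ip_def inner_add_left ip_integrable)
next
  show "0 \<le> ip f f" for f :: "complex \<Rightarrow> complex^'n"
    by (simp add: ip_self)
qed

lemma ip_commute: "ip f g = ip g f"
  by (simp add: ip_def inner_commute)

lemma ip_add_left: "f \<in> L2 \<Longrightarrow> g \<in> L2 \<Longrightarrow> h \<in> L2 \<Longrightarrow> ip (\<lambda>x. f x + g x) h = ip f h + ip g h"
  using L2.lin[of f g h 1] by simp

lemma ip_diff_left: "f \<in> L2 \<Longrightarrow> g \<in> L2 \<Longrightarrow> h \<in> L2 \<Longrightarrow> ip (\<lambda>x. f x - g x) h = ip f h - ip g h"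
  using L2.lin[of f g h "-1"] by simp

lemma ip_add_right: "f \<in> L2 \<Longrightarrow> g \<in> L2 \<Longrightarrow> h \<in> L2 \<Longrightarrow> ip h (\<lambda>x. f x + g x) = ip h f + ip h g"
  using ip_add_left[of f g h] by (simp add: ip_commute)

lemma ip_sum_left:
  "(\<And>i. i \<in> A \<Longrightarrow> f i \<in> L2) \<Longrightarrow> h \<in> L2 \<Longrightarrow> ip (\<lambda>\<zeta>. \<Sum>i\<in>A. f i \<zeta>) h = (\<Sum>i\<in>A. ip (f i) h)"
  by (induction A rule: infinite_finite_induct) (auto simp: ip_add_left L2_sum, simp_all add: ip_def)

lemma ip_sum_right:
  "(\<And>i. i \<in> A \<Longrightarrow> f i \<in> L2) \<Longrightarrow> h \<in> L2 \<Longrightarrow> ip h (\<lambda>\<zeta>. \<Sum>i\<in>A. f i \<zeta>) = (\<Sum>i\<in>A. ip h (f i))"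
  using ip_sum_left[of A f h] by (simp add: ip_commute)

lemma ip_cong_AE:
  assumes "f \<in> L2" "g \<in> L2" "f' \<in> L2" "g' \<in> L2" "AE \<zeta> in \<mu>. f \<zeta> = f' \<zeta>" "AE \<zeta> in \<mu>. g \<zeta> = g' \<zeta>"
  shows "ip f g = ip f' g'"
  unfolding ip_def using assms by (intro integral_cong_AE) auto

lemma L2_norm_cong_AE:
  assumes "f \<in> L2" "g \<in> L2" "AE \<zeta> in \<mu>. f \<zeta> = g \<zeta>"
  shows "L2_norm f = L2_norm g"
  using ip_cong_AE[OF assms(1,1,2,2,3,3)] by (simp add: L2_norm_sqrt)

lemma ip_zero [simp]: "ip (\<lambda>_. 0) g = 0" "ip f (\<lambda>_. 0) = 0"
  by (simp_all add: ip_def)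

lemma ip_scalar:
  "ip (\<lambda>\<zeta>. h \<zeta> *s f \<zeta>) g = ip f (\<lambda>\<zeta>. cnj (h \<zeta>) *s g \<zeta>)"
  by (simp add: ip_def inner_scalar_vec)

lemma L2_cauchy_schwarz: "f \<in> L2 \<Longrightarrow> g \<in> L2 \<Longrightarrow> \<bar>ip f g\<bar> \<le> L2_norm f * L2_norm g"
  using L2.cauchy_schwarz[of f g] by (simp add: L2_norm_sqrt)

lemma L2_norm_triangle: "f \<in> L2 \<Longrightarrow> g \<in> L2 \<Longrightarrow> L2_norm (\<lambda>x. f x + g x) \<le> L2_norm f + L2_norm g"
  using L2.triangle[of f g 1] by (simp add: L2_norm_sqrt)

lemma L2_norm_triangle_diff: "f \<in> L2 \<Longrightarrow> g \<in> L2 \<Longrightarrow> L2_norm (\<lambda>x. f x - g x) \<le> L2_norm f + L2_norm g"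
  using L2.triangle[of f g "-1"] by (simp add: L2_norm_sqrt)

lemma L2_norm_minus_commute: "L2_norm (\<lambda>x. f x - g x) = L2_norm (\<lambda>x. g x - f x)"
  by (simp add: L2_norm_def norm_minus_commute)

lemma L2_norm_cmult: "L2_norm (\<lambda>x. c *s f x) = norm c * L2_norm f"
  by (simp add: L2_norm_def power_mult_distrib real_sqrt_mult)

lemma L2_norm_unimodular:
  assumes "f \<in> L2" "h \<in> borel_measurable \<mu>" "\<And>\<zeta>. norm \<zeta> = 1 \<Longrightarrow> norm (h \<zeta>) = 1"
  shows "L2_norm (\<lambda>\<zeta>. h \<zeta> *s f \<zeta>) = L2_norm f"
  unfolding L2_norm_def by (intro arg_cong[where f=sqrt] Bochner_Integration.integral_cong) (auto simp: assms(3))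

lemma L2_norm_eq_0_iff:
  assumes [measurable]: "f \<in> L2"
  shows "L2_norm f = 0 \<longleftrightarrow> (AE \<zeta> in \<mu>. f \<zeta> = 0)"
  using integral_nonneg_eq_0_iff_AE[OF L2_integrable[OF assms]] by (simp add: L2_norm_def)

lemma L2_norm_le_of_AE:
  assumes "f \<in> L2" "g \<in> L2" "AE \<zeta> in \<mu>. norm (f \<zeta>) \<le> C * norm (g \<zeta>)" "0 \<le> C"
  shows "L2_norm f \<le> C * L2_norm g"
proof -
  have "(\<integral>\<zeta>. (norm (f \<zeta>))\<^sup>2 \<partial>\<mu>) \<le> (\<integral>\<zeta>. C\<^sup>2 * (norm (g \<zeta>))\<^sup>2 \<partial>\<mu>)"
  proof (rule integral_mono_AE)
    show "AE \<zeta> in \<mu>. (norm (f \<zeta>))\<^sup>2 \<le> C\<^sup>2 * (norm (g \<zeta>))\<^sup>2"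
      using assms(3) by eventually_elim (metis norm_ge_zero power_mono power_mult_distrib)
  qed (use assms in \<open>auto intro: L2_integrable\<close>)
  then have "sqrt (\<integral>\<zeta>. (norm (f \<zeta>))\<^sup>2 \<partial>\<mu>) \<le> sqrt (C\<^sup>2 * (\<integral>\<zeta>. (norm (g \<zeta>))\<^sup>2 \<partial>\<mu>))"
    by (intro real_sqrt_le_mono) simp
  then show ?thesis using assms(4) by (simp add: L2_norm_def real_sqrt_mult)
qed

text \<open>On a probability space this is the nonnegativity of the variance.\<close>

lemma integral_norm_le_L2_norm:
  assumes "f \<in> L2"
  shows "(\<integral>\<zeta>. norm (f \<zeta>) \<partial>\<mu>) \<le> L2_norm f"
proof -
  have "(\<integral>\<zeta>. norm (f \<zeta>) \<partial>\<mu>)\<^sup>2 \<le> (\<integral>\<zeta>. (norm (f \<zeta>))\<^sup>2 \<partial>\<mu>)"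
  proof -
    have "0 \<le> (\<integral>\<zeta>. (norm (f \<zeta>) - circle.expectation (\<lambda>\<zeta>. norm (f \<zeta>)))\<^sup>2 \<partial>\<mu>)"
      by (simp add: integral_nonneg_AE)
    also have "\<dots> = (\<integral>\<zeta>. (norm (f \<zeta>))\<^sup>2 \<partial>\<mu>) - (\<integral>\<zeta>. norm (f \<zeta>) \<partial>\<mu>)\<^sup>2"
      using assms by (intro circle.variance_eq) (auto intro: L2_integrable L2_integrable_vec)
    finally show ?thesis by simp
  qed
  then show ?thesis unfolding L2_norm_def by (rule real_le_rsqrt)
qed

text \<open>An \<open>L\<^sup>2\<close>-Cauchy sequence has a subsequence that converges almost everywhere, and Fatou's lemma identifies that limit
  as the \<open>L\<^sup>2\<close>-limit of the whole sequence.\<close>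

lemma L2_complete:
  fixes X :: "nat \<Rightarrow> complex \<Rightarrow> complex^'n::finite"
  assumes X: "\<And>n. X n \<in> L2"
    and C: "\<And>e. e > 0 \<Longrightarrow> \<exists>N. \<forall>m\<ge>N. \<forall>n\<ge>N. L2_norm (\<lambda>\<zeta>. X m \<zeta> - X n \<zeta>) < e"
  shows "\<exists>g\<in>L2. (\<lambda>n. L2_norm (\<lambda>\<zeta>. X n \<zeta> - g \<zeta>)) \<longlonglongrightarrow> 0"
proof -
  note [measurable] = X[THEN L2_measurable]
  have D: "(\<lambda>\<zeta>. X m \<zeta> - X n \<zeta>) \<in> L2" for m n by (intro L2_diff X)
  obtain r where r: "strict_mono r" "AE \<zeta> in \<mu>. Cauchy (\<lambda>i. X (r i) \<zeta>)"
  proof (rule cauchy_L1_AE_cauchy_subseq[of \<mu> X])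
    show "integrable \<mu> (X n)" for n by (rule L2_integrable_vec[OF X])
    fix e :: real assume "e > 0"
    from C[OF this] obtain N where "\<forall>m\<ge>N. \<forall>n\<ge>N. L2_norm (\<lambda>\<zeta>. X m \<zeta> - X n \<zeta>) < e" by blast
    then show "\<exists>N. \<forall>i\<ge>N. \<forall>j\<ge>N. (\<integral>\<zeta>. norm (X i \<zeta> - X j \<zeta>) \<partial>\<mu>) < e"
      using integral_norm_le_L2_norm[OF D] by (meson le_less_trans)
  qed auto
  define g where "g \<zeta> = lim (\<lambda>i. X (r i) \<zeta>)" for \<zeta>
  have g[measurable]: "g \<in> borel_measurable \<mu>" unfolding g_def by measurable
  have lim: "AE \<zeta> in \<mu>. (\<lambda>i. X (r i) \<zeta>) \<longlonglongrightarrow> g \<zeta>"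
    using r(2) by eventually_elim (auto simp: g_def Cauchy_convergent_iff convergent_LIMSEQ_iff)
  have key: "(\<lambda>\<zeta>. X n \<zeta> - g \<zeta>) \<in> L2 \<and> L2_norm (\<lambda>\<zeta>. X n \<zeta> - g \<zeta>) \<le> e"
    if "e > 0" and N: "\<forall>m\<ge>N. \<forall>n\<ge>N. L2_norm (\<lambda>\<zeta>. X m \<zeta> - X n \<zeta>) < e" and n: "n \<ge> N" for e N n
  proof -
    have "(\<integral>\<^sup>+ \<zeta>. ennreal ((norm (X n \<zeta> - g \<zeta>))\<^sup>2) \<partial>\<mu>)
        = (\<integral>\<^sup>+ \<zeta>. liminf (\<lambda>i. ennreal ((norm (X n \<zeta> - X (r i) \<zeta>))\<^sup>2)) \<partial>\<mu>)"
    proof (rule nn_integral_cong_AE)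
      show "AE \<zeta> in \<mu>. ennreal ((norm (X n \<zeta> - g \<zeta>))\<^sup>2) = liminf (\<lambda>i. ennreal ((norm (X n \<zeta> - X (r i) \<zeta>))\<^sup>2))"
        using lim
      proof eventually_elim
        case (elim \<zeta>)
        then have "(\<lambda>i. ennreal ((norm (X n \<zeta> - X (r i) \<zeta>))\<^sup>2)) \<longlonglongrightarrow> ennreal ((norm (X n \<zeta> - g \<zeta>))\<^sup>2)"
          by (intro tendsto_intros)
        then show ?case by (intro lim_imp_Liminf[symmetric]) auto
      qed
    qed
    also have "\<dots> \<le> liminf (\<lambda>i. \<integral>\<^sup>+ \<zeta>. ennreal ((norm (X n \<zeta> - X (r i) \<zeta>))\<^sup>2) \<partial>\<mu>)"
      by (intro nn_integral_liminf) measurable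
    also have "\<dots> \<le> ennreal (e\<^sup>2)"
    proof (intro Liminf_le eventually_sequentiallyI[of N])
      fix i assume "N \<le> i"
      then have "r i \<ge> N" using seq_suble[OF r(1), of i] by simp
      then have "L2_norm (\<lambda>\<zeta>. X n \<zeta> - X (r i) \<zeta>) < e" using N n by blast
      then have "(L2_norm (\<lambda>\<zeta>. X n \<zeta> - X (r i) \<zeta>))\<^sup>2 \<le> e\<^sup>2" by (intro power_mono) auto
      then show "(\<integral>\<^sup>+ \<zeta>. ennreal ((norm (X n \<zeta> - X (r i) \<zeta>))\<^sup>2) \<partial>\<mu>) \<le> ennreal (e\<^sup>2)"
        using L2_integrable[OF D[of n "r i"]]
        by (simp add: nn_integral_eq_integral L2_norm_def integral_nonneg_AE)
    qed simp
    finally have le: "(\<integral>\<^sup>+ \<zeta>. ennreal ((norm (X n \<zeta> - g \<zeta>))\<^sup>2) \<partial>\<mu>) \<le> ennreal (e\<^sup>2)" .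
    then have "integrable \<mu> (\<lambda>\<zeta>. (norm (X n \<zeta> - g \<zeta>))\<^sup>2)"
      by (intro integrableI_bounded) (auto simp: le_less_trans)
    then have L: "(\<lambda>\<zeta>. X n \<zeta> - g \<zeta>) \<in> L2" by (simp add: L2_def)
    with le have "(\<integral>\<zeta>. (norm (X n \<zeta> - g \<zeta>))\<^sup>2 \<partial>\<mu>) \<le> e\<^sup>2"
      by (simp add: nn_integral_eq_integral L2_integrable)
    then have "L2_norm (\<lambda>\<zeta>. X n \<zeta> - g \<zeta>) \<le> e"
      unfolding L2_norm_def using \<open>e > 0\<close> by (intro real_le_lsqrt) (auto simp: integral_nonneg_AE)
    with L show ?thesis by simp
  qed
  have gL2: "g \<in> L2"
  proof -
    from C[of 1] obtain N where N: "\<forall>m\<ge>N. \<forall>n\<ge>N. L2_norm (\<lambda>\<zeta>. X m \<zeta> - X n \<zeta>) < 1" by auto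
    have "(\<lambda>\<zeta>. X N \<zeta> - (X N \<zeta> - g \<zeta>)) \<in> L2"
      by (rule L2_diff[OF X conjunct1[OF key[OF zero_less_one N order.refl]]])
    then show ?thesis by simp
  qed
  have "(\<lambda>n. L2_norm (\<lambda>\<zeta>. X n \<zeta> - g \<zeta>)) \<longlonglongrightarrow> 0"
  proof (rule LIMSEQ_I)
    fix e :: real assume e: "e > 0"
    from C[of "e/2"] e obtain N where N: "\<forall>m\<ge>N. \<forall>n\<ge>N. L2_norm (\<lambda>\<zeta>. X m \<zeta> - X n \<zeta>) < e/2" by auto
    have "norm (L2_norm (\<lambda>\<zeta>. X n \<zeta> - g \<zeta>) - 0) < e" if "n \<ge> N" for n
      using key[OF _ N that] e by auto
    then show "\<exists>no. \<forall>n\<ge>no. norm (L2_norm (\<lambda>\<zeta>. X n \<zeta> - g \<zeta>) - 0) < e" by blast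
  qed
  with gL2 show ?thesis by blast
qed

lemma ip_tendsto:
  assumes "\<And>n. X n \<in> L2" "g \<in> L2" "h \<in> L2" "(\<lambda>n. L2_norm (\<lambda>\<zeta>. X n \<zeta> - g \<zeta>)) \<longlonglongrightarrow> 0"
  shows "(\<lambda>n. ip (X n) h) \<longlonglongrightarrow> ip g h"
proof (rule Lim_transform)
  show "(\<lambda>n. ip g h) \<longlonglongrightarrow> ip g h" by simp
  show "(\<lambda>n. ip (X n) h - ip g h) \<longlonglongrightarrow> 0"
  proof (rule Lim_null_comparison)
    show "\<forall>\<^sub>F n in sequentially. norm (ip (X n) h - ip g h) \<le> L2_norm (\<lambda>\<zeta>. X n \<zeta> - g \<zeta>) * L2_norm h"
      using L2_cauchy_schwarz[OF L2_diff[OF assms(1,2)] assms(3)] assms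
      by (intro always_eventually allI) (simp add: ip_diff_left)
    show "(\<lambda>n. L2_norm (\<lambda>\<zeta>. X n \<zeta> - g \<zeta>) * L2_norm h) \<longlonglongrightarrow> 0"
      using tendsto_mult_right[OF assms(4), of "L2_norm h"] by simp
  qed
qed

section \<open>Fourier series on the circle\<close>

lemma cnj_unimodular: "norm \<zeta> = 1 \<Longrightarrow> cnj \<zeta> = inverse \<zeta>"
  by (rule inverse_unique[symmetric]) (simp add: complex_norm_square[symmetric])

lemma cnj_powi_unimodular: "norm \<zeta> = 1 \<Longrightarrow> cnj (\<zeta> powi k) = \<zeta> powi (- k)"
  by (simp add: cnj_unimodular power_int_minus power_int_inverse)

text \<open>The congruence rule lets only the values on the circle count, so that products of powers with negative exponents need
  no exception at the origin.\<close>

inductive trig_poly :: "(complex \<Rightarrow> complex) \<Rightarrow> bool" where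
  monom: "trig_poly (\<lambda>\<zeta>. a * \<zeta> powi k)"
| add: "trig_poly p \<Longrightarrow> trig_poly q \<Longrightarrow> trig_poly (\<lambda>\<zeta>. p \<zeta> + q \<zeta>)"
| cong: "trig_poly p \<Longrightarrow> (\<And>\<zeta>. norm \<zeta> = 1 \<Longrightarrow> q \<zeta> = p \<zeta>) \<Longrightarrow> trig_poly q"

lemma trig_poly_monom_mult: "trig_poly q \<Longrightarrow> trig_poly (\<lambda>\<zeta>. (a * \<zeta> powi k) * q \<zeta>)"
proof (induction rule: trig_poly.induct)
  case (monom b j)
  show ?case
  proof (rule trig_poly.cong[OF trig_poly.monom[of "a * b" "k + j"]])
    fix \<zeta> :: complex assume "norm \<zeta> = 1"
    then have "\<zeta> \<noteq> 0" by auto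
    then show "(a * \<zeta> powi k) * (b * \<zeta> powi j) = a * b * \<zeta> powi (k + j)"
      by (simp add: power_int_add)
  qed
next
  case (add p q)
  from trig_poly.add[OF add.IH] show ?case by (rule trig_poly.cong) (simp add: algebra_simps)
next
  case (cong p q)
  from cong.IH show ?case by (rule trig_poly.cong) (simp add: cong.hyps)
qed

lemma trig_poly_mult: "trig_poly p \<Longrightarrow> trig_poly q \<Longrightarrow> trig_poly (\<lambda>\<zeta>. p \<zeta> * q \<zeta>)"
proof (induction rule: trig_poly.induct)
  case (monom a k)
  then show ?case by (rule trig_poly_monom_mult)
next
  case (add p p')
  from trig_poly.add[OF add.IH[OF add.prems]] show ?case
    by (rule trig_poly.cong) (simp add: algebra_simps)
next
  case (cong p p')
  from cong.IH[OF cong.prems] show ?case by (rule trig_poly.cong) (simp add: cong.hyps)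
qed

lemma trig_poly_const: "trig_poly (\<lambda>\<zeta>. c)"
  using trig_poly.monom[of c 0] by simp

lemma real_polynomial_trig:
  assumes "real_polynomial_function p"
  shows "trig_poly (\<lambda>\<zeta>. complex_of_real (p \<zeta>))"
  using assms
proof (induction rule: real_polynomial_function.induct)
  case (linear f)
  interpret f: bounded_linear f by fact
  have eq: "complex_of_real (f \<zeta>) = of_real (f 1) * Re \<zeta> + of_real (f \<i>) * Im \<zeta>" for \<zeta>
  proof -
    have "\<zeta> = Re \<zeta> *\<^sub>R 1 + Im \<zeta> *\<^sub>R \<i>" by (simp add: complex_eq_iff)
    then have "f \<zeta> = Re \<zeta> * f 1 + Im \<zeta> * f \<i>" by (metis f.add f.scaleR real_scaleR_def)
    then show ?thesis by simp
  qed
  have "trig_poly (\<lambda>\<zeta>. ((of_real (f 1) - of_real (f \<i>) * \<i>) / 2) * \<zeta> powi 1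
     + ((of_real (f 1) + of_real (f \<i>) * \<i>) / 2) * \<zeta> powi (-1))"
    by (intro trig_poly.intros)
  then show ?case
  proof (rule trig_poly.cong)
    fix \<zeta> :: complex assume "norm \<zeta> = 1"
    then have "\<zeta> powi (-1) = cnj \<zeta>"
      by (simp add: power_int_minus cnj_unimodular)
    then have "((of_real (f 1) - of_real (f \<i>) * \<i>) / 2) * \<zeta> powi 1
       + ((of_real (f 1) + of_real (f \<i>) * \<i>) / 2) * \<zeta> powi (-1)
      = (of_real (f 1) * (\<zeta> + cnj \<zeta>) - of_real (f \<i>) * \<i> * (\<zeta> - cnj \<zeta>)) / 2"
      by (simp only: power_int_1_right) (simp add: field_simps)
    also have "\<dots> = of_real (f \<zeta>)"
      unfolding eq complex_add_cnj complex_diff_cnj by (simp add: complex_eq_iff)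
    finally show "complex_of_real (f \<zeta>) = ((of_real (f 1) - of_real (f \<i>) * \<i>) / 2) * \<zeta> powi 1
     + ((of_real (f 1) + of_real (f \<i>) * \<i>) / 2) * \<zeta> powi (-1)" ..
  qed
next
  case (const c)
  show ?case by (rule trig_poly_const)
next
  case (add f g)
  then show ?case by (simp add: trig_poly.add)
next
  case (mult f g)
  then show ?case by (simp add: trig_poly_mult)
qed

lemma real_polynomial_function_measurable_circle:
  "real_polynomial_function p \<Longrightarrow> p \<in> borel_measurable \<mu>"
  by (intro borel_measurable_circle borel_measurable_continuous_onI continuous_on_polymonial_function)
    (simp add: real_polynomial_function_eq)

text \<open>The measure is completed, whereas inner regularity is a statement about Borel sets.\<close>

lemma borel_subset_of_measurable_circle:
  assumes "N \<in> sets \<mu>"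
  obtains S where "S \<in> sets borel" "S \<in> sets \<mu>" "S \<subseteq> N" "emeasure \<mu> S = emeasure \<mu> N"
proof -
  let ?M = "distr (uniform_measure lborel {0..2 * pi}) (restrict_space borel (sphere 0 1)) cis"
  have N: "N \<in> sets (completion ?M)" using assms by (simp add: circle_measure_def)
  define S where "S = main_part ?M N"
  have S: "S \<in> sets ?M" unfolding S_def by (rule main_part_sets[OF N])
  have "S \<subseteq> N" unfolding S_def using main_part_null_part_Un[OF N] by blast
  moreover have "S \<in> sets borel" using S by (auto simp: sets_restrict_space)
  moreover have "S \<in> sets \<mu>" unfolding circle_measure_def using S by (rule sets_completionI_sets)
  moreover have "emeasure \<mu> S = emeasure \<mu> N"
    unfolding circle_measure_def using N S emeasure_completion[OF N] emeasure_completion[of S ?M]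
    by (simp add: S_def)
  ultimately show ?thesis using that by blast
qed

lemma compact_subset_of_measurable_circle:
  assumes N: "N \<in> sets \<mu>" "emeasure \<mu> N > 0"
  obtains K where "compact K" "K \<subseteq> N" "emeasure \<mu> K > 0" "K \<in> sets \<mu>"
proof -
  from borel_subset_of_measurable_circle[OF N(1)] obtain S where
    S: "S \<in> sets borel" "S \<in> sets \<mu>" "S \<subseteq> N" "emeasure \<mu> S = emeasure \<mu> N" .
  define \<nu> where "\<nu> = distr \<mu> borel (\<lambda>\<zeta>. \<zeta>)"
  have em: "emeasure \<nu> A = emeasure \<mu> (A \<inter> sphere 0 1)" if "A \<in> sets borel" for A
    using that by (simp add: \<nu>_def emeasure_distr)
  have "prob_space \<nu>" unfolding \<nu>_def by (rule circle.prob_space_distr) simp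
  then have fin: "emeasure \<nu> (space \<nu>) \<noteq> \<infinity>" by (simp add: prob_space.emeasure_space_1)
  have sub: "A \<inter> sphere 0 1 = A" if "A \<subseteq> N" for A
    using sets.sets_into_space[OF N(1)] that by auto
  have "emeasure \<nu> S = (SUP K \<in> {K. K \<subseteq> S \<and> compact K}. emeasure \<nu> K)"
    by (rule inner_regular) (use fin S in \<open>auto simp: \<nu>_def\<close>)
  moreover have "emeasure \<nu> S > 0" using S N em[OF S(1)] sub[OF S(3)] by simp
  ultimately obtain K where K: "K \<subseteq> S" "compact K" "emeasure \<nu> K > 0"
    by (auto simp: less_SUP_iff)
  have Kb: "K \<in> sets borel" using K by (auto intro: borel_closed compact_imp_closed)
  have "K \<subseteq> N" using K S by blast
  then show ?thesis
    using K em[OF Kb] sub[of K] borel_sets_circle[OF Kb] by (intro that[of K]) auto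
qed

text \<open>Squares of polynomials suffice to test positivity: they approximate every nonnegative continuous function
  uniformly (Stone-Weierstrass for its square root), these approximate indicators of closed sets, and inner regularity
  finds a closed set of positive measure where a counterexample is negative.\<close>

lemma nonneg_AE_of_square_weights:
  fixes w :: "complex \<Rightarrow> real"
  assumes w: "integrable \<mu> w"
    and pos: "\<And>p. real_polynomial_function p \<Longrightarrow> 0 \<le> (\<integral>\<zeta>. (p \<zeta>)\<^sup>2 * w \<zeta> \<partial>\<mu>)"
  shows "AE \<zeta> in \<mu>. 0 \<le> w \<zeta>"
proof -
  have [measurable]: "w \<in> borel_measurable \<mu>" using w by auto
  have cont: "0 \<le> (\<integral>\<zeta>. \<phi> \<zeta> * w \<zeta> \<partial>\<mu>)"
    if \<phi>: "continuous_on (sphere 0 1) \<phi>" "\<And>\<zeta>. 0 \<le> \<phi> \<zeta>" for \<phi> :: "complex \<Rightarrow> real"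
  proof -
    have cs: "continuous_on (sphere 0 1) (\<lambda>\<zeta>. sqrt (\<phi> \<zeta>))" using \<phi> by (intro continuous_intros)
    have "\<exists>p. real_polynomial_function p \<and> (\<forall>\<zeta>\<in>sphere 0 1. \<bar>sqrt (\<phi> \<zeta>) - p \<zeta>\<bar> < 1 / real (Suc n))" for n
      by (rule Stone_Weierstrass_real_polynomial_function[OF compact_sphere cs, of "1 / real (Suc n)"]) auto
    then obtain p where p: "\<And>n. real_polynomial_function (p n)"
      "\<And>n \<zeta>. \<zeta> \<in> sphere 0 1 \<Longrightarrow> \<bar>sqrt (\<phi> \<zeta>) - p n \<zeta>\<bar> < 1 / real (Suc n)" by metis
    note [measurable] = p(1)[THEN real_polynomial_function_measurable_circle]
    have [measurable]: "\<phi> \<in> borel_measurable \<mu>" by (rule continuous_on_measurable_circle[OF \<phi>(1)])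
    have "bounded ((\<lambda>\<zeta>. sqrt (\<phi> \<zeta>)) ` sphere 0 1)"
      by (intro compact_imp_bounded compact_continuous_image cs) auto
    then obtain B where B: "\<And>\<zeta>. \<zeta> \<in> sphere 0 1 \<Longrightarrow> \<bar>sqrt (\<phi> \<zeta>)\<bar> \<le> B"
      unfolding bounded_iff by force
    have "(\<lambda>n. \<integral>\<zeta>. (p n \<zeta>)\<^sup>2 * w \<zeta> \<partial>\<mu>) \<longlonglongrightarrow> (\<integral>\<zeta>. \<phi> \<zeta> * w \<zeta> \<partial>\<mu>)"
    proof (rule integral_dominated_convergence[where w="\<lambda>\<zeta>. (B + 1)\<^sup>2 * \<bar>w \<zeta>\<bar>"])
      show "integrable \<mu> (\<lambda>\<zeta>. (B + 1)\<^sup>2 * \<bar>w \<zeta>\<bar>)" using w by auto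
      show "AE \<zeta> in \<mu>. (\<lambda>n. (p n \<zeta>)\<^sup>2 * w \<zeta>) \<longlonglongrightarrow> \<phi> \<zeta> * w \<zeta>"
      proof (rule AE_I2)
        fix \<zeta> assume "\<zeta> \<in> space \<mu>"
        then have z: "\<zeta> \<in> sphere 0 1" by simp
        have "(\<lambda>n. p n \<zeta> - sqrt (\<phi> \<zeta>)) \<longlonglongrightarrow> 0"
        proof (rule Lim_null_comparison)
          show "\<forall>\<^sub>F n in sequentially. norm (p n \<zeta> - sqrt (\<phi> \<zeta>)) \<le> 1 / real (Suc n)"
            using p(2)[OF z] by (intro always_eventually allI) (simp add: abs_minus_commute less_imp_le)
        qed (intro LIMSEQ_Suc lim_1_over_n)
        then have "(\<lambda>n. p n \<zeta>) \<longlonglongrightarrow> sqrt (\<phi> \<zeta>)" by (simp add: LIM_zero_iff)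
        then have "(\<lambda>n. (p n \<zeta>)\<^sup>2 * w \<zeta>) \<longlonglongrightarrow> (sqrt (\<phi> \<zeta>))\<^sup>2 * w \<zeta>" by (intro tendsto_intros)
        then show "(\<lambda>n. (p n \<zeta>)\<^sup>2 * w \<zeta>) \<longlonglongrightarrow> \<phi> \<zeta> * w \<zeta>" using \<phi>(2) by simp
      qed
      fix n
      show "AE \<zeta> in \<mu>. norm ((p n \<zeta>)\<^sup>2 * w \<zeta>) \<le> (B + 1)\<^sup>2 * \<bar>w \<zeta>\<bar>"
      proof (rule AE_I2)
        fix \<zeta> assume "\<zeta> \<in> space \<mu>"
        then have z: "\<zeta> \<in> sphere 0 1" by simp
        have "1 / real (Suc n) \<le> 1" by simp
        then have "\<bar>p n \<zeta>\<bar> \<le> B + 1" using p(2)[OF z, of n] B[OF z] by linarith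
        then have "\<bar>p n \<zeta>\<bar>\<^sup>2 \<le> (B + 1)\<^sup>2" by (intro power_mono) auto
        then show "norm ((p n \<zeta>)\<^sup>2 * w \<zeta>) \<le> (B + 1)\<^sup>2 * \<bar>w \<zeta>\<bar>"
          by (simp add: abs_mult mult_right_mono)
      qed
    qed measurable
    then show ?thesis using pos[OF p(1)] by (intro LIMSEQ_le_const) auto
  qed
  have closed: "0 \<le> (\<integral>\<zeta>. indicator K \<zeta> * w \<zeta> \<partial>\<mu>)" if K: "closed K" "K \<noteq> {}" for K
  proof -
    define \<phi> where "\<phi> n \<zeta> = max 0 (1 - real n * infdist \<zeta> K)" for n \<zeta>
    have c: "continuous_on S (\<phi> n)" for n S
      unfolding \<phi>_def by (intro continuous_intros)
    have [measurable]: "\<phi> n \<in> borel_measurable \<mu>" for n by (rule continuous_on_measurable_circle[OF c])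
    have [measurable]: "K \<in> sets borel" using K by auto
    have "(indicator K :: complex \<Rightarrow> real) \<in> borel_measurable borel" by measurable
    from borel_measurable_circle[OF this] have [measurable]: "(indicator K :: complex \<Rightarrow> real) \<in> borel_measurable \<mu>" .
    have "(\<lambda>n. \<integral>\<zeta>. \<phi> n \<zeta> * w \<zeta> \<partial>\<mu>) \<longlonglongrightarrow> (\<integral>\<zeta>. indicator K \<zeta> * w \<zeta> \<partial>\<mu>)"
    proof (rule integral_dominated_convergence[where w="\<lambda>\<zeta>. \<bar>w \<zeta>\<bar>"])
      show "integrable \<mu> (\<lambda>\<zeta>. \<bar>w \<zeta>\<bar>)" using w by auto
      show "AE \<zeta> in \<mu>. (\<lambda>n. \<phi> n \<zeta> * w \<zeta>) \<longlonglongrightarrow> indicator K \<zeta> * w \<zeta>"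
      proof (rule AE_I2)
        fix \<zeta>
        have "(\<lambda>n. \<phi> n \<zeta>) \<longlonglongrightarrow> indicator K \<zeta>"
        proof (cases "\<zeta> \<in> K")
          case True
          then show ?thesis by (simp add: \<phi>_def)
        next
          case False
          then have d: "infdist \<zeta> K > 0" using K by (simp add: infdist_pos_not_in_closed)
          obtain N :: nat where N: "1 / infdist \<zeta> K < real N" using reals_Archimedean2 by blast
          have "\<phi> n \<zeta> = 0" if "n \<ge> N" for n
          proof -
            have "1 / infdist \<zeta> K < real n" using N that by simp
            then show ?thesis using d by (simp add: \<phi>_def field_simps max_def)
          qed
          then have "\<forall>\<^sub>F n in sequentially. \<phi> n \<zeta> = 0" by (auto simp: eventually_sequentially)
          then show ?thesis using False by (simp add: tendsto_eventually)
        qed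
        then show "(\<lambda>n. \<phi> n \<zeta> * w \<zeta>) \<longlonglongrightarrow> indicator K \<zeta> * w \<zeta>" by (intro tendsto_intros)
      qed
      fix n
      have "\<bar>\<phi> n \<zeta>\<bar> \<le> 1" for \<zeta> by (simp add: \<phi>_def infdist_nonneg)
      then show "AE \<zeta> in \<mu>. norm (\<phi> n \<zeta> * w \<zeta>) \<le> \<bar>w \<zeta>\<bar>"
        by (intro AE_I2) (simp add: abs_mult mult_left_le_one_le)
    qed measurable
    moreover have "0 \<le> (\<integral>\<zeta>. \<phi> n \<zeta> * w \<zeta> \<partial>\<mu>)" for n
      by (rule cont[OF c]) (simp add: \<phi>_def)
    ultimately show ?thesis by (intro LIMSEQ_le_const) auto
  qed
  show ?thesis
  proof (rule ccontr)
    assume not: "\<not> (AE \<zeta> in \<mu>. 0 \<le> w \<zeta>)"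
    define N where "N = {\<zeta> \<in> space \<mu>. w \<zeta> < 0}"
    have N: "N \<in> sets \<mu>" unfolding N_def by measurable
    have "emeasure \<mu> N \<noteq> 0"
    proof
      assume "emeasure \<mu> N = 0"
      with N have "AE \<zeta> in \<mu>. 0 \<le> w \<zeta>" by (intro AE_I[of _ _ N]) (auto simp: N_def)
      with not show False by simp
    qed
    then have "emeasure \<mu> N > 0" by (simp add: zero_less_iff_neq_zero)
    from compact_subset_of_measurable_circle[OF N this] obtain K
      where K: "compact K" "K \<subseteq> N" "emeasure \<mu> K > 0" "K \<in> sets \<mu>" .
    have "K \<noteq> {}" using K by auto
    have int: "integrable \<mu> (\<lambda>\<zeta>. - (indicator K \<zeta> * w \<zeta>))"
      using integrable_mult_indicator[OF K(4) w] by simp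
    have nn: "AE \<zeta> in \<mu>. 0 \<le> - (indicator K \<zeta> * w \<zeta>)"
      using K by (intro AE_I2) (auto simp: N_def indicator_def)
    have "0 \<le> (\<integral>\<zeta>. - (indicator K \<zeta> * w \<zeta>) \<partial>\<mu>)" by (rule integral_nonneg_AE[OF nn])
    with closed[of K] K \<open>K \<noteq> {}\<close> have "(\<integral>\<zeta>. - (indicator K \<zeta> * w \<zeta>) \<partial>\<mu>) = 0"
      by (simp add: compact_imp_closed)
    with integral_nonneg_eq_0_iff_AE[OF int nn] have "AE \<zeta> in \<mu>. indicator K \<zeta> * w \<zeta> = 0" by simp
    then have "AE \<zeta> in \<mu>. \<zeta> \<notin> K"
      by eventually_elim (use K in \<open>auto simp: N_def indicator_def split: if_splits\<close>)
    then have "emeasure \<mu> K = 0" using AE_iff_null_sets[OF K(4)] by auto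
    with K(3) show False by simp
  qed
qed

lemma zero_AE_of_polynomial_weights:
  fixes w :: "complex \<Rightarrow> real"
  assumes w: "integrable \<mu> w"
    and "\<And>p. real_polynomial_function p \<Longrightarrow> (\<integral>\<zeta>. p \<zeta> * w \<zeta> \<partial>\<mu>) = 0"
  shows "AE \<zeta> in \<mu>. w \<zeta> = 0"
proof -
  have 0: "(\<integral>\<zeta>. (p \<zeta>)\<^sup>2 * w \<zeta> \<partial>\<mu>) = 0" if "real_polynomial_function p" for p
    unfolding power2_eq_square using that by (intro assms(2) real_polynomial_function.intros(4))
  have "AE \<zeta> in \<mu>. 0 \<le> w \<zeta>" using 0 by (intro nonneg_AE_of_square_weights w) simp
  moreover have "AE \<zeta> in \<mu>. 0 \<le> - w \<zeta>" using 0 w by (intro nonneg_AE_of_square_weights) simp_all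
  ultimately show ?thesis by eventually_elim simp
qed

lemma fourier_coeff_inner:
  assumes "f \<in> L2"
  shows "fourier_coeff f k \<bullet> x = ip f (\<lambda>\<zeta>. (\<zeta> powi k) *s x)"
proof -
  have "fourier_coeff f k \<bullet> x = (\<integral>\<zeta>. ((\<zeta> powi (- k)) *s f \<zeta>) \<bullet> x \<partial>\<mu>)"
    unfolding fourier_coeff_def using L2_integrable_vec[OF L2_mult_powi[OF assms, of "- k"]]
    by (simp add: integral_inner_left)
  also have "\<dots> = ip f (\<lambda>\<zeta>. (\<zeta> powi k) *s x)"
    unfolding ip_def
    by (intro Bochner_Integration.integral_cong) (simp_all add: inner_scalar_vec cnj_powi_unimodular del: complex_cnj_power_int)
  finally show ?thesis .
qed

lemma L2_monom [simp]: "(\<lambda>\<zeta>. (\<zeta> powi k) *s x) \<in> L2"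
  by (intro L2_mult_powi L2_const)

lemma vec_eq_inner: "(\<And>z. x \<bullet> z = y \<bullet> z) \<Longrightarrow> x = y"
  using vector_eq_rdot[of x y] by blast

lemma fourier_coeff_lin:
  assumes "f \<in> L2" "g \<in> L2"
  shows "fourier_coeff (\<lambda>\<zeta>. f \<zeta> + c *\<^sub>R g \<zeta>) k = fourier_coeff f k + c *\<^sub>R fourier_coeff g k"
  by (rule vec_eq_inner) (simp add: fourier_coeff_inner L2_lin assms L2.lin inner_add_left)

lemma fourier_coeff_add:
  "f \<in> L2 \<Longrightarrow> g \<in> L2 \<Longrightarrow> fourier_coeff (\<lambda>\<zeta>. f \<zeta> + g \<zeta>) k = fourier_coeff f k + fourier_coeff g k"
  using fourier_coeff_lin[of f g 1] by simp

lemma fourier_coeff_diff: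
  "f \<in> L2 \<Longrightarrow> g \<in> L2 \<Longrightarrow> fourier_coeff (\<lambda>\<zeta>. f \<zeta> - g \<zeta>) k = fourier_coeff f k - fourier_coeff g k"
  using fourier_coeff_lin[of f g "-1"] by simp

lemma fourier_coeff_zero [simp]: "fourier_coeff (\<lambda>_. 0) k = 0"
  by (simp add: fourier_coeff_def)

lemma fourier_coeff_sum:
  "(\<And>i. i \<in> A \<Longrightarrow> f i \<in> L2) \<Longrightarrow> fourier_coeff (\<lambda>\<zeta>. \<Sum>i\<in>A. f i \<zeta>) k = (\<Sum>i\<in>A. fourier_coeff (f i) k)"
  by (induction A rule: infinite_finite_induct) (auto simp: fourier_coeff_add L2_sum)

lemma fourier_coeff_cmult:
  assumes "f \<in> L2"
  shows "fourier_coeff (\<lambda>\<zeta>. c *s f \<zeta>) k = c *s fourier_coeff f k"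
proof (rule vec_eq_inner)
  fix z
  have "fourier_coeff (\<lambda>\<zeta>. c *s f \<zeta>) k \<bullet> z = ip f (\<lambda>\<zeta>. (\<zeta> powi k) *s (cnj c *s z))"
    by (simp add: fourier_coeff_inner L2_cmult assms ip_scalar vector_smult_assoc mult.commute)
  also have "\<dots> = (c *s fourier_coeff f k) \<bullet> z"
    unfolding fourier_coeff_inner[OF assms, symmetric] inner_scalar_vec ..
  finally show "fourier_coeff (\<lambda>\<zeta>. c *s f \<zeta>) k \<bullet> z = (c *s fourier_coeff f k) \<bullet> z" .
qed

lemma fourier_coeff_shift:
  "fourier_coeff (\<lambda>\<zeta>. (\<zeta> powi j) *s f \<zeta>) k = fourier_coeff f (k - j)"
proof -
  have "\<zeta> powi (- k) * \<zeta> powi j = \<zeta> powi (- (k - j))" if "norm \<zeta> = 1" for \<zeta> :: complex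
  proof -
    have "\<zeta> \<noteq> 0" using that by auto
    then show ?thesis by (simp add: power_int_add[symmetric])
  qed
  then show ?thesis
    unfolding fourier_coeff_def
    by (intro Bochner_Integration.integral_cong) (simp_all add: vector_smult_assoc)
qed

lemma fourier_coeff_cong_AE:
  assumes "f \<in> L2" "g \<in> L2" "AE \<zeta> in \<mu>. f \<zeta> = g \<zeta>"
  shows "fourier_coeff f k = fourier_coeff g k"
proof -
  note [measurable] = assms(1,2)
  show ?thesis unfolding fourier_coeff_def using assms(3) by (intro integral_cong_AE) auto
qed

lemma fourier_coeff_const:
  fixes x :: "complex^'n::finite"
  shows "fourier_coeff (\<lambda>_. x) k = (if k = 0 then x else 0)"
proof -
  have "fourier_coeff (\<lambda>_. x) k = (\<integral>\<zeta>. (\<zeta> powi (- k)) *s x \<partial>\<mu>)"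
    by (simp add: fourier_coeff_def)
  also have "(\<integral>\<zeta>. (\<zeta> powi (- k)) *s x \<partial>\<mu>) = (\<integral>\<zeta>. \<zeta> powi (- k) \<partial>\<mu>) *s x"
  proof (rule integral_bounded_linear)
    show "bounded_linear (\<lambda>c. c *s x)" by (rule bounded_bilinear.bounded_linear_left[OF bounded_bilinear_scalar_vec])
    show "integrable \<mu> (\<lambda>\<zeta>. \<zeta> powi (- k))"
      by (rule circle.integrable_const_bound[where B=1]) (auto simp: norm_power_int)
  qed
  finally show ?thesis
    by (simp add: integral_powi_circle)
qed

lemma fourier_coeff_monom: "fourier_coeff (\<lambda>\<zeta>. (\<zeta> powi j) *s x) k = (if k = j then x else 0)"
  using fourier_coeff_shift[of j "\<lambda>_. x" k] by (simp add: fourier_coeff_const)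

lemma bounded_linear_matrix: "bounded_linear (\<lambda>x. (A::complex^'n::finite^'m::finite) *v x)"
  by (rule bounded_bilinear.bounded_linear_right[OF bounded_bilinear_matrix_vec])

lemma matrix_scalar_vec: "(A::complex^'n::finite^'m::finite) *v (c *s x) = c *s (A *v x)"
  by (simp add: matrix_vector_mult_def vec_eq_iff sum_distrib_left algebra_simps)

lemma fourier_coeff_matrix:
  assumes "f \<in> L2"
  shows "fourier_coeff (\<lambda>\<zeta>. A *v f \<zeta>) k = A *v fourier_coeff f k"
proof -
  have "fourier_coeff (\<lambda>\<zeta>. A *v f \<zeta>) k = (\<integral>\<zeta>. A *v ((\<zeta> powi (- k)) *s f \<zeta>) \<partial>\<mu>)"
    by (simp add: fourier_coeff_def matrix_scalar_vec)
  also have "\<dots> = A *v fourier_coeff f k"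
    unfolding fourier_coeff_def
    by (rule integral_bounded_linear[OF bounded_linear_matrix L2_integrable_vec[OF L2_mult_powi[OF assms]]])
  finally show ?thesis .
qed

lemma trig_poly_bounded:
  "trig_poly p \<Longrightarrow> p \<in> borel_measurable \<mu> \<and> (\<exists>B. \<forall>\<zeta>. norm \<zeta> = 1 \<longrightarrow> norm (p \<zeta>) \<le> B)"
proof (induction rule: trig_poly.induct)
  case (monom a k)
  show ?case by (auto simp: norm_mult norm_power_int intro!: exI[of _ "norm a"])
next
  case (add p q)
  then obtain B C where "\<forall>\<zeta>. norm \<zeta> = 1 \<longrightarrow> norm (p \<zeta>) \<le> B" "\<forall>\<zeta>. norm \<zeta> = 1 \<longrightarrow> norm (q \<zeta>) \<le> C" by auto
  then have "\<forall>\<zeta>. norm \<zeta> = 1 \<longrightarrow> norm (p \<zeta> + q \<zeta>) \<le> B + C" by (metis add_mono norm_triangle_ineq order_trans)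
  with add show ?case by auto
next
  case (cong p q)
  then have "q \<in> borel_measurable \<mu>" using measurable_cong[of \<mu> q p] by simp
  with cong show ?case by metis
qed

lemma trig_poly_measurable: "trig_poly p \<Longrightarrow> p \<in> borel_measurable \<mu>"
  using trig_poly_bounded by blast

lemma zero_AE_of_fourier_real:
  fixes w :: "complex \<Rightarrow> real"
  assumes w: "integrable \<mu> w"
    and 0: "\<And>k. (\<integral>\<zeta>. (\<zeta> powi k) * complex_of_real (w \<zeta>) \<partial>\<mu>) = 0"
  shows "AE \<zeta> in \<mu>. w \<zeta> = 0"
proof (rule zero_AE_of_polynomial_weights[OF w])
  fix p :: "complex \<Rightarrow> real" assume p: "real_polynomial_function p"
  have *: "integrable \<mu> (\<lambda>\<zeta>. t \<zeta> * complex_of_real (w \<zeta>)) \<and> (\<integral>\<zeta>. t \<zeta> * complex_of_real (w \<zeta>) \<partial>\<mu>) = 0" if "trig_poly t" for t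
    using that
  proof (induction rule: trig_poly.induct)
    case (monom a k)
    have "integrable \<mu> (\<lambda>\<zeta>. (\<zeta> powi k) * complex_of_real (w \<zeta>))"
    proof (rule Bochner_Integration.integrable_bound[OF w])
      show "(\<lambda>\<zeta>. (\<zeta> powi k) * complex_of_real (w \<zeta>)) \<in> borel_measurable \<mu>"
        using borel_measurable_integrable[OF w] by measurable
      show "AE \<zeta> in \<mu>. norm ((\<zeta> powi k) * complex_of_real (w \<zeta>)) \<le> norm (w \<zeta>)"
        by (intro AE_I2) (simp add: norm_mult norm_power_int)
    qed
    then show ?case using 0[of k] by (simp add: mult.assoc)
  next
    case (add p q)
    then show ?case by (simp add: algebra_simps)
  next
    case (cong p q)
    have "integrable \<mu> (\<lambda>\<zeta>. q \<zeta> * complex_of_real (w \<zeta>)) \<longleftrightarrow> integrable \<mu> (\<lambda>\<zeta>. p \<zeta> * complex_of_real (w \<zeta>))"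
      by (intro Bochner_Integration.integrable_cong) (simp_all add: cong.hyps)
    moreover have "(\<integral>\<zeta>. q \<zeta> * complex_of_real (w \<zeta>) \<partial>\<mu>) = (\<integral>\<zeta>. p \<zeta> * complex_of_real (w \<zeta>) \<partial>\<mu>)"
      by (intro Bochner_Integration.integral_cong) (simp_all add: cong.hyps)
    ultimately show ?case using cong.IH by simp
  qed
  from conjunct2[OF *[OF real_polynomial_trig[OF p]]]
  have "complex_of_real (\<integral>\<zeta>. p \<zeta> * w \<zeta> \<partial>\<mu>) = 0"
    by (simp add: integral_complex_of_real[symmetric] del: integral_complex_of_real)
  then show "(\<integral>\<zeta>. p \<zeta> * w \<zeta> \<partial>\<mu>) = 0" by simp
qed

text \<open>Each real component is orthogonal to all polynomials in the real and imaginary part of \<open>\<zeta>\<close>, because these are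
  trigonometric polynomials on the circle.\<close>

lemma zero_AE_of_fourier_coeff:
  assumes f: "f \<in> L2" and 0: "\<And>k. fourier_coeff f k = 0"
  shows "AE \<zeta> in \<mu>. f \<zeta> = 0"
proof -
  have "AE \<zeta> in \<mu>. f \<zeta> \<bullet> b = 0" for b
  proof (rule zero_AE_of_polynomial_weights)
    show "integrable \<mu> (\<lambda>\<zeta>. f \<zeta> \<bullet> b)" using L2_integrable_vec[OF f] by simp
    fix p :: "complex \<Rightarrow> real" assume p: "real_polynomial_function p"
    have *: "(\<lambda>\<zeta>. t \<zeta> *s x) \<in> L2 \<and> ip f (\<lambda>\<zeta>. t \<zeta> *s x) = 0" if "trig_poly t" for t x
      using that
    proof (induction rule: trig_poly.induct)
      case (monom a k)
      show ?case
        using fourier_coeff_inner[OF f, of k "a *s x"] 0[of k] L2_monom[of k "a *s x"]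
        by (simp add: vector_smult_assoc mult.commute)
    next
      case (add p q)
      then show ?case using f by (simp add: vector_sadd_rdistrib ip_add_right L2_add)
    next
      case (cong p q)
      have "(\<lambda>\<zeta>. q \<zeta> *s x) \<in> L2"
      proof (rule L2_cong_AE[OF conjunct1[OF cong.IH]])
        show "AE \<zeta> in \<mu>. p \<zeta> *s x = q \<zeta> *s x" by (intro AE_I2) (simp add: cong.hyps)
        have "trig_poly q" by (rule trig_poly.cong) (use cong.hyps in auto)
        then have [measurable]: "q \<in> borel_measurable \<mu>" by (rule trig_poly_measurable)
        show "(\<lambda>\<zeta>. q \<zeta> *s x) \<in> borel_measurable \<mu>" by measurable
      qed
      moreover have "ip f (\<lambda>\<zeta>. q \<zeta> *s x) = ip f (\<lambda>\<zeta>. p \<zeta> *s x)"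
        unfolding ip_def by (intro Bochner_Integration.integral_cong) (simp_all add: cong.hyps)
      ultimately show ?case using cong.IH by simp
    qed
    from conjunct2[OF *[OF real_polynomial_trig[OF p], of b]]
    show "(\<integral>\<zeta>. p \<zeta> * (f \<zeta> \<bullet> b) \<partial>\<mu>) = 0"
      by (simp add: ip_def scaleR_as_scalar_vec[symmetric])
  qed
  then have "AE \<zeta> in \<mu>. \<forall>b\<in>Basis. f \<zeta> \<bullet> b = 0" by (intro AE_finite_allI) auto
  then show ?thesis by eventually_elim (simp add: euclidean_all_zero_iff)
qed

definition trig_sum :: "int set \<Rightarrow> (int \<Rightarrow> complex^'n::finite) \<Rightarrow> complex \<Rightarrow> complex^'n" where
  "trig_sum K d \<zeta> = (\<Sum>k\<in>K. (\<zeta> powi k) *s d k)"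

lemma L2_trig_sum [simp]: "trig_sum K d \<in> L2"
  unfolding trig_sum_def[abs_def] by (intro L2_sum L2_monom)

lemma fourier_coeff_trig_sum:
  "finite K \<Longrightarrow> fourier_coeff (trig_sum K d) j = (if j \<in> K then d j else 0)"
  unfolding trig_sum_def[abs_def] by (simp add: fourier_coeff_sum fourier_coeff_monom)

lemma ip_trig_sum: "f \<in> L2 \<Longrightarrow> ip f (trig_sum K d) = (\<Sum>k\<in>K. fourier_coeff f k \<bullet> d k)"
  unfolding trig_sum_def[abs_def] by (simp add: ip_sum_right fourier_coeff_inner)

lemma L2_norm_trig_sum: "finite K \<Longrightarrow> (L2_norm (trig_sum K d))\<^sup>2 = (\<Sum>k\<in>K. (norm (d k))\<^sup>2)"
  unfolding ip_self[symmetric]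
  by (simp add: ip_trig_sum fourier_coeff_trig_sum dot_square_norm)

text \<open>The squared distance of two partial sums is the difference of two terms of a bounded monotone sequence.\<close>

lemma riesz_fischer:
  fixes d :: "int \<Rightarrow> complex^'n::finite"
  assumes B: "\<And>N::nat. (\<Sum>k\<in>{-int N..int N}. (norm (d k))\<^sup>2) \<le> B"
  obtains D where "D \<in> L2" "\<And>k. fourier_coeff D k = d k"
    "(\<lambda>N. L2_norm (\<lambda>\<zeta>. trig_sum {-int N..int N} d \<zeta> - D \<zeta>)) \<longlonglongrightarrow> 0"
proof -
  define T where "T N = trig_sum {-int N..int N} d" for N
  define s where "s N = (\<Sum>k\<in>{-int N..int N}. (norm (d k))\<^sup>2)" for N :: nat
  have "incseq s" unfolding s_def by (intro monoI sum_mono2) auto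
  moreover have "bdd_above (range s)" using B by (auto simp: s_def intro!: bdd_aboveI)
  ultimately have "convergent s" by (metis LIMSEQ_incseq_SUP convergent_def)
  then have Cs: "Cauchy s" by (rule convergent_Cauchy)
  have diff: "(L2_norm (\<lambda>\<zeta>. T m \<zeta> - T n \<zeta>))\<^sup>2 = s m - s n" if "n \<le> m" for m n
  proof -
    have sub: "{-int n..int n} \<subseteq> {-int m..int m}" using that by auto
    have "(\<lambda>\<zeta>. T m \<zeta> - T n \<zeta>) = trig_sum ({-int m..int m} - {-int n..int n}) d"
      using sub by (auto simp: T_def trig_sum_def fun_eq_iff sum_diff)
    then show ?thesis using sub by (simp add: L2_norm_trig_sum s_def sum_diff)
  qed
  have "\<exists>g\<in>L2. (\<lambda>n. L2_norm (\<lambda>\<zeta>. T n \<zeta> - g \<zeta>)) \<longlonglongrightarrow> 0"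
  proof (rule L2_complete)
    show "T n \<in> L2" for n by (simp add: T_def)
    fix e :: real assume e: "e > 0"
    then obtain N where N: "\<And>m n. m \<ge> N \<Longrightarrow> n \<ge> N \<Longrightarrow> norm (s m - s n) < e\<^sup>2"
      using CauchyD[OF Cs, of "e\<^sup>2"] by auto
    have *: "L2_norm (\<lambda>\<zeta>. T m \<zeta> - T n \<zeta>) < e" if "n \<le> m" "m \<ge> N" "n \<ge> N" for m n
      using diff[OF that(1)] N[OF that(2,3)] e by (intro power2_less_imp_less[of _ e]) auto
    have "L2_norm (\<lambda>\<zeta>. T m \<zeta> - T n \<zeta>) < e" if "m \<ge> N" "n \<ge> N" for m n
      using *[of n m] *[of m n] that L2_norm_minus_commute[of "T m" "T n"] by (metis nat_le_linear)
    then show "\<exists>N. \<forall>m\<ge>N. \<forall>n\<ge>N. L2_norm (\<lambda>\<zeta>. T m \<zeta> - T n \<zeta>) < e" by blast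
  qed
  then obtain D where D: "D \<in> L2" "(\<lambda>n. L2_norm (\<lambda>\<zeta>. T n \<zeta> - D \<zeta>)) \<longlonglongrightarrow> 0" by blast
  have "fourier_coeff D k = d k" for k
  proof (rule vec_eq_inner)
    fix z
    have "(\<lambda>n. ip (T n) (\<lambda>\<zeta>. (\<zeta> powi k) *s z)) \<longlonglongrightarrow> ip D (\<lambda>\<zeta>. (\<zeta> powi k) *s z)"
      by (rule ip_tendsto[OF _ D(1) _ D(2)]) (simp_all add: T_def)
    moreover have "ip (T n) (\<lambda>\<zeta>. (\<zeta> powi k) *s z) = d k \<bullet> z" if "n \<ge> nat \<bar>k\<bar>" for n
      using that unfolding T_def by (subst fourier_coeff_inner[symmetric]) (auto simp: fourier_coeff_trig_sum)
    then have "(\<lambda>n. ip (T n) (\<lambda>\<zeta>. (\<zeta> powi k) *s z)) \<longlonglongrightarrow> d k \<bullet> z"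
      by (intro tendsto_eventually eventually_sequentiallyI)
    ultimately show "fourier_coeff D k \<bullet> z = d k \<bullet> z"
      using LIMSEQ_unique by (auto simp: fourier_coeff_inner[OF D(1)])
  qed
  then show ?thesis using that D unfolding T_def by blast
qed

text \<open>Bessel's inequality makes the partial sums converge; the limit has the coefficients of \<open>f\<close> and hence is \<open>f\<close>.\<close>

lemma fourier_series_L2:
  assumes f: "f \<in> L2"
  shows "(\<lambda>N. L2_norm (\<lambda>\<zeta>. trig_sum {-int N..int N} (fourier_coeff f) \<zeta> - f \<zeta>)) \<longlonglongrightarrow> 0"
proof -
  have "(\<Sum>k\<in>{-int N..int N}. (norm (fourier_coeff f k))\<^sup>2) \<le> (L2_norm f)\<^sup>2" for N
  proof -
    let ?S = "trig_sum {-int N..int N} (fourier_coeff f)"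
    have S: "ip f ?S = (L2_norm ?S)\<^sup>2"
      using f by (simp add: ip_trig_sum L2_norm_trig_sum dot_square_norm)
    have "0 \<le> ip (\<lambda>\<zeta>. f \<zeta> - ?S \<zeta>) (\<lambda>\<zeta>. f \<zeta> - ?S \<zeta>)" by (intro L2.nonneg L2_diff f L2_trig_sum)
    also have "\<dots> = (L2_norm f)\<^sup>2 - (L2_norm ?S)\<^sup>2"
      using L2.quad_expand[OF f L2_trig_sum, of "-1" "{-int N..int N}" "fourier_coeff f"] S by (simp add: ip_self)
    finally show ?thesis by (simp add: L2_norm_trig_sum)
  qed
  from riesz_fischer[OF this] obtain D where D: "D \<in> L2" "\<And>k. fourier_coeff D k = fourier_coeff f k"
    "(\<lambda>N. L2_norm (\<lambda>\<zeta>. trig_sum {-int N..int N} (fourier_coeff f) \<zeta> - D \<zeta>)) \<longlonglongrightarrow> 0" by blast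
  have "AE \<zeta> in \<mu>. D \<zeta> - f \<zeta> = 0"
    by (rule zero_AE_of_fourier_coeff) (simp_all add: D f L2_diff fourier_coeff_diff)
  then have "L2_norm (\<lambda>\<zeta>. trig_sum {-int N..int N} (fourier_coeff f) \<zeta> - D \<zeta>)
           = L2_norm (\<lambda>\<zeta>. trig_sum {-int N..int N} (fourier_coeff f) \<zeta> - f \<zeta>)" for N
    by (intro L2_norm_cong_AE L2_diff L2_trig_sum D f) auto
  with D(3) show ?thesis by simp
qed

section \<open>Hardy spaces as annihilators\<close>

text \<open>The subspaces that occur below (\<open>H\<^sup>2\<close>, its complement, the functions vanishing at the origin or on a given set)
  are all described by orthogonality relations, so that closedness needs to be proved only once.\<close>

definition annih :: "(complex \<Rightarrow> complex^'n::finite) set \<Rightarrow> (complex \<Rightarrow> complex^'n) set" where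
  "annih S = {f \<in> L2. \<forall>h\<in>S. ip f h = 0}"

lemma annih_L2: "annih S \<subseteq> L2"
  by (auto simp: annih_def)

lemma annih_lin:
  assumes "S \<subseteq> L2" "f \<in> annih S" "g \<in> annih S"
  shows "(\<lambda>\<zeta>. f \<zeta> + c *\<^sub>R g \<zeta>) \<in> annih S"
  using assms by (auto simp: annih_def L2_lin L2.lin subset_iff)

lemma annih_zero [simp]: "(\<lambda>_. 0) \<in> annih S"
  by (simp add: annih_def)

lemma annih_complete:
  assumes S: "S \<subseteq> L2" and X: "\<And>n::nat. X n \<in> annih S"
    and C: "\<And>e. e > 0 \<Longrightarrow> \<exists>N. \<forall>m\<ge>N. \<forall>n\<ge>N. L2_norm (\<lambda>\<zeta>. X m \<zeta> - X n \<zeta>) < e"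
  shows "\<exists>g\<in>annih S. (\<lambda>n. L2_norm (\<lambda>\<zeta>. X n \<zeta> - g \<zeta>)) \<longlonglongrightarrow> 0"
proof -
  have XL: "X n \<in> L2" for n using X annih_L2 by blast
  from L2_complete[OF XL C] obtain g where g: "g \<in> L2" "(\<lambda>n. L2_norm (\<lambda>\<zeta>. X n \<zeta> - g \<zeta>)) \<longlonglongrightarrow> 0" by blast
  have "ip g h = 0" if h: "h \<in> S" for h
  proof -
    have "(\<lambda>n. ip (X n) h) \<longlonglongrightarrow> ip g h" using S h by (intro ip_tendsto XL g) auto
    moreover have "ip (X n) h = 0" for n using X[of n] h by (simp add: annih_def)
    ultimately show ?thesis by (simp add: LIMSEQ_const_iff)
  qed
  then show ?thesis using g by (auto simp: annih_def)
qed

text \<open>The \<open>L\<^sup>2\<close> inner product is not the only form of interest: the two-sided bounds transfer completeness from the \<open>L\<^sup>2\<close> norm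
  to an equivalent form \<open>b\<close>.\<close>

lemma annih_projection_form:
  assumes b: "semi_inner_space V b" and S: "S \<subseteq> L2" and M: "annih S \<subseteq> V" and V: "V \<subseteq> L2" and f: "f \<in> V"
    and c: "c > 0" and lower: "\<And>f. f \<in> V \<Longrightarrow> c * (L2_norm f)\<^sup>2 \<le> b f f"
    and upper: "\<And>f. f \<in> V \<Longrightarrow> b f f \<le> C * (L2_norm f)\<^sup>2"
  shows "\<exists>g\<in>annih S. \<forall>h\<in>annih S. b (\<lambda>\<zeta>. f \<zeta> - g \<zeta>) h = 0"
proof -
  interpret b: semi_inner_space V b by (rule b)
  show ?thesis
  proof (rule b.projection_exists[OF M _ annih_lin[OF S] _ f])
    show "annih S \<noteq> {}" using annih_zero by blast
    fix X :: "nat \<Rightarrow> complex \<Rightarrow> complex^'a"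
    assume X: "\<And>n. X n \<in> annih S"
      and Cau: "\<And>e. e > 0 \<Longrightarrow> \<exists>N. \<forall>m\<ge>N. \<forall>n\<ge>N. b (\<lambda>x. X m x - X n x) (\<lambda>x. X m x - X n x) < e"
    have XV: "(\<lambda>x. X m x - g x) \<in> V" if "g \<in> annih S" for m g
      using annih_lin[OF S X[of m] that, of "-1"] M by auto
    have "\<exists>g\<in>annih S. (\<lambda>n. L2_norm (\<lambda>\<zeta>. X n \<zeta> - g \<zeta>)) \<longlonglongrightarrow> 0"
    proof (rule annih_complete[OF S X])
      fix e :: real assume e: "e > 0"
      then obtain N where N: "\<forall>m\<ge>N. \<forall>n\<ge>N. b (\<lambda>x. X m x - X n x) (\<lambda>x. X m x - X n x) < c * e\<^sup>2"
        using Cau[of "c * e\<^sup>2"] c by auto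
      have "L2_norm (\<lambda>\<zeta>. X m \<zeta> - X n \<zeta>) < e" if "m \<ge> N" "n \<ge> N" for m n
      proof -
        have "c * (L2_norm (\<lambda>\<zeta>. X m \<zeta> - X n \<zeta>))\<^sup>2 < c * e\<^sup>2"
          using lower[OF XV[OF X]] N that by (meson le_less_trans)
        then have "(L2_norm (\<lambda>\<zeta>. X m \<zeta> - X n \<zeta>))\<^sup>2 < e\<^sup>2" using c by simp
        then show ?thesis using e by (intro power2_less_imp_less[of _ e]) auto
      qed
      then show "\<exists>N. \<forall>m\<ge>N. \<forall>n\<ge>N. L2_norm (\<lambda>\<zeta>. X m \<zeta> - X n \<zeta>) < e" by blast
    qed
    then obtain g where g: "g \<in> annih S" "(\<lambda>n. L2_norm (\<lambda>\<zeta>. X n \<zeta> - g \<zeta>)) \<longlonglongrightarrow> 0" by blast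
    have "(\<lambda>n. b (\<lambda>x. X n x - g x) (\<lambda>x. X n x - g x)) \<longlonglongrightarrow> 0"
    proof (rule tendsto_sandwich[of "\<lambda>_. 0" _ _ "\<lambda>n. C * (L2_norm (\<lambda>\<zeta>. X n \<zeta> - g \<zeta>))\<^sup>2"])
      show "(\<lambda>n. C * (L2_norm (\<lambda>\<zeta>. X n \<zeta> - g \<zeta>))\<^sup>2) \<longlonglongrightarrow> 0"
        using tendsto_mult[OF tendsto_const[of C] tendsto_power[OF g(2), of 2]] by simp
    qed (use upper[OF XV[OF g(1)]] b.nonneg[OF XV[OF g(1)]] in auto)
    with g show "\<exists>g\<in>annih S. (\<lambda>n. b (\<lambda>x. X n x - g x) (\<lambda>x. X n x - g x)) \<longlonglongrightarrow> 0" by blast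
  qed
qed

lemma annih_projection:
  assumes "S \<subseteq> L2" "f \<in> L2"
  shows "\<exists>g\<in>annih S. \<forall>h\<in>annih S. ip (\<lambda>\<zeta>. f \<zeta> - g \<zeta>) h = 0"
  by (rule annih_projection_form[of L2 ip, where c=1 and C=1])
    (use assms annih_L2 L2.semi_inner_space_axioms in \<open>auto simp: ip_self\<close>)

lemma H2_L2: "f \<in> H2 \<Longrightarrow> f \<in> L2" by (simp add: H2_def)

lemma H2_minus_L2: "f \<in> H2_minus \<Longrightarrow> f \<in> L2" by (simp add: H2_minus_def)

lemma annih_monomials:
  "annih {(\<lambda>\<zeta>. (\<zeta> powi k) *s x) | k x. k \<in> J} = {f \<in> L2. \<forall>k\<in>J. fourier_coeff f k = 0}" (is "?A = ?B")
proof
  show "?A \<subseteq> ?B"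
  proof
    fix f assume f: "f \<in> ?A"
    then have L: "f \<in> L2" by (simp add: annih_def)
    have "fourier_coeff f k = 0" if "k \<in> J" for k
    proof (rule vec_eq_inner)
      fix z show "fourier_coeff f k \<bullet> z = 0 \<bullet> z"
        using f that by (simp add: fourier_coeff_inner[OF L]) (auto simp: annih_def)
    qed
    with L show "f \<in> ?B" by simp
  qed
  show "?B \<subseteq> ?A" by (auto simp: annih_def fourier_coeff_inner[symmetric])
qed

lemma H2_eq_annih: "H2 = annih {(\<lambda>\<zeta>. (\<zeta> powi k) *s x) | k x. k \<in> {..<0}}"
  unfolding annih_monomials by (auto simp: H2_def)

lemma monomials_L2: "{(\<lambda>\<zeta>. (\<zeta> powi k) *s x) | k x. k \<in> J} \<subseteq> L2"
  by auto

lemma H2_lin: "f \<in> H2 \<Longrightarrow> g \<in> H2 \<Longrightarrow> (\<lambda>\<zeta>. f \<zeta> + c *\<^sub>R g \<zeta>) \<in> H2"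
  unfolding H2_eq_annih by (rule annih_lin[OF monomials_L2])

lemma H2_add: "f \<in> H2 \<Longrightarrow> g \<in> H2 \<Longrightarrow> (\<lambda>\<zeta>. f \<zeta> + g \<zeta>) \<in> H2"
  using H2_lin[of f g 1] by simp

lemma H2_diff: "f \<in> H2 \<Longrightarrow> g \<in> H2 \<Longrightarrow> (\<lambda>\<zeta>. f \<zeta> - g \<zeta>) \<in> H2"
  using H2_lin[of f g "-1"] by simp

lemma H2_zero [simp]: "(\<lambda>_. 0) \<in> H2"
  by (simp add: H2_def)

lemma H2_sum: "(\<And>i. i \<in> A \<Longrightarrow> f i \<in> H2) \<Longrightarrow> (\<lambda>\<zeta>. \<Sum>i\<in>A. f i \<zeta>) \<in> H2"
  by (induction A rule: infinite_finite_induct) (auto intro: H2_add)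

lemma H2_cmult: "f \<in> H2 \<Longrightarrow> (\<lambda>\<zeta>. c *s f \<zeta>) \<in> H2"
  by (simp add: H2_def L2_cmult fourier_coeff_cmult)

lemma H2_shift: "f \<in> H2 \<Longrightarrow> 0 \<le> k \<Longrightarrow> (\<lambda>\<zeta>. (\<zeta> powi k) *s f \<zeta>) \<in> H2"
  by (simp add: H2_def L2_mult_powi fourier_coeff_shift)

lemma H2_const [simp]: "(\<lambda>_. x) \<in> H2"
  by (simp add: H2_def fourier_coeff_const)

lemma H2_matrix: "f \<in> H2 \<Longrightarrow> (\<lambda>\<zeta>. A *v f \<zeta>) \<in> H2"
  by (auto simp: H2_def fourier_coeff_matrix bounded_linear.pos_bounded[OF bounded_linear_matrix]
      intro!: L2_matrix_mult[where C="onorm (\<lambda>x. A *v x)"] onorm[OF bounded_linear_matrix])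

lemma cnj_measurable [measurable]:
  "f \<in> borel_measurable M \<Longrightarrow> (\<lambda>x. cnj (f x)) \<in> borel_measurable M"
  by (rule borel_measurable_continuous_on[where f=cnj]) (intro continuous_intros)

lemma L2_inner_Re_Im:
  assumes f: "f \<in> L2" and g: "g \<in> L2"
  shows "L2_inner f g = Complex (ip f g) (ip f (\<lambda>\<zeta>. \<i> *s g \<zeta>))"
proof -
  note [measurable] = f g
  have int: "integrable \<mu> (\<lambda>\<zeta>. \<Sum>i\<in>UNIV. f \<zeta> $ i * cnj (g \<zeta> $ i))"
  proof (intro Bochner_Integration.integrable_sum)
    fix i
    show "integrable \<mu> (\<lambda>\<zeta>. f \<zeta> $ i * cnj (g \<zeta> $ i))"
    proof (rule Bochner_Integration.integrable_bound)
      show "integrable \<mu> (\<lambda>\<zeta>. (norm (f \<zeta>))\<^sup>2 + (norm (g \<zeta>))\<^sup>2)"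
        using assms by (auto intro: L2_integrable)
      have "norm (x $ i * cnj (y $ i)) \<le> (norm x)\<^sup>2 + (norm y)\<^sup>2" for x y :: "complex^'a"
      proof -
        have "norm (x $ i * cnj (y $ i)) \<le> norm x * norm y"
          by (simp add: norm_mult component_le_norm_cart Finite_Cartesian_Product.norm_nth_le mult_mono)
        then show ?thesis
          using sum_squares_bound[of "norm x" "norm y"] mult_nonneg_nonneg[OF norm_ge_zero[of x] norm_ge_zero[of y]] by linarith
      qed
      then show "AE \<zeta> in \<mu>. norm (f \<zeta> $ i * cnj (g \<zeta> $ i)) \<le> norm ((norm (f \<zeta>))\<^sup>2 + (norm (g \<zeta>))\<^sup>2)"
        by (intro AE_I2) simp
    qed measurable
  qed
  have "Re (L2_inner f g) = ip f g"
    unfolding L2_inner_def ip_def integral_Re[OF int, symmetric]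
    by (intro Bochner_Integration.integral_cong) (auto simp: inner_vec_def inner_complex_def)
  moreover have "Im (L2_inner f g) = ip f (\<lambda>\<zeta>. \<i> *s g \<zeta>)"
    unfolding L2_inner_def ip_def integral_Im[OF int, symmetric]
    by (intro Bochner_Integration.integral_cong) (auto simp: inner_vec_def inner_complex_def algebra_simps)
  ultimately show ?thesis by (simp add: complex_eq_iff)
qed

lemma L2_inner_zero_iff:
  assumes "f \<in> L2" "S \<subseteq> L2" "\<And>g. g \<in> S \<Longrightarrow> (\<lambda>\<zeta>. \<i> *s g \<zeta>) \<in> S"
  shows "(\<forall>g\<in>S. L2_inner f g = 0) \<longleftrightarrow> (\<forall>g\<in>S. ip f g = 0)"
proof
  assume a: "\<forall>g\<in>S. L2_inner f g = 0"
  show "\<forall>g\<in>S. ip f g = 0"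
  proof
    fix g assume g: "g \<in> S"
    then have "Re (L2_inner f g) = ip f g" using assms by (subst L2_inner_Re_Im) auto
    with a g show "ip f g = 0" by simp
  qed
next
  assume "\<forall>g\<in>S. ip f g = 0"
  then show "\<forall>g\<in>S. L2_inner f g = 0"
    using assms by (auto simp: L2_inner_Re_Im subset_iff complex_eq_iff)
qed

lemma H2_minus_eq_annih: "H2_minus = annih H2"
proof -
  have "(\<forall>g\<in>H2. L2_inner f g = 0) \<longleftrightarrow> (\<forall>g\<in>H2. ip f g = 0)" if "f \<in> L2" for f
    by (rule L2_inner_zero_iff[OF that]) (auto intro: H2_cmult H2_L2)
  then show ?thesis unfolding H2_minus_def annih_def by (auto intro: Collect_cong)
qed

lemma H2_minus_lin: "f \<in> H2_minus \<Longrightarrow> g \<in> H2_minus \<Longrightarrow> (\<lambda>\<zeta>. f \<zeta> + c *\<^sub>R g \<zeta>) \<in> H2_minus"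
  unfolding H2_minus_eq_annih by (rule annih_lin) (auto intro: H2_L2)

lemma H2_minus_diff: "f \<in> H2_minus \<Longrightarrow> g \<in> H2_minus \<Longrightarrow> (\<lambda>\<zeta>. f \<zeta> - g \<zeta>) \<in> H2_minus"
  using H2_minus_lin[of f g "-1"] by simp

lemma H2_minus_add: "f \<in> H2_minus \<Longrightarrow> g \<in> H2_minus \<Longrightarrow> (\<lambda>\<zeta>. f \<zeta> + g \<zeta>) \<in> H2_minus"
  using H2_minus_lin[of f g 1] by simp

lemma H2_minus_cmult:
  assumes "f \<in> H2_minus"
  shows "(\<lambda>\<zeta>. c *s f \<zeta>) \<in> H2_minus"
  using assms unfolding H2_minus_eq_annih annih_def
  by (auto simp: L2_cmult ip_scalar[of "\<lambda>_. c"] intro: H2_cmult)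

lemma H2_minus_ip: "h \<in> H2_minus \<Longrightarrow> g \<in> H2 \<Longrightarrow> ip h g = 0"
  unfolding H2_minus_eq_annih annih_def by simp

text \<open>The projection is a choice among representatives; every use of it goes through these two properties.\<close>

lemma orth_proj_annih:
  assumes M: "M = annih S" "S \<subseteq> L2" and i: "\<And>g. g \<in> M \<Longrightarrow> (\<lambda>\<zeta>. \<i> *s g \<zeta>) \<in> M" and g: "g \<in> L2"
  shows "orth_proj M g \<in> M" "\<And>k. k \<in> M \<Longrightarrow> ip (orth_proj M g) k = ip g k"
proof -
  have ML2: "M \<subseteq> L2" using M annih_L2 by blast
  obtain h where h: "h \<in> M" "\<forall>k\<in>M. ip (\<lambda>\<zeta>. g \<zeta> - h \<zeta>) k = 0"
    using annih_projection[OF M(2) g] M(1) by blast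
  have iff: "(\<forall>k\<in>M. L2_inner (\<lambda>\<zeta>. g \<zeta> - h \<zeta>) k = 0) \<longleftrightarrow> (\<forall>k\<in>M. ip (\<lambda>\<zeta>. g \<zeta> - h \<zeta>) k = 0)" if "h \<in> M" for h
    by (rule L2_inner_zero_iff[OF _ ML2 i]) (use that g ML2 in \<open>auto intro!: L2_diff\<close>)
  have "orth_proj M g \<in> M \<and> (\<forall>k\<in>M. L2_inner (\<lambda>\<zeta>. g \<zeta> - orth_proj M g \<zeta>) k = 0)"
    unfolding orth_proj_def by (rule someI[of _ h]) (use h iff in auto)
  then have *: "orth_proj M g \<in> M" "\<forall>k\<in>M. ip (\<lambda>\<zeta>. g \<zeta> - orth_proj M g \<zeta>) k = 0" using iff by auto
  then show "orth_proj M g \<in> M" by simp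
  fix k assume k: "k \<in> M"
  from * ML2 have "orth_proj M g \<in> L2" "k \<in> L2" using k by auto
  then have "ip (\<lambda>\<zeta>. g \<zeta> - orth_proj M g \<zeta>) k = ip g k - ip (orth_proj M g) k"
    by (intro ip_diff_left g)
  with *(2) k show "ip (orth_proj M g) k = ip g k" by simp
qed

lemma orth_proj_H2:
  assumes "g \<in> L2"
  shows "orth_proj H2 g \<in> H2" "\<And>k. k \<in> H2 \<Longrightarrow> ip (orth_proj H2 g) k = ip g k"
  using orth_proj_annih[OF H2_eq_annih monomials_L2 H2_cmult assms] by auto

lemma orth_proj_H2_minus:
  assumes "g \<in> L2"
  shows "orth_proj H2_minus g \<in> H2_minus" "\<And>k. k \<in> H2_minus \<Longrightarrow> ip (orth_proj H2_minus g) k = ip g k"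
  using orth_proj_annih[OF H2_minus_eq_annih _ H2_minus_cmult assms] H2_L2 by blast+

lemma inner_scalar_self: "x \<bullet> (c *s x) = Re c * (norm (x::complex^'n::finite))\<^sup>2"
  unfolding dot_square_norm[symmetric]
  by (simp add: inner_vec_def inner_complex_def sum_distrib_left algebra_simps)

text \<open>The uniqueness theorem of F. and M. Riesz, by Beurling's argument. Let \<open>f\<^sub>0\<close> be \<open>f\<close> divided by its lowest power of \<open>\<zeta>\<close>,
  and subtract the projection of \<open>f\<^sub>0\<close> onto the \<open>H\<^sup>2\<close> functions that vanish at the origin and wherever \<open>f\<close> does. The
  difference \<open>g\<close> is orthogonal to \<open>\<zeta>\<^sup>j g\<close> for all \<open>j > 0\<close>, so \<open>|g|\<^sup>2\<close> has no Fourier coefficients except the mean: it is a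
  nonzero constant, although \<open>g\<close> vanishes wherever \<open>f\<close> does.\<close>

lemma H2_nonvanishing:
  fixes f :: "complex \<Rightarrow> complex^'n::finite"
  assumes f: "f \<in> H2" and nz: "\<not> (AE \<zeta> in \<mu>. f \<zeta> = 0)"
  shows "AE \<zeta> in \<mu>. f \<zeta> \<noteq> 0"
proof -
  have fL: "f \<in> L2" using f by (rule H2_L2)
  note [measurable] = L2_measurable[OF fL]
  have neg: "fourier_coeff f k = 0" if "k < 0" for k using f that by (simp add: H2_def)
  obtain j where "fourier_coeff f j \<noteq> 0" using zero_AE_of_fourier_coeff[OF fL] nz by blast
  then have "\<exists>n. fourier_coeff f (int n) \<noteq> 0" using neg[of j] by (metis nonneg_int_cases not_le)
  define k where "k = (LEAST n. fourier_coeff f (int n) \<noteq> 0)"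
  have k: "fourier_coeff f (int k) \<noteq> 0" unfolding k_def using \<open>\<exists>n. _\<close> by (rule LeastI_ex)
  have below: "fourier_coeff f j = 0" if "j < int k" for j
  proof (cases "j < 0")
    case False
    then obtain n where n: "j = int n" by (metis nonneg_int_cases not_le)
    with that have "n < k" by simp
    then show ?thesis using not_less_Least[of n "\<lambda>n. fourier_coeff f (int n) \<noteq> 0"] n by (simp add: k_def)
  qed (rule neg)
  define f0 where "f0 \<zeta> = (\<zeta> powi (- int k)) *s f \<zeta>" for \<zeta>
  have f0L: "f0 \<in> L2" unfolding f0_def by (rule L2_mult_powi[OF fL])
  have f0c: "fourier_coeff f0 j = fourier_coeff f (j + int k)" for j
    unfolding f0_def fourier_coeff_shift by simp
  define z :: "complex \<Rightarrow> complex" where "z \<zeta> = (if f \<zeta> = 0 then 1 else 0)" for \<zeta>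
  have [measurable]: "z \<in> borel_measurable \<mu>" unfolding z_def by measurable
  have zL: "(\<lambda>\<zeta>. z \<zeta> *s h \<zeta>) \<in> L2" if "h \<in> L2" for h :: "complex \<Rightarrow> complex^'n"
    by (rule L2_mult[OF that, where C=1]) (auto simp: z_def)
  define S1 :: "(complex \<Rightarrow> complex^'n) set" where "S1 = {(\<lambda>\<zeta>. (\<zeta> powi k) *s x) | k x. k \<in> {..0}}"
  define S2 :: "(complex \<Rightarrow> complex^'n) set" where "S2 = {\<lambda>\<zeta>. z \<zeta> *s h \<zeta> | h. h \<in> L2}"
  have SL: "S1 \<union> S2 \<subseteq> L2" unfolding S1_def S2_def using zL by auto
  have mem: "h \<in> annih (S1 \<union> S2) \<longleftrightarrow> h \<in> L2 \<and> (\<forall>j\<le>0. fourier_coeff h j = 0) \<and> (\<forall>h'\<in>L2. ip h (\<lambda>\<zeta>. z \<zeta> *s h' \<zeta>) = 0)" for h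
  proof -
    have "annih (S1 \<union> S2) = annih S1 \<inter> annih S2" by (auto simp: annih_def)
    then show ?thesis unfolding S1_def annih_monomials by (auto simp: annih_def S2_def)
  qed
  obtain g0 where g0: "g0 \<in> annih (S1 \<union> S2)" "\<forall>h\<in>annih (S1 \<union> S2). ip (\<lambda>\<zeta>. f0 \<zeta> - g0 \<zeta>) h = 0"
    using annih_projection[OF SL f0L] by blast
  have g0L: "g0 \<in> L2" using g0 mem by blast
  note [measurable] = L2_measurable[OF g0L]
  define g where "g \<zeta> = f0 \<zeta> - g0 \<zeta>" for \<zeta>
  have gL: "g \<in> L2" unfolding g_def by (rule L2_diff[OF f0L g0L])
  note [measurable] = L2_measurable[OF gL]
  have gz: "AE \<zeta> in \<mu>. z \<zeta> *s g \<zeta> = 0"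
  proof -
    have "ip (\<lambda>\<zeta>. z \<zeta> *s g0 \<zeta>) (\<lambda>\<zeta>. z \<zeta> *s g0 \<zeta>) = ip g0 (\<lambda>\<zeta>. z \<zeta> *s g0 \<zeta>)"
      unfolding ip_def by (intro Bochner_Integration.integral_cong) (auto simp: z_def)
    also have "\<dots> = 0" using g0(1) g0L mem by blast
    finally have "AE \<zeta> in \<mu>. z \<zeta> *s g0 \<zeta> = 0"
      using L2_norm_eq_0_iff[OF zL[OF g0L]] by (simp add: ip_self)
    then show ?thesis by eventually_elim (auto simp: g_def f0_def z_def split: if_splits)
  qed
  have gneg: "fourier_coeff g j = 0" if "j < 0" for j
    using below[of "j + int k"] g0(1) that mem f0L g0L unfolding g_def by (simp add: fourier_coeff_diff f0c)
  have shift: "ip g (\<lambda>\<zeta>. c *s ((\<zeta> powi j) *s g \<zeta>)) = 0" if j: "j > 0" for j c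
  proof -
    have L: "(\<lambda>\<zeta>. c *s ((\<zeta> powi j) *s g \<zeta>)) \<in> L2" by (intro L2_cmult L2_mult_powi gL)
    have "(\<lambda>\<zeta>. c *s ((\<zeta> powi j) *s g \<zeta>)) \<in> annih (S1 \<union> S2)"
      unfolding mem
    proof (intro conjI allI impI ballI L)
      fix i :: int assume "i \<le> 0"
      then show "fourier_coeff (\<lambda>\<zeta>. c *s ((\<zeta> powi j) *s g \<zeta>)) i = 0"
        using j gneg[of "i - j"] unfolding fourier_coeff_cmult[OF L2_mult_powi[OF gL]] fourier_coeff_shift by simp
    next
      fix h' :: "complex \<Rightarrow> complex^'n" assume h': "h' \<in> L2"
      show "ip (\<lambda>\<zeta>. c *s ((\<zeta> powi j) *s g \<zeta>)) (\<lambda>\<zeta>. z \<zeta> *s h' \<zeta>) = 0"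
        unfolding ip_def
        by (rule integral_eq_zero_AE) (use gz in eventually_elim, auto simp: z_def split: if_splits)
    qed
    with g0(2) show ?thesis unfolding g_def[abs_def] by blast
  qed
  have gint: "integrable \<mu> (\<lambda>\<zeta>. (norm (g \<zeta>))\<^sup>2)" by (rule L2_integrable[OF gL])
  have cint: "integrable \<mu> (\<lambda>\<zeta>. (\<zeta> powi j) * complex_of_real ((norm (g \<zeta>))\<^sup>2))" for j
    by (rule Bochner_Integration.integrable_bound[OF gint])
      (measurable, intro AE_I2, simp add: norm_mult norm_power_int norm_power)
  have pos: "(\<integral>\<zeta>. (\<zeta> powi j) * complex_of_real ((norm (g \<zeta>))\<^sup>2) \<partial>\<mu>) = 0" if j: "j > 0" for j
  proof (rule complex_eqI)
    have r: "Re (c * (\<integral>\<zeta>. (\<zeta> powi j) * complex_of_real ((norm (g \<zeta>))\<^sup>2) \<partial>\<mu>)) = 0" for c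
    proof -
      have "ip g (\<lambda>\<zeta>. c *s ((\<zeta> powi j) *s g \<zeta>)) = Re (c * (\<integral>\<zeta>. (\<zeta> powi j) * complex_of_real ((norm (g \<zeta>))\<^sup>2) \<partial>\<mu>))"
      proof -
      have "ip g (\<lambda>\<zeta>. c *s ((\<zeta> powi j) *s g \<zeta>)) = (\<integral>\<zeta>. Re (c * ((\<zeta> powi j) * complex_of_real ((norm (g \<zeta>))\<^sup>2))) \<partial>\<mu>)"
        unfolding ip_def
        by (intro Bochner_Integration.integral_cong refl)
          (simp only: vector_smult_assoc inner_scalar_self mult.assoc[symmetric], simp)
      also have "\<dots> = Re (c * (\<integral>\<zeta>. (\<zeta> powi j) * complex_of_real ((norm (g \<zeta>))\<^sup>2) \<partial>\<mu>))"
        using cint[of j] by (subst integral_Re) (auto simp del: times_complex.simps)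
      finally show ?thesis .
      qed
      then show ?thesis by (simp only: shift[OF j, of c])
    qed
    from r[of 1] r[of \<i>]
    show "Re (\<integral>\<zeta>. (\<zeta> powi j) * complex_of_real ((norm (g \<zeta>))\<^sup>2) \<partial>\<mu>) = Re 0"
      and "Im (\<integral>\<zeta>. (\<zeta> powi j) * complex_of_real ((norm (g \<zeta>))\<^sup>2) \<partial>\<mu>) = Im 0" by auto
  qed
  have all: "(\<integral>\<zeta>. (\<zeta> powi j) * complex_of_real ((norm (g \<zeta>))\<^sup>2) \<partial>\<mu>) = 0" if j: "j \<noteq> 0" for j
  proof (cases "j > 0")
    case False
    have "(\<integral>\<zeta>. (\<zeta> powi j) * complex_of_real ((norm (g \<zeta>))\<^sup>2) \<partial>\<mu>)
        = (\<integral>\<zeta>. cnj ((\<zeta> powi (- j)) * complex_of_real ((norm (g \<zeta>))\<^sup>2)) \<partial>\<mu>)"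
      by (intro Bochner_Integration.integral_cong refl)
        (simp del: complex_cnj_power_int add: cnj_powi_unimodular)
    also have "\<dots> = cnj (\<integral>\<zeta>. (\<zeta> powi (- j)) * complex_of_real ((norm (g \<zeta>))\<^sup>2) \<partial>\<mu>)"
      by (rule Bochner_Integration.integral_cnj)
    also have "\<dots> = 0" using False j pos[of "- j"] by (simp del: of_real_power)
    finally show ?thesis .
  qed (rule pos)
  define a where "a = (\<integral>\<zeta>. (norm (g \<zeta>))\<^sup>2 \<partial>\<mu>)"
  have const: "AE \<zeta> in \<mu>. (norm (g \<zeta>))\<^sup>2 - a = 0"
  proof (rule zero_AE_of_fourier_real)
    show "integrable \<mu> (\<lambda>\<zeta>. (norm (g \<zeta>))\<^sup>2 - a)" using gint by simp
    fix j
    have i1: "integrable \<mu> (\<lambda>\<zeta>::complex. \<zeta> powi j)"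
      by (rule circle.integrable_const_bound[where B=1]) (auto simp: norm_power_int)
    have "(\<integral>\<zeta>. (\<zeta> powi j) * complex_of_real ((norm (g \<zeta>))\<^sup>2 - a) \<partial>\<mu>)
        = (\<integral>\<zeta>. (\<zeta> powi j) * complex_of_real ((norm (g \<zeta>))\<^sup>2) - (\<zeta> powi j) * complex_of_real a \<partial>\<mu>)"
      by (simp add: algebra_simps)
    also have "\<dots> = (\<integral>\<zeta>. (\<zeta> powi j) * complex_of_real ((norm (g \<zeta>))\<^sup>2) \<partial>\<mu>) - (\<integral>\<zeta>. (\<zeta> powi j) * complex_of_real a \<partial>\<mu>)"
      using i1 cint[of j] by (intro Bochner_Integration.integral_diff) auto
    also have "\<dots> = 0"
    proof (cases "j = 0")
      case True
      have "(\<integral>\<zeta>. complex_of_real ((norm (g \<zeta>))\<^sup>2) \<partial>\<mu>) = complex_of_real a"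
        unfolding a_def by (rule integral_complex_of_real)
      then show ?thesis using True circle.prob_space by simp
    next
      case False
      have "(\<integral>\<zeta>. (\<zeta> powi j) * complex_of_real a \<partial>\<mu>) = 0"
        using False integral_powi_circle[of j] by simp
      then show ?thesis using all[OF False] by simp
    qed
    finally show "(\<integral>\<zeta>. (\<zeta> powi j) * complex_of_real ((norm (g \<zeta>))\<^sup>2 - a) \<partial>\<mu>) = 0" .
  qed
  have "a \<noteq> 0"
  proof
    assume "a = 0"
    then have "L2_norm g = 0" by (simp add: L2_norm_def a_def)
    then have "AE \<zeta> in \<mu>. g \<zeta> = 0" using L2_norm_eq_0_iff[OF gL] by simp
    then have "fourier_coeff g 0 = 0" using fourier_coeff_cong_AE[OF gL L2_zero] by simp
    moreover have "fourier_coeff g 0 = fourier_coeff f (int k)"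
      using g0(1) mem f0L g0L unfolding g_def by (simp add: fourier_coeff_diff f0c)
    ultimately show False using k by simp
  qed
  show ?thesis using const gz
    by eventually_elim (use \<open>a \<noteq> 0\<close> in \<open>auto simp: z_def split: if_splits\<close>)
qed

section \<open>Radial limits\<close>

definition poisson_kernel :: "complex \<Rightarrow> complex \<Rightarrow> real" where
  "poisson_kernel z \<eta> = (1 - (norm z)\<^sup>2) / (norm (\<eta> - z))\<^sup>2"

definition poisson :: "(complex \<Rightarrow> complex^'n::finite) \<Rightarrow> complex \<Rightarrow> complex^'n" where
  "poisson f z = (\<integral>\<eta>. poisson_kernel z \<eta> *\<^sub>R f \<eta> \<partial>\<mu>)"

lemma poisson_kernel_nonneg: "norm z < 1 \<Longrightarrow> 0 \<le> poisson_kernel z \<eta>"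
  by (simp add: poisson_kernel_def power_le_one)

lemma poisson_kernel_measurable [measurable]: "poisson_kernel z \<in> borel_measurable \<mu>"
  unfolding poisson_kernel_def by (intro borel_measurable_circle) measurable

lemma poisson_kernel_series:
  assumes z: "norm z < 1" and \<eta>: "norm \<eta> = 1"
  shows "(\<lambda>n. (z * cnj \<eta>) ^ n + (cnj z * \<eta>) ^ Suc n) sums complex_of_real (poisson_kernel z \<eta>)"
proof -
  define q where "q = z * cnj \<eta>"
  have q: "norm q < 1" "norm (cnj q) < 1" using z \<eta> by (simp_all add: q_def norm_mult)
  have "(\<lambda>n. q ^ n) sums (1 / (1 - q))" by (rule geometric_sums[OF q(1)])
  moreover have "(\<lambda>n. cnj q * cnj q ^ n) sums (cnj q * (1 / (1 - cnj q)))"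
    by (intro sums_mult geometric_sums q)
  ultimately have "(\<lambda>n. q ^ n + cnj q * cnj q ^ n) sums (1 / (1 - q) + cnj q * (1 / (1 - cnj q)))"
    by (rule sums_add)
  moreover have "1 / (1 - q) + cnj q * (1 / (1 - cnj q)) = complex_of_real (poisson_kernel z \<eta>)"
  proof -
    have ne: "1 - q \<noteq> 0" "1 - cnj q \<noteq> 0" using q by auto
    have "1 / (1 - q) + cnj q * (1 / (1 - cnj q)) = (1 - q * cnj q) / ((1 - q) * cnj (1 - q))"
      using ne by (simp add: field_simps)
    also have "(1 - q) * cnj (1 - q) = complex_of_real ((norm (1 - q))\<^sup>2)"
      by (rule complex_norm_square[symmetric])
    also have "q * cnj q = complex_of_real ((norm q)\<^sup>2)"
      by (rule complex_norm_square[symmetric])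
    also have "norm q = norm z" using \<eta> by (simp add: q_def norm_mult)
    also have "norm (1 - q) = norm (\<eta> - z)"
    proof -
      have "\<eta> * cnj \<eta> = 1" using \<eta> by (simp add: complex_norm_square[symmetric])
      then have "(\<eta> - z) * cnj \<eta> = 1 - q" by (simp add: q_def algebra_simps)
      then have "norm (1 - q) = norm (\<eta> - z) * norm (cnj \<eta>)" by (metis norm_mult)
      then show ?thesis using \<eta> by simp
    qed
    finally show ?thesis by (simp add: poisson_kernel_def)
  qed
  ultimately show ?thesis by (simp add: q_def)
qed

text \<open>The Poisson integral of an \<open>H\<^sup>2\<close> function is its power series: the antianalytic half of the kernel
  only meets vanishing coefficients.\<close>

lemma poisson_power_series:
  fixes f :: "complex \<Rightarrow> complex^'n::finite"
  assumes f: "f \<in> H2" and z: "norm z < 1"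
  shows "(\<lambda>n. z ^ n *s fourier_coeff f (int n)) sums poisson f z"
proof -
  have fL: "f \<in> L2" using f by (rule H2_L2)
  note [measurable] = L2_measurable[OF fL]
  define t where "t n \<eta> = (z ^ n) *s ((\<eta> powi (- int n)) *s f \<eta>) + (cnj z ^ Suc n) *s ((\<eta> powi (int n + 1)) *s f \<eta>)" for n \<eta>
  have tL: "t n \<in> L2" for n
    unfolding t_def by (intro L2_add L2_cmult L2_mult_powi fL)
  have t_eq: "t n \<eta> = ((z * cnj \<eta>) ^ n + (cnj z * \<eta>) ^ Suc n) *s f \<eta>" if "norm \<eta> = 1" for n \<eta>
  proof -
    have "\<eta> powi (- int n) = cnj \<eta> ^ n" "\<eta> powi (int n + 1) = \<eta> ^ Suc n"
      using that by (auto simp: power_int_minus cnj_unimodular power_int_add power_inverse)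
    then show ?thesis
      by (simp add: t_def vector_smult_assoc power_mult_distrib vector_sadd_rdistrib)
  qed
  have bound: "norm (t n \<eta>) \<le> norm (f \<eta>) * (2 * norm z ^ n)" if "norm \<eta> = 1" for n \<eta>
  proof -
    have "norm ((z * cnj \<eta>) ^ n + (cnj z * \<eta>) ^ Suc n) \<le> norm z ^ n + norm z ^ Suc n"
      using that by (intro order_trans[OF norm_triangle_ineq]) (simp add: norm_mult norm_power)
    also have "\<dots> \<le> 2 * norm z ^ n" using z mult_right_mono[of "norm z" 1 "norm z ^ n"] by simp
    finally have "norm ((z * cnj \<eta>) ^ n + (cnj z * \<eta>) ^ Suc n) \<le> 2 * norm z ^ n" .
    from mult_right_mono[OF this norm_ge_zero[of "f \<eta>"]] show ?thesis
      unfolding t_eq[OF that] norm_scalar_vec by (simp only: mult.commute)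
  qed
  have sums: "(\<lambda>n. t n \<eta>) sums (poisson_kernel z \<eta> *\<^sub>R f \<eta>)" if "norm \<eta> = 1" for \<eta>
    unfolding t_eq[OF that] scaleR_as_scalar_vec
    by (rule bounded_linear.sums[OF bounded_bilinear.bounded_linear_left[OF bounded_bilinear_scalar_vec] poisson_kernel_series[OF z that]])
  have geo: "summable (\<lambda>n. c * (2 * norm z ^ n))" for c :: real
    using z by (intro summable_mult summable_geometric) simp
  have "(\<lambda>n. integral\<^sup>L \<mu> (t n)) sums (\<integral>\<eta>. (\<Sum>n. t n \<eta>) \<partial>\<mu>)"
  proof (rule sums_integral)
    show "integrable \<mu> (t n)" for n by (rule L2_integrable_vec[OF tL])
    show "AE \<eta> in \<mu>. summable (\<lambda>n. norm (t n \<eta>))"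
      using bound by (intro AE_I2 summable_comparison_test'[OF geo]) simp
    show "summable (\<lambda>n. \<integral>\<eta>. norm (t n \<eta>) \<partial>\<mu>)"
    proof (rule summable_comparison_test'[OF geo])
      fix n
      have "(\<integral>\<eta>. norm (t n \<eta>) \<partial>\<mu>) \<le> (\<integral>\<eta>. norm (f \<eta>) * (2 * norm z ^ n) \<partial>\<mu>)"
        using L2_integrable_vec[OF tL] L2_integrable_vec[OF fL] bound by (intro integral_mono) auto
      then show "norm (\<integral>\<eta>. norm (t n \<eta>) \<partial>\<mu>) \<le> (\<integral>\<eta>. norm (f \<eta>) \<partial>\<mu>) * (2 * norm z ^ n)"
        by (simp add: integral_nonneg_AE)
    qed
  qed
  moreover have "(\<integral>\<eta>. (\<Sum>n. t n \<eta>) \<partial>\<mu>) = poisson f z"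
    unfolding poisson_def using sums by (intro Bochner_Integration.integral_cong) (auto simp: sums_unique[symmetric])
  moreover have "integral\<^sup>L \<mu> (t n) = z ^ n *s fourier_coeff f (int n)" for n
  proof -
    have "integral\<^sup>L \<mu> (t n) = fourier_coeff (t n) 0"
      by (simp add: fourier_coeff_def)
    also have "\<dots> = z ^ n *s fourier_coeff f (int n) + (cnj z ^ Suc n) *s fourier_coeff f (- (int n + 1))"
      unfolding t_def
      unfolding fourier_coeff_add[OF L2_cmult[OF L2_mult_powi[OF fL]] L2_cmult[OF L2_mult_powi[OF fL]]]
        fourier_coeff_cmult[OF L2_mult_powi[OF fL]] fourier_coeff_shift by simp
    also have "fourier_coeff f (- (int n + 1)) = 0" using f by (simp add: H2_def)
    finally show ?thesis by simp
  qed
  ultimately show ?thesis by simp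
qed

lemma poisson_kernel_integrable:
  assumes z: "norm z < 1" and u: "integrable \<mu> u"
  shows "integrable \<mu> (\<lambda>\<eta>. poisson_kernel z \<eta> *\<^sub>R (u \<eta> :: 'b::{banach, second_countable_topology}))"
proof (rule Bochner_Integration.integrable_bound)
  note [measurable] = borel_measurable_integrable[OF u]
  define C where "C = (1 - (norm z)\<^sup>2) / (1 - norm z)\<^sup>2"
  show "integrable \<mu> (\<lambda>\<eta>. C * norm (u \<eta>))" using u by simp
  show "(\<lambda>\<eta>. poisson_kernel z \<eta> *\<^sub>R u \<eta>) \<in> borel_measurable \<mu>" by measurable
  show "AE \<eta> in \<mu>. norm (poisson_kernel z \<eta> *\<^sub>R u \<eta>) \<le> norm (C * norm (u \<eta>))"
  proof (rule AE_I2)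
    fix \<eta> assume "\<eta> \<in> space \<mu>"
    then have "1 - norm z \<le> norm (\<eta> - z)" using norm_triangle_ineq2[of \<eta> z] by simp
    then have "(1 - norm z)\<^sup>2 \<le> (norm (\<eta> - z))\<^sup>2" using z by (intro power_mono) auto
    then have "poisson_kernel z \<eta> \<le> C"
      unfolding poisson_kernel_def C_def using z by (intro frac_le) (auto simp: power_le_one)
    then show "norm (poisson_kernel z \<eta> *\<^sub>R u \<eta>) \<le> norm (C * norm (u \<eta>))"
      using poisson_kernel_nonneg[OF z, of \<eta>] by (simp add: abs_mult mult_right_mono)
  qed
qed

lemma integral_poisson_kernel:
  assumes z: "norm z < 1"
  shows "(\<integral>\<eta>. poisson_kernel z \<eta> \<partial>\<mu>) = 1"
proof -
  let ?e = "axis 1 1 :: complex^1"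
  have a: "(\<lambda>n. z ^ n *s fourier_coeff (\<lambda>_. ?e) (int n)) sums poisson (\<lambda>_. ?e) z"
    by (rule poisson_power_series[OF H2_const z])
  have b: "(\<lambda>n. z ^ n *s fourier_coeff (\<lambda>_. ?e) (int n)) sums (\<Sum>n\<in>{0}. z ^ n *s fourier_coeff (\<lambda>_. ?e) (int n))"
    by (rule sums_finite) (auto simp: fourier_coeff_const)
  have "poisson (\<lambda>_. ?e) z = ?e"
    using sums_unique2[OF a b] by (simp add: fourier_coeff_const)
  moreover have "poisson (\<lambda>_. ?e) z = (\<integral>\<eta>. poisson_kernel z \<eta> \<partial>\<mu>) *\<^sub>R ?e"
    unfolding poisson_def using poisson_kernel_integrable[OF z, of "\<lambda>_. 1::real"] by simp
  ultimately have "(\<integral>\<eta>. poisson_kernel z \<eta> \<partial>\<mu>) *\<^sub>R ?e = 1 *\<^sub>R ?e" by simp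
  moreover have "?e \<noteq> 0" by (simp add: axis_eq_0_iff)
  ultimately show ?thesis unfolding scaleR_cancel_right by blast
qed

lemma norm_poisson_le:
  assumes z: "norm z < 1" and u: "integrable \<mu> f"
  shows "norm (poisson f z) \<le> (\<integral>\<eta>. poisson_kernel z \<eta> * norm (f \<eta>) \<partial>\<mu>)"
proof -
  have "norm (poisson f z) \<le> (\<integral>\<eta>. norm (poisson_kernel z \<eta> *\<^sub>R f \<eta>) \<partial>\<mu>)"
    unfolding poisson_def by (rule integral_norm_bound)
  also have "\<dots> = (\<integral>\<eta>. poisson_kernel z \<eta> * norm (f \<eta>) \<partial>\<mu>)"
    by (simp add: poisson_kernel_nonneg[OF z])
  finally show ?thesis .
qed

lemma norm_poisson_bounded:
  assumes z: "norm z < 1" and f: "f \<in> L2" and C: "AE \<zeta> in \<mu>. norm (f \<zeta>) \<le> C"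
  shows "norm (poisson f z) \<le> C"
proof -
  note fi = L2_integrable_vec[OF f]
  have "norm (poisson f z) \<le> (\<integral>\<eta>. poisson_kernel z \<eta> * norm (f \<eta>) \<partial>\<mu>)"
    by (rule norm_poisson_le[OF z fi])
  also have "\<dots> \<le> (\<integral>\<eta>. poisson_kernel z \<eta> * C \<partial>\<mu>)"
  proof (rule integral_mono_AE)
    show "integrable \<mu> (\<lambda>\<eta>. poisson_kernel z \<eta> * norm (f \<eta>))"
      using poisson_kernel_integrable[OF z integrable_norm[OF fi]] by simp
    show "integrable \<mu> (\<lambda>\<eta>. poisson_kernel z \<eta> * C)"
      using poisson_kernel_integrable[OF z, of "\<lambda>_. C"] by simp
    show "AE \<eta> in \<mu>. poisson_kernel z \<eta> * norm (f \<eta>) \<le> poisson_kernel z \<eta> * C"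
      using C by eventually_elim (intro mult_left_mono poisson_kernel_nonneg z)
  qed
  also have "\<dots> = C" by (simp add: integral_poisson_kernel[OF z])
  finally show ?thesis .
qed

lemma poisson_holomorphic:
  fixes f :: "complex \<Rightarrow> complex^'n::finite"
  assumes f: "f \<in> H2"
  shows "(\<lambda>z. poisson f z $ i) holomorphic_on ball 0 1"
proof (rule power_series_holomorphic)
  fix w :: complex assume "w \<in> ball 0 1"
  then have "norm w < 1" by simp
  from bounded_linear.sums[OF bounded_linear_vec_nth poisson_power_series[OF f this]]
  show "(\<lambda>n. fourier_coeff f (int n) $ i * (w - 0) ^ n) sums (poisson f w $ i)"
    by (simp add: mult.commute)
qed

text \<open>With \<open>e = 1 - r\<close>, a point of the circle at distance at least \<open>2\<^sup>k e \<ge> 2 e\<close> from \<open>\<zeta>\<close> keeps at least half that distance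
  from \<open>r \<zeta>\<close>, so the kernel decays like \<open>4\<^sup>-\<^sup>k / e\<close> on dyadic shells.\<close>

lemma poisson_kernel_dyadic:
  fixes r :: real
  assumes r: "0 \<le> r" "r < 1" and \<zeta>: "norm \<zeta> = 1" and \<eta>: "norm \<eta> = 1" and N: "2 < 2 ^ Suc N * (1 - r)"
  shows "poisson_kernel (of_real r * \<zeta>) \<eta>
    \<le> (\<Sum>k\<le>N. 8 / (4 ^ k * (1 - r)) * indicator (ball \<zeta> (2 ^ Suc k * (1 - r))) \<eta>)"
proof -
  define e where "e = 1 - r"
  have e: "e > 0" "e \<le> 1" using r by (auto simp: e_def)
  define d where "d = dist \<zeta> \<eta>"
  have d2: "d \<le> 2" unfolding d_def dist_norm using norm_triangle_ineq4[of \<zeta> \<eta>] \<zeta> \<eta> by simp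
  define z where "z = complex_of_real r * \<zeta>"
  have nz: "norm z = r" using r \<zeta> by (simp add: z_def norm_mult)
  have ge_e: "e \<le> norm (\<eta> - z)" using norm_triangle_ineq2[of \<eta> z] \<eta> nz by (simp add: e_def)
  have ge_d: "d - e \<le> norm (\<eta> - z)"
  proof -
    have "norm (\<zeta> - z) = e"
    proof -
      have "\<zeta> - z = of_real (1 - r) * \<zeta>" by (simp add: z_def algebra_simps)
      then show ?thesis using r \<zeta> by (simp add: norm_mult e_def del: of_real_diff)
    qed
    moreover have "d \<le> norm (\<eta> - z) + norm (\<zeta> - z)"
      unfolding d_def dist_norm using norm_triangle_ineq4[of "\<zeta> - z" "\<eta> - z"] by simp
    ultimately show ?thesis by simp
  qed
  have num: "1 - r\<^sup>2 \<le> 2 * e" using r by (simp add: e_def power2_eq_square algebra_simps)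
     (use sum_squares_bound[of r 1] in \<open>simp add: power2_eq_square\<close>)
  have num0: "0 \<le> 1 - r\<^sup>2" using r by (simp add: power_le_one)
  have ex: "d < 2 ^ Suc N * e" using d2 N by (simp add: e_def)
  \<comment> \<open>The dyadic shell around \<open>\<zeta>\<close> that contains \<open>\<eta>\<close>; the last of the given balls covers the whole circle.\<close>
  define k where "k = (LEAST k. d < 2 ^ Suc k * e)"
  have k: "d < 2 ^ Suc k * e" unfolding k_def by (rule LeastI[where P="\<lambda>k. d < 2 ^ Suc k * e", OF ex])
  have kN: "k \<le> N" unfolding k_def by (rule Least_le[where P="\<lambda>k. d < 2 ^ Suc k * e", OF ex])
  have "poisson_kernel z \<eta> \<le> 8 / (4 ^ k * e)"
  proof (cases k)
    case 0
    have "poisson_kernel z \<eta> \<le> (2 * e) / e\<^sup>2"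
      unfolding poisson_kernel_def nz using num num0 ge_e e
      by (intro frac_le power_mono) auto
    also have "\<dots> = 2 / e" using e by (simp add: power2_eq_square)
    also have "\<dots> \<le> 8 / e" using e by (intro divide_right_mono) auto
    finally show ?thesis using 0 by simp
  next
    case (Suc j)
    have "\<not> d < 2 ^ Suc j * e"
      using not_less_Least[of j "\<lambda>k. d < 2 ^ Suc k * e"] Suc by (simp add: k_def)
    then have lo: "2 ^ k * e \<le> d" using Suc by simp
    moreover have "2 * e \<le> 2 ^ k * e" using Suc e by simp
    ultimately have "d / 2 \<le> norm (\<eta> - z)" using ge_d by linarith
    moreover have "2 ^ k * e / 2 \<le> d / 2" using lo by simp
    ultimately have lo2: "2 ^ k * e / 2 \<le> norm (\<eta> - z)" by linarith
    have "poisson_kernel z \<eta> \<le> (2 * e) / (2 ^ k * e / 2)\<^sup>2"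
      unfolding poisson_kernel_def nz using num num0 lo2 e
      by (intro frac_le power_mono) auto
    also have "(2 ^ k * e / 2)\<^sup>2 = 4 ^ k * e\<^sup>2 / 4"
    proof -
      have "(4::real) ^ k = 2 ^ k * 2 ^ k" by (simp add: power_mult_distrib[symmetric])
      then show ?thesis by (simp add: power2_eq_square)
    qed
    also have "(2 * e) / (4 ^ k * e\<^sup>2 / 4) = 8 / (4 ^ k * e)"
      using e by (simp add: field_simps power2_eq_square)
    finally show ?thesis .
  qed
  also have "\<dots> = 8 / (4 ^ k * e) * indicator (ball \<zeta> (2 ^ Suc k * e)) \<eta>"
    using k by (simp add: d_def)
  also have "\<dots> \<le> (\<Sum>k\<le>N. 8 / (4 ^ k * e) * indicator (ball \<zeta> (2 ^ Suc k * e)) \<eta>)"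
    using kN e by (intro member_le_sum) auto
  finally show ?thesis by (simp add: z_def e_def)
qed

lemma indicator_ball_measurable_circle [measurable]:
  "(indicator (ball \<zeta> s) :: complex \<Rightarrow> real) \<in> borel_measurable \<mu>"
  by (intro borel_measurable_circle borel_measurable_indicator) simp

text \<open>The shell of radius \<open>2\<^sup>k\<^sup>+\<^sup>1 e\<close> contributes at most \<open>8 a \<cdot> 2\<^sup>k\<^sup>+\<^sup>1 / 4\<^sup>k\<close>, and these bounds sum to at most \<open>32 a\<close>.\<close>

lemma poisson_le_maximal:
  fixes u :: "complex \<Rightarrow> real"
  assumes u: "integrable \<mu> u" and pos: "\<And>\<eta>. 0 \<le> u \<eta>" and \<zeta>: "norm \<zeta> = 1"
    and r: "0 \<le> r" "r < 1"
    and M: "\<And>s. s > 0 \<Longrightarrow> (\<integral>\<eta>. indicator (ball \<zeta> s) \<eta> * u \<eta> \<partial>\<mu>) \<le> a * s" and a: "0 \<le> a"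
  shows "(\<integral>\<eta>. poisson_kernel (of_real r * \<zeta>) \<eta> * u \<eta> \<partial>\<mu>) \<le> 32 * a"
proof -
  note [measurable] = borel_measurable_integrable[OF u]
  define e where "e = 1 - r"
  have e: "e > 0" using r by (simp add: e_def)
  obtain N where "2 / e < 2 ^ N" using real_arch_pow[of 2 "2 / e"] by auto
  then have "2 < 2 ^ N * e" using e by (simp add: field_simps)
  then have N: "2 < 2 ^ Suc N * e" using e by simp
  have z: "norm (of_real r * \<zeta>) < 1" using r \<zeta> by (simp add: norm_mult)
  have int: "integrable \<mu> (\<lambda>\<eta>. indicator (ball \<zeta> s) \<eta> * u \<eta>)" for s
    by (rule Bochner_Integration.integrable_bound[OF u]) (auto simp: indicator_def)
  have "(\<integral>\<eta>. poisson_kernel (of_real r * \<zeta>) \<eta> * u \<eta> \<partial>\<mu>)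
     \<le> (\<integral>\<eta>. (\<Sum>k\<le>N. 8 / (4 ^ k * e) * (indicator (ball \<zeta> (2 ^ Suc k * e)) \<eta> * u \<eta>)) \<partial>\<mu>)"
  proof (rule integral_mono)
    show "integrable \<mu> (\<lambda>\<eta>. poisson_kernel (of_real r * \<zeta>) \<eta> * u \<eta>)"
      using poisson_kernel_integrable[OF z u] by simp
    show "integrable \<mu> (\<lambda>\<eta>. (\<Sum>k\<le>N. 8 / (4 ^ k * e) * (indicator (ball \<zeta> (2 ^ Suc k * e)) \<eta> * u \<eta>)))"
      by (intro Bochner_Integration.integrable_sum integrable_mult_right int)
    fix \<eta> assume "\<eta> \<in> space \<mu>"
    then have "norm \<eta> = 1" by simp
    from mult_right_mono[OF poisson_kernel_dyadic[OF r \<zeta> this N[unfolded e_def]] pos[of \<eta>]]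
    show "poisson_kernel (of_real r * \<zeta>) \<eta> * u \<eta>
      \<le> (\<Sum>k\<le>N. 8 / (4 ^ k * e) * (indicator (ball \<zeta> (2 ^ Suc k * e)) \<eta> * u \<eta>))"
      by (simp add: e_def sum_distrib_right mult.assoc)
  qed
  also have "\<dots> = (\<Sum>k\<le>N. 8 / (4 ^ k * e) * (\<integral>\<eta>. indicator (ball \<zeta> (2 ^ Suc k * e)) \<eta> * u \<eta> \<partial>\<mu>))"
  proof -
    have "(\<integral>\<eta>. (\<Sum>k\<le>N. 8 / (4 ^ k * e) * (indicator (ball \<zeta> (2 ^ Suc k * e)) \<eta> * u \<eta>)) \<partial>\<mu>)
       = (\<Sum>k\<le>N. \<integral>\<eta>. 8 / (4 ^ k * e) * (indicator (ball \<zeta> (2 ^ Suc k * e)) \<eta> * u \<eta>) \<partial>\<mu>)"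
      by (rule Bochner_Integration.integral_sum) (intro integrable_mult_right int)
    then show ?thesis by (simp only: integral_mult_right_zero)
  qed
  also have "\<dots> \<le> (\<Sum>k\<le>N. 8 / (4 ^ k * e) * (a * (2 ^ Suc k * e)))"
    using e by (intro sum_mono mult_left_mono M) auto
  also have "\<dots> = 16 * a * (\<Sum>k\<le>N. (1/2) ^ k)"
  proof -
    have "8 / (4 ^ k * e) * (a * (2 ^ Suc k * e)) = 16 * a * (1/2) ^ k" for k
    proof -
      have "(4::real) ^ k = 2 ^ k * 2 ^ k" by (simp add: power_mult_distrib[symmetric])
      then show ?thesis using e by (simp add: field_simps power_divide)
    qed
    then show ?thesis by (simp add: sum_distrib_left)
  qed
  also have "\<dots> \<le> 16 * a * 2"
  proof (intro mult_left_mono)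
    have "(\<Sum>k\<le>N. (1/2::real) ^ k) = (\<Sum>k<Suc N. (1/2) ^ k)" by (simp add: lessThan_Suc_atMost)
    also have "\<dots> \<le> (\<Sum>k. (1/2::real) ^ k)" by (intro sum_le_suminf summable_geometric) auto
    also have "\<dots> = 2" by (simp add: suminf_geometric)
    finally show "(\<Sum>k\<le>N. (1/2::real) ^ k) \<le> 2" .
  qed (use a in auto)
  finally show ?thesis by simp
qed

text \<open>The Hardy-Littlewood maximal inequality. The bad points are centres of balls in the plane that carry too much mass of
  \<open>u\<close>; Vitali's covering lemma makes them disjoint at the price of a factor 5 in the radii.\<close>

lemma maximal_inequality:
  fixes u :: "complex \<Rightarrow> real"
  assumes u: "integrable \<mu> u" and pos: "\<And>\<eta>. 0 \<le> u \<eta>" and a: "0 < a"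
  obtains U where "U \<in> sets \<mu>" "measure \<mu> U \<le> 10 / a * (\<integral>\<eta>. u \<eta> \<partial>\<mu>)"
    "\<And>\<zeta> s. norm \<zeta> = 1 \<Longrightarrow> \<zeta> \<notin> U \<Longrightarrow> s > 0 \<Longrightarrow> (\<integral>\<eta>. indicator (ball \<zeta> s) \<eta> * u \<eta> \<partial>\<mu>) \<le> a * s"
proof -
  note [measurable] = borel_measurable_integrable[OF u]
  define I where "I \<zeta> s = (\<integral>\<eta>. indicator (ball \<zeta> s) \<eta> * u \<eta> \<partial>\<mu>)" for \<zeta> s
  have int: "integrable \<mu> (\<lambda>\<eta>. indicator (ball \<zeta> s) \<eta> * u \<eta>)" for \<zeta> s
    by (rule Bochner_Integration.integrable_bound[OF u]) (auto simp: indicator_def)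
  define K where "K = {\<zeta>. norm \<zeta> = 1 \<and> (\<exists>s>0. I \<zeta> s > a * s)}"
  define s where "s \<zeta> = (SOME s. s > 0 \<and> I \<zeta> s > a * s)" for \<zeta>
  have s: "s \<zeta> > 0" "I \<zeta> (s \<zeta>) > a * s \<zeta>" if "\<zeta> \<in> K" for \<zeta>
    using someI_ex[of "\<lambda>s. s > 0 \<and> I \<zeta> s > a * s"] that by (auto simp: K_def s_def)
  have bound: "s \<zeta> \<le> (\<integral>\<eta>. u \<eta> \<partial>\<mu>) / a" if "\<zeta> \<in> K" for \<zeta>
  proof -
    have "I \<zeta> (s \<zeta>) \<le> (\<integral>\<eta>. u \<eta> \<partial>\<mu>)"
      unfolding I_def using pos by (intro integral_mono int u) (auto simp: indicator_def)
    then show ?thesis using s(2)[OF that] a by (simp add: field_simps)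
  qed
  obtain C where C: "countable C" "C \<subseteq> K"
     "pairwise (\<lambda>i j. disjnt (ball i (s i)) (ball j (s j))) C"
     "K \<subseteq> (\<Union>i\<in>C. ball i (5 * s i))"
  proof (rule Vitali_covering_lemma_balls[where S=K and K=K and a="\<lambda>i. i" and r=s and B="(\<integral>\<eta>. u \<eta> \<partial>\<mu>) / a"])
    show "K \<subseteq> (\<Union>i\<in>K. ball i (s i))" using s(1) by force
  qed (use s(1) bound in auto)
  define B where "B i t = ball i t \<inter> sphere 0 1" for i :: complex and t :: real
  have Bs [measurable]: "B i t \<in> sets \<mu>" for i t unfolding B_def by (rule borel_sets_circle) simp
  define U where "U = (\<Union>i\<in>C. B i (5 * s i))"
  have U: "U \<in> sets \<mu>" unfolding U_def using C(1) by (intro sets.countable_UN'') auto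
  \<comment> \<open>As a measure, the mass of \<open>u\<close> is additive over the disjoint balls.\<close>
  define \<nu> where "\<nu> = density \<mu> (\<lambda>\<eta>. ennreal (u \<eta>))"
  have \<nu>B: "emeasure \<nu> (B i t) = ennreal (I i t)" for i t
  proof -
    have "emeasure \<nu> (B i t) = (\<integral>\<^sup>+\<eta>. ennreal (u \<eta>) * indicator (B i t) \<eta> \<partial>\<mu>)"
      unfolding \<nu>_def by (rule emeasure_density) auto
    also have "\<dots> = (\<integral>\<^sup>+\<eta>. ennreal (indicator (ball i t) \<eta> * u \<eta>) \<partial>\<mu>)"
      by (intro nn_integral_cong) (auto simp: B_def indicator_def)
    also have "\<dots> = ennreal (I i t)" unfolding I_def using pos by (intro nn_integral_eq_integral int) auto
    finally show ?thesis .
  qed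
  have "emeasure \<mu> U = (\<integral>\<^sup>+x. indicator U x \<partial>\<mu>)" using U by simp
  also have "\<dots> \<le> (\<integral>\<^sup>+x. (\<integral>\<^sup>+i. indicator (B i (5 * s i)) x \<partial>count_space C) \<partial>\<mu>)"
  proof (rule nn_integral_mono)
    fix x
    show "indicator U x \<le> (\<integral>\<^sup>+i. indicator (B i (5 * s i)) x \<partial>count_space C)"
    proof (cases "x \<in> U")
      case True
      then obtain i where i: "i \<in> C" "x \<in> B i (5 * s i)" by (auto simp: U_def)
      have "(\<integral>\<^sup>+j. indicator {i} j \<partial>count_space C) \<le> (\<integral>\<^sup>+j. indicator (B j (5 * s j)) x \<partial>count_space C)"
        using i by (intro nn_integral_mono) (auto simp: indicator_def)
      moreover have "(\<integral>\<^sup>+j. indicator {i} j \<partial>count_space C) = 1" using i by simp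
      ultimately show ?thesis using True by simp
    qed simp
  qed
  also have "\<dots> = (\<integral>\<^sup>+i. (\<integral>\<^sup>+x. indicator (B i (5 * s i)) x \<partial>\<mu>) \<partial>count_space C)"
    by (rule nn_integral_count_space_nn_integral[OF C(1)]) measurable
  also have "\<dots> \<le> (\<integral>\<^sup>+i. ennreal (10 / a) * emeasure \<nu> (B i (s i)) \<partial>count_space C)"
  proof (rule nn_integral_mono)
    fix i assume "i \<in> space (count_space C)"
    then have i: "i \<in> K" using C by auto
    have "emeasure \<mu> (B i (5 * s i)) \<le> ennreal (2 * (5 * s i))"
      unfolding B_def circle.emeasure_eq_measure using i s(1)[OF i]
      by (intro ennreal_leI arc_measure_le) (auto simp: K_def)
    also have "\<dots> \<le> ennreal (10 / a * I i (s i))"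
      using s(2)[OF i] a by (intro ennreal_leI) (simp add: field_simps)
    also have "\<dots> = ennreal (10 / a) * emeasure \<nu> (B i (s i))"
      using a ennreal_mult'[of "10 / a" "I i (s i)"] by (simp add: \<nu>B)
    finally show "(\<integral>\<^sup>+x. indicator (B i (5 * s i)) x \<partial>\<mu>) \<le> ennreal (10 / a) * emeasure \<nu> (B i (s i))"
      by simp
  qed
  also have "\<dots> = ennreal (10 / a) * (\<integral>\<^sup>+i. emeasure \<nu> (B i (s i)) \<partial>count_space C)"
    by (rule nn_integral_cmult) simp
  also have "(\<integral>\<^sup>+i. emeasure \<nu> (B i (s i)) \<partial>count_space C) = emeasure \<nu> (\<Union>i\<in>C. B i (s i))"
  proof (rule emeasure_UN_countable[symmetric])
    show "disjoint_family_on (\<lambda>i. B i (s i)) C"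
      using C(3) by (fastforce simp: disjoint_family_on_def pairwise_def disjnt_def B_def)
  qed (use C(1) in \<open>auto simp: \<nu>_def\<close>)
  also have "\<dots> \<le> emeasure \<nu> (space \<nu>)" by (rule emeasure_space)
  also have "\<dots> = ennreal (\<integral>\<eta>. u \<eta> \<partial>\<mu>)"
  proof -
    have "emeasure \<nu> (space \<mu>) = (\<integral>\<^sup>+\<eta>. ennreal (u \<eta>) * indicator (space \<mu>) \<eta> \<partial>\<mu>)"
      unfolding \<nu>_def by (rule emeasure_density[OF _ sets.top]) measurable
    also have "\<dots> = (\<integral>\<^sup>+\<eta>. ennreal (u \<eta>) \<partial>\<mu>)" by (intro nn_integral_cong) auto
    also have "\<dots> = ennreal (\<integral>\<eta>. u \<eta> \<partial>\<mu>)" using pos by (intro nn_integral_eq_integral u) auto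
    finally show ?thesis by (simp add: \<nu>_def)
  qed
  finally have "emeasure \<mu> U \<le> ennreal (10 / a) * ennreal (\<integral>\<eta>. u \<eta> \<partial>\<mu>)"
    by (simp add: mult_left_mono)
  also have "\<dots> = ennreal (10 / a * (\<integral>\<eta>. u \<eta> \<partial>\<mu>))" using a ennreal_mult'[of "10 / a" "\<integral>\<eta>. u \<eta> \<partial>\<mu>"] by simp
  finally have "measure \<mu> U \<le> 10 / a * (\<integral>\<eta>. u \<eta> \<partial>\<mu>)"
    using a pos by (simp add: circle.emeasure_eq_measure integral_nonneg_AE)
  with U show ?thesis
  proof (rule that)
    fix \<zeta> t assume \<zeta>: "norm \<zeta> = 1" "\<zeta> \<notin> U" and t: "t > (0::real)"
    have "\<zeta> \<notin> K" using C(4) \<zeta> by (auto simp: U_def B_def)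
    then have "\<not> (\<exists>s>0. I \<zeta> s > a * s)" using \<zeta>(1) by (simp add: K_def)
    then have "\<not> I \<zeta> t > a * t" using t by blast
    then show "(\<integral>\<eta>. indicator (ball \<zeta> t) \<eta> * u \<eta> \<partial>\<mu>) \<le> a * t"
      unfolding I_def by simp
  qed
qed

text \<open>Fatou's theorem. The radial limits of the Fourier sums are clear, and the maximal inequality controls the remainder off a
  small set.\<close>

lemma poisson_radial_limit:
  fixes f :: "complex \<Rightarrow> complex^'n::finite"
  assumes f: "f \<in> H2"
  shows "AE \<zeta> in \<mu>. ((\<lambda>r. poisson f (complex_of_real r * \<zeta>)) \<longlongrightarrow> f \<zeta>) (at_left 1)"
proof -
  have fL: "f \<in> L2" using f by (rule H2_L2)
  define T where "T N = trig_sum {-int N..int N} (fourier_coeff f)" for N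
  have TL: "T N \<in> L2" for N by (simp add: T_def)
  have TH: "T N \<in> H2" for N using f by (auto simp: H2_def T_def fourier_coeff_trig_sum)
  have T_eq: "T N \<zeta> = (\<Sum>n\<le>N. \<zeta> ^ n *s fourier_coeff f (int n))" for N \<zeta>
  proof -
    have "T N \<zeta> = (\<Sum>k\<in>int ` {..N}. (\<zeta> powi k) *s fourier_coeff f k)"
      unfolding T_def trig_sum_def
    proof (rule sum.mono_neutral_right)
      show "\<forall>k\<in>{- int N..int N} - int ` {..N}. (\<zeta> powi k) *s fourier_coeff f k = 0"
      proof
        fix k assume k: "k \<in> {- int N..int N} - int ` {..N}"
        have "k < 0"
        proof (rule ccontr)
          assume "\<not> k < 0"
          then have "k = int (nat k)" "nat k \<le> N" using k by auto
          then show False using k by blast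
        qed
        then show "(\<zeta> powi k) *s fourier_coeff f k = 0" using f by (simp add: H2_def)
      qed
    qed auto
    then show ?thesis by (simp add: sum.reindex)
  qed
  have pT: "poisson (T N) z = (\<Sum>n\<le>N. z ^ n *s fourier_coeff f (int n))" if "norm z < 1" for N z
  proof -
    have "(\<lambda>n. z ^ n *s fourier_coeff (T N) (int n)) sums (\<Sum>n\<le>N. z ^ n *s fourier_coeff (T N) (int n))"
      by (rule sums_finite) (auto simp: T_def fourier_coeff_trig_sum)
    from sums_unique2[OF this poisson_power_series[OF TH that]] show ?thesis
      by (simp add: T_def fourier_coeff_trig_sum)
  qed
  have T_lim: "((\<lambda>r. poisson (T N) (complex_of_real r * \<zeta>)) \<longlongrightarrow> T N \<zeta>) (at_left 1)" if "norm \<zeta> = 1" for N \<zeta>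
  proof (rule Lim_transform_eventually)
    have "((\<lambda>r. \<Sum>n\<le>N. (complex_of_real r * \<zeta>) ^ n *s fourier_coeff f (int n)) \<longlongrightarrow>
       (\<Sum>n\<le>N. (complex_of_real 1 * \<zeta>) ^ n *s fourier_coeff f (int n))) (at_left 1)"
      by (intro tendsto_intros)
    then show "((\<lambda>r. \<Sum>n\<le>N. (complex_of_real r * \<zeta>) ^ n *s fourier_coeff f (int n)) \<longlongrightarrow> T N \<zeta>) (at_left 1)"
      by (simp add: T_eq)
    have "\<forall>\<^sub>F r in at_left (1::real). 0 < r \<and> r < 1"
      using eventually_at_left_real[of 0 "1::real"] by simp
    then show "\<forall>\<^sub>F r in at_left 1. (\<Sum>n\<le>N. (complex_of_real r * \<zeta>) ^ n *s fourier_coeff f (int n)) = poisson (T N) (complex_of_real r * \<zeta>)"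
      by eventually_elim (simp add: pT norm_mult that)
  qed
  \<comment> \<open>An error of \<open>4\<^sup>-\<^sup>j\<close> in mean exceeds \<open>2\<^sup>-\<^sup>j\<close> only on a set of measure about \<open>2\<^sup>-\<^sup>j\<close>, which is summable.\<close>
  have "\<exists>N. L2_norm (\<lambda>\<zeta>. T N \<zeta> - f \<zeta>) < (1/4) ^ j" for j :: nat
  proof -
    have "(\<lambda>N. L2_norm (\<lambda>\<zeta>. T N \<zeta> - f \<zeta>)) \<longlonglongrightarrow> 0" unfolding T_def by (rule fourier_series_L2[OF fL])
    then have "\<forall>\<^sub>F N in sequentially. L2_norm (\<lambda>\<zeta>. T N \<zeta> - f \<zeta>) < (1/4) ^ j"
      by (rule order_tendstoD(2)) simp
    then show ?thesis by (auto simp: eventually_sequentially)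
  qed
  then obtain N where N: "\<And>j. L2_norm (\<lambda>\<zeta>. T (N j) \<zeta> - f \<zeta>) < (1/4) ^ j" by metis
  define u where "u j \<zeta> = norm (T (N j) \<zeta> - f \<zeta>)" for j \<zeta>
  have dL: "(\<lambda>\<zeta>. T (N j) \<zeta> - f \<zeta>) \<in> L2" for j by (rule L2_diff[OF TL fL])
  have u_int: "integrable \<mu> (u j)" for j
    unfolding u_def by (intro integrable_norm L2_integrable_vec dL)
  note [measurable] = borel_measurable_integrable[OF u_int]
  have u_small: "(\<integral>\<zeta>. u j \<zeta> \<partial>\<mu>) \<le> (1/4) ^ j" for j
    unfolding u_def using integral_norm_le_L2_norm[OF dL[of j]] N[of j] by linarith
  have "\<exists>U. U \<in> sets \<mu> \<and> measure \<mu> U \<le> 10 / ((1/2)^j) * (\<integral>\<eta>. u j \<eta> \<partial>\<mu>) \<and>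
    (\<forall>\<zeta> s. norm \<zeta> = 1 \<longrightarrow> \<zeta> \<notin> U \<longrightarrow> s > 0 \<longrightarrow> (\<integral>\<eta>. indicator (ball \<zeta> s) \<eta> * u j \<eta> \<partial>\<mu>) \<le> (1/2)^j * s)" for j
    by (rule maximal_inequality[OF u_int, of j "(1/2)^j"]) (auto simp: u_def)
  then obtain U where U: "\<And>j. U j \<in> sets \<mu>" "\<And>j. measure \<mu> (U j) \<le> 10 / ((1/2)^j) * (\<integral>\<eta>. u j \<eta> \<partial>\<mu>)"
    "\<And>j \<zeta> s. norm \<zeta> = 1 \<Longrightarrow> \<zeta> \<notin> U j \<Longrightarrow> s > 0 \<Longrightarrow> (\<integral>\<eta>. indicator (ball \<zeta> s) \<eta> * u j \<eta> \<partial>\<mu>) \<le> (1/2)^j * s"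
    by metis
  define W where "W j = {\<zeta> \<in> space \<mu>. (1/2) ^ j \<le> u j \<zeta>}" for j
  have W: "W j \<in> sets \<mu>" for j unfolding W_def by measurable
  have half: "(1/4) ^ j / (1/2) ^ j = (1/2 :: real) ^ j" for j :: nat
    by (simp add: power_divide[symmetric])
  have W_small: "measure \<mu> (W j) \<le> (1/2) ^ j" for j
  proof -
    have "measure \<mu> (W j) \<le> (\<integral>\<eta>. u j \<eta> \<partial>\<mu>) / (1/2) ^ j"
      unfolding W_def by (rule integral_Markov_inequality_measure[OF u_int]) (auto simp: u_def)
    also have "\<dots> \<le> (1/4) ^ j / (1/2) ^ j" by (intro divide_right_mono u_small) simp
    finally show ?thesis by (simp only: half)
  qed
  have U_small: "measure \<mu> (U j) \<le> 10 * (1/2) ^ j" for j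
  proof -
    have "measure \<mu> (U j) \<le> 10 * ((\<integral>\<eta>. u j \<eta> \<partial>\<mu>) / (1/2)^j)" using U(2)[of j] by simp
    also have "\<dots> \<le> 10 * ((1/4) ^ j / (1/2) ^ j)" by (intro mult_left_mono divide_right_mono u_small) auto
    finally show ?thesis by (simp only: half)
  qed
  have "AE \<zeta> in \<mu>. \<forall>\<^sub>F j in sequentially. \<zeta> \<in> space \<mu> - (U j \<union> W j)"
  proof (rule borel_cantelli_AE1)
    show "U j \<union> W j \<in> sets \<mu>" for j using U(1) W by simp
    show "emeasure \<mu> (U j \<union> W j) < \<infinity>" for j by (simp add: circle.emeasure_eq_measure)
    show "summable (\<lambda>j. measure \<mu> (U j \<union> W j))"
    proof (rule summable_comparison_test')
      show "summable (\<lambda>j. 11 * (1/2 :: real) ^ j)" by (intro summable_mult summable_geometric) simp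
      fix j
      have "measure \<mu> (U j \<union> W j) \<le> measure \<mu> (U j) + measure \<mu> (W j)"
        using U(1) W by (intro measure_subadditive) (auto simp: circle.emeasure_eq_measure)
      then show "norm (measure \<mu> (U j \<union> W j)) \<le> 11 * (1/2) ^ j"
        using U_small[of j] W_small[of j] by simp
    qed
  qed
  then show ?thesis
  proof eventually_elim
    case (elim \<zeta>)
    then have \<zeta>: "norm \<zeta> = 1" by (auto simp: eventually_sequentially)
    show ?case
    proof (rule tendstoI)
      fix e :: real assume e: "e > 0"
      \<comment> \<open>34 = 32 + 1 + 1: the maximal function, the remainder at \<open>\<zeta>\<close> itself, and the radial limit of the Fourier sum.\<close>
      have "(\<lambda>j. 34 * (1/2 :: real) ^ j) \<longlonglongrightarrow> 34 * 0" by (intro tendsto_mult tendsto_const LIMSEQ_power_zero) simp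
      then have "\<forall>\<^sub>F j in sequentially. 34 * (1/2 :: real) ^ j < e" using e by (intro order_tendstoD(2)) auto
      with elim have "\<forall>\<^sub>F j in sequentially. 34 * (1/2 :: real) ^ j < e \<and> \<zeta> \<in> space \<mu> - (U j \<union> W j)"
        by eventually_elim simp
      then obtain j where j: "34 * (1/2 :: real) ^ j < e" "\<zeta> \<notin> U j" "\<zeta> \<notin> W j"
        by (auto simp: eventually_sequentially)
      have uj: "u j \<zeta> < (1/2) ^ j" using j(3) \<zeta> by (auto simp: W_def)
      have max: "norm (poisson (\<lambda>\<zeta>. T (N j) \<zeta> - f \<zeta>) (complex_of_real r * \<zeta>)) \<le> 32 * (1/2) ^ j"
        if r: "0 \<le> r" "r < 1" for r
      proof -
        have z: "norm (complex_of_real r * \<zeta>) < 1" using r \<zeta> by (simp add: norm_mult)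
        have "norm (poisson (\<lambda>\<zeta>. T (N j) \<zeta> - f \<zeta>) (complex_of_real r * \<zeta>))
           \<le> (\<integral>\<eta>. poisson_kernel (complex_of_real r * \<zeta>) \<eta> * u j \<eta> \<partial>\<mu>)"
          unfolding u_def by (rule norm_poisson_le[OF z L2_integrable_vec[OF dL]])
        also have "\<dots> \<le> 32 * (1/2) ^ j"
          by (rule poisson_le_maximal[OF u_int _ \<zeta> r U(3)[OF \<zeta> j(2)]]) (auto simp: u_def)
        finally show ?thesis .
      qed
      have "\<forall>\<^sub>F r in at_left (1::real). dist (poisson (T (N j)) (complex_of_real r * \<zeta>)) (T (N j) \<zeta>) < (1/2) ^ j"
        by (rule tendstoD[OF T_lim[OF \<zeta>]]) simp
      moreover have "\<forall>\<^sub>F r in at_left (1::real). 0 < r \<and> r < 1"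
        using eventually_at_left_real[of 0 "1::real"] by simp
      ultimately show "\<forall>\<^sub>F r in at_left 1. dist (poisson f (complex_of_real r * \<zeta>)) (f \<zeta>) < e"
      proof eventually_elim
        case (elim r)
        have z: "norm (complex_of_real r * \<zeta>) < 1" using elim \<zeta> by (simp add: norm_mult)
        let ?z = "complex_of_real r * \<zeta>"
        have "poisson (\<lambda>\<zeta>. T (N j) \<zeta> - f \<zeta>) ?z = poisson (T (N j)) ?z - poisson f ?z"
          unfolding poisson_def
          using poisson_kernel_integrable[OF z L2_integrable_vec[OF TL]] poisson_kernel_integrable[OF z L2_integrable_vec[OF fL]]
          by (simp add: scaleR_diff_right)
        then have eq: "poisson f ?z - f \<zeta> = (poisson (T (N j)) ?z - T (N j) \<zeta>) + (T (N j) \<zeta> - f \<zeta>)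
            - poisson (\<lambda>\<zeta>. T (N j) \<zeta> - f \<zeta>) ?z"
          by simp
        have "norm (poisson f ?z - f \<zeta>) \<le> norm (poisson (T (N j)) ?z - T (N j) \<zeta>) + u j \<zeta>
            + norm (poisson (\<lambda>\<zeta>. T (N j) \<zeta> - f \<zeta>) ?z)"
          unfolding u_def eq
          using norm_triangle_ineq4[of "(poisson (T (N j)) ?z - T (N j) \<zeta>) + (T (N j) \<zeta> - f \<zeta>)" "poisson (\<lambda>\<zeta>. T (N j) \<zeta> - f \<zeta>) ?z"]
            norm_triangle_ineq[of "poisson (T (N j)) ?z - T (N j) \<zeta>" "T (N j) \<zeta> - f \<zeta>"]
          by linarith
        also have "\<dots> < (1/2) ^ j + (1/2) ^ j + 32 * (1/2) ^ j"
          using elim max[of r] uj by (simp add: dist_norm)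
        finally show ?case using j(1) by (simp add: dist_norm)
      qed
    qed
  qed
qed

section \<open>Bounded matrix functions\<close>

lemma norm_matrix_le: "norm (A *v x) \<le> mat_norm A * norm x"
  unfolding mat_norm_def by (rule onorm[OF bounded_linear_matrix])

lemma mat_norm_le: "(\<And>x. norm (A *v x) \<le> C * norm x) \<Longrightarrow> mat_norm A \<le> C"
  unfolding mat_norm_def by (rule onorm_le)

lemma mat_norm_nonneg: "0 \<le> mat_norm A"
  unfolding mat_norm_def by (rule onorm_pos_le[OF bounded_linear_matrix])

lemma mat_norm_diff_le: "mat_norm (A - B) \<le> mat_norm A + mat_norm B"
proof (rule mat_norm_le)
  fix x
  have "norm ((A - B) *v x) \<le> norm (A *v x) + norm (B *v x)"
    unfolding matrix_vector_mult_diff_rdistrib by (rule norm_triangle_ineq4)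
  also have "\<dots> \<le> (mat_norm A + mat_norm B) * norm x"
    using norm_matrix_le[of A x] norm_matrix_le[of B x] by (simp add: distrib_right)
  finally show "norm ((A - B) *v x) \<le> (mat_norm A + mat_norm B) * norm x" .
qed

lemma continuous_mat_norm: "continuous_on UNIV (mat_norm :: complex^'n::finite^'m::finite \<Rightarrow> real)"
proof -
  obtain K where K: "K > 0" "\<And>(A::complex^'n^'m) x. norm (A *v x) \<le> norm A * norm x * K"
    using bounded_bilinear.pos_bounded[OF bounded_bilinear_matrix_vec] by metis
  have le: "mat_norm A \<le> K * norm A" for A :: "complex^'n^'m"
    using K(2)[of A] by (intro mat_norm_le) (simp add: mult_ac)
  have *: "mat_norm A - mat_norm B \<le> K * norm (A - B)" for A B :: "complex^'n^'m"
  proof -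
    have "mat_norm A \<le> mat_norm (A - B) + mat_norm B"
    proof (rule mat_norm_le)
      fix x
      have "A *v x = (A - B) *v x + B *v x" by (simp add: matrix_vector_mult_diff_rdistrib)
      then have "norm (A *v x) \<le> norm ((A - B) *v x) + norm (B *v x)" by (simp add: norm_triangle_ineq)
      also have "\<dots> \<le> (mat_norm (A - B) + mat_norm B) * norm x"
        using norm_matrix_le[of "A - B" x] norm_matrix_le[of B x] by (simp add: distrib_right)
      finally show "norm (A *v x) \<le> (mat_norm (A - B) + mat_norm B) * norm x" .
    qed
    then show ?thesis using le[of "A - B"] by simp
  qed
  show ?thesis
  proof (rule continuous_onI)
    fix A :: "complex^'n^'m" and e :: real assume e: "e > 0"
    have "dist (mat_norm B) (mat_norm A) \<le> e" if "dist B A < e / K" for B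
    proof -
      have "K * norm (B - A) \<le> e" using that K(1) by (simp add: dist_norm field_simps)
      then show ?thesis using *[of A B] *[of B A] by (simp add: dist_real_def norm_minus_commute)
    qed
    then show "\<exists>d>0. \<forall>B\<in>UNIV. dist B A < d \<longrightarrow> dist (mat_norm B) (mat_norm A) \<le> e"
      using e K(1) by (intro exI[of _ "e / K"]) auto
  qed
qed

lemma mat_norm_measurable [measurable]:
  assumes "\<Phi> \<in> borel_measurable M"
  shows "(\<lambda>\<zeta>. mat_norm (\<Phi> \<zeta>)) \<in> borel_measurable M"
  by (rule borel_measurable_continuous_on[OF continuous_mat_norm assms])

lemma Linf_measurable [measurable_dest]: "\<Phi> \<in> Linf \<Longrightarrow> \<Phi> \<in> borel_measurable \<mu>"
  by (simp add: Linf_def)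

lemma Linf_norm_ereal:
  assumes "\<Phi> \<in> Linf"
  shows "esssup \<mu> (\<lambda>\<zeta>. ereal (mat_norm (\<Phi> \<zeta>))) = ereal (Linf_norm \<Phi>)" and "0 \<le> Linf_norm \<Phi>"
proof -
  note [measurable] = Linf_measurable[OF assms]
  obtain C where C: "AE \<zeta> in \<mu>. mat_norm (\<Phi> \<zeta>) \<le> C" using assms by (auto simp: Linf_def)
  let ?e = "esssup \<mu> (\<lambda>\<zeta>. ereal (mat_norm (\<Phi> \<zeta>)))"
  have "?e \<le> ereal C" using C by (intro esssup_I) auto
  moreover have "AE \<zeta> in \<mu>. ereal (mat_norm (\<Phi> \<zeta>)) \<le> ?e" by (rule esssup_AE)
  then have "AE \<zeta> in \<mu>. 0 \<le> ?e"
    by eventually_elim (meson ereal_less_eq(5) mat_norm_nonneg order_trans)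
  then have "0 \<le> ?e" by (simp add: circle.AE_const)
  ultimately show "?e = ereal (Linf_norm \<Phi>)" "0 \<le> Linf_norm \<Phi>"
    unfolding Linf_norm_def by (cases ?e; auto)+
qed

lemma Linf_norm_AE:
  assumes "\<Phi> \<in> Linf"
  shows "AE \<zeta> in \<mu>. mat_norm (\<Phi> \<zeta>) \<le> Linf_norm \<Phi>"
  using esssup_AE[of "\<lambda>\<zeta>. ereal (mat_norm (\<Phi> \<zeta>))" \<mu>] by (simp add: Linf_norm_ereal[OF assms])

lemma Linf_norm_le:
  assumes "\<Phi> \<in> Linf" "AE \<zeta> in \<mu>. mat_norm (\<Phi> \<zeta>) \<le> C"
  shows "Linf_norm \<Phi> \<le> C"
proof -
  note [measurable] = Linf_measurable[OF assms(1)]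
  have "esssup \<mu> (\<lambda>\<zeta>. ereal (mat_norm (\<Phi> \<zeta>))) \<le> ereal C"
    using assms(2) by (intro esssup_I) auto
  then show ?thesis by (simp add: Linf_norm_ereal[OF assms(1)])
qed

lemma Linf_diff:
  assumes "\<Phi> \<in> Linf" "\<Psi> \<in> Linf"
  shows "(\<lambda>\<zeta>. \<Phi> \<zeta> - \<Psi> \<zeta>) \<in> Linf"
proof -
  note [measurable] = assms
  have "AE \<zeta> in \<mu>. mat_norm (\<Phi> \<zeta> - \<Psi> \<zeta>) \<le> Linf_norm \<Phi> + Linf_norm \<Psi>"
    using Linf_norm_AE[OF assms(1)] Linf_norm_AE[OF assms(2)]
    by eventually_elim (meson add_mono mat_norm_diff_le order_trans)
  then show ?thesis unfolding Linf_def by auto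
qed

lemma Linf_const: "(\<lambda>_. A) \<in> Linf"
  unfolding Linf_def by auto

lemma Linf_mult_AE:
  assumes "\<Phi> \<in> Linf"
  shows "AE \<zeta> in \<mu>. \<forall>x. norm (\<Phi> \<zeta> *v x) \<le> Linf_norm \<Phi> * norm x"
  using Linf_norm_AE[OF assms]
  by eventually_elim (meson mult_right_mono norm_ge_zero norm_matrix_le order_trans)

lemma Linf_L2: "\<Phi> \<in> Linf \<Longrightarrow> f \<in> L2 \<Longrightarrow> (\<lambda>\<zeta>. \<Phi> \<zeta> *v f \<zeta>) \<in> L2"
  by (rule L2_matrix_mult[OF _ Linf_measurable Linf_mult_AE])

lemma Linf_L2_norm: "\<Phi> \<in> Linf \<Longrightarrow> f \<in> L2 \<Longrightarrow> L2_norm (\<lambda>\<zeta>. \<Phi> \<zeta> *v f \<zeta>) \<le> Linf_norm \<Phi> * L2_norm f"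
  using Linf_mult_AE[of \<Phi>] Linf_norm_ereal(2)[of \<Phi>]
  by (intro L2_norm_le_of_AE Linf_L2) auto

text \<open>On matrices, \<open>*s\<close> would take a vector as its first argument and multiply each row by it entrywise.\<close>

definition cscale :: "complex \<Rightarrow> complex^'n::finite^'m::finite \<Rightarrow> complex^'n^'m" where
  "cscale c A = (\<chi> i j. c * A $ i $ j)"

lemma cscale_mult: "cscale c A *v x = c *s (A *v x)"
  by (simp add: cscale_def matrix_vector_mult_def vec_eq_iff sum_distrib_left mult.assoc)

lemma Linf_cscale_powi:
  fixes \<Phi> :: "complex \<Rightarrow> complex^'n::finite^'m::finite"
  assumes "\<Phi> \<in> Linf"
  shows "(\<lambda>\<zeta>. cscale (\<zeta> powi k) (\<Phi> \<zeta>)) \<in> Linf"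
proof -
  note [measurable] = assms
  have "bounded_bilinear (\<lambda>c (A::complex^'n^'m). cscale c A)"
  proof (subst bilinear_conv_bounded_bilinear[symmetric], unfold bilinear_def, safe)
    show "linear (\<lambda>y. cscale c y)" for c
      by (intro linearI) (simp_all add: cscale_def vec_eq_iff algebra_simps)
    show "linear (\<lambda>c. cscale c y)" for y
      by (intro linearI) (simp_all add: cscale_def vec_eq_iff algebra_simps)
  qed
  note cont = bounded_bilinear.continuous_on[OF this]
  have "(\<lambda>p::complex \<times> (complex^'n^'m). cscale (fst p) (snd p)) \<in> borel_measurable borel"
    by (intro borel_measurable_continuous_onI cont continuous_intros)
  then have "(\<lambda>\<zeta>. (\<lambda>p::complex \<times> (complex^'n^'m). cscale (fst p) (snd p)) (\<zeta> powi k, \<Phi> \<zeta>)) \<in> borel_measurable \<mu>"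
    by measurable
  moreover have "AE \<zeta> in \<mu>. mat_norm (cscale (\<zeta> powi k) (\<Phi> \<zeta>)) \<le> Linf_norm \<Phi>"
    using Linf_mult_AE[OF assms] AE_circle_norm
    by eventually_elim (auto intro!: mat_norm_le simp: cscale_mult norm_power_int)
  ultimately show ?thesis unfolding Linf_def by auto
qed

text \<open>The analytic function that the definition of \<open>H\<^sup>\<infinity>\<close> asks for is the Poisson extension of the columns.\<close>

lemma Hinf_of_columns_H2:
  fixes F :: "complex \<Rightarrow> complex^'n::finite^'m::finite"
  assumes F: "F \<in> Linf" and H: "\<And>x. (\<lambda>\<zeta>. F \<zeta> *v x) \<in> H2"
  shows "F \<in> Hinf"
proof -
  define G :: "complex \<Rightarrow> complex^'n^'m" where "G z = (\<chi> l i. poisson (\<lambda>\<zeta>. F \<zeta> *v axis i 1) z $ l)" for z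
  have col: "(A *v axis i 1) $ l = A $ l $ i" for A :: "complex^'n^'m" and l i
    by (simp add: matrix_vector_mult_def axis_def if_distrib sum.delta cong: if_cong)
  have hol: "(\<lambda>z. G z $ l $ i) holomorphic_on ball 0 1" for l i
    unfolding G_def using poisson_holomorphic[OF H[of "axis i 1"], of l] by simp
  have "bounded (G ` ball 0 1)"
  proof (rule boundedI)
    fix A assume "A \<in> G ` ball 0 1"
    then obtain z where z: "norm z < 1" "A = G z" by auto
    have p: "norm (poisson (\<lambda>\<zeta>. F \<zeta> *v axis i 1) z) \<le> Linf_norm F" for i
    proof (rule norm_poisson_bounded[OF z(1) H2_L2[OF H]])
      show "AE \<zeta> in \<mu>. norm (F \<zeta> *v axis i 1) \<le> Linf_norm F"
        using Linf_mult_AE[OF F]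
      proof eventually_elim
        case (elim \<zeta>)
        have "norm (axis i 1 :: complex^'n) = 1" by (simp add: norm_eq_sqrt_inner inner_axis_axis)
        with elim[rule_format, of "axis i 1"] show ?case by simp
      qed
    qed
    have "norm (G z $ l $ i) \<le> Linf_norm F" for l i
      unfolding G_def using order_trans[OF Finite_Cartesian_Product.norm_nth_le p] by simp
    then have "norm (G z $ l) \<le> (\<Sum>i\<in>(UNIV::'n set). Linf_norm F)" for l
      unfolding norm_vec_def[of "G z $ l"] by (intro order_trans[OF L2_set_le_sum] sum_mono) auto
    then have "norm (G z) \<le> (\<Sum>l\<in>(UNIV::'m set). \<Sum>i\<in>(UNIV::'n set). Linf_norm F)"
      unfolding norm_vec_def[of "G z"] by (intro order_trans[OF L2_set_le_sum] sum_mono) auto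
    then show "norm A \<le> (\<Sum>l\<in>(UNIV::'m set). \<Sum>i\<in>(UNIV::'n set). Linf_norm F)" using z by simp
  qed
  moreover have "AE \<zeta> in \<mu>. ((\<lambda>r. G (complex_of_real r * \<zeta>)) \<longlongrightarrow> F \<zeta>) (at_left 1)"
  proof -
    have "AE \<zeta> in \<mu>. \<forall>i\<in>UNIV. ((\<lambda>r. poisson (\<lambda>\<zeta>. F \<zeta> *v axis i 1) (complex_of_real r * \<zeta>)) \<longlongrightarrow> F \<zeta> *v axis i 1) (at_left 1)"
      by (intro AE_finite_allI poisson_radial_limit H) auto
    then show ?thesis
    proof eventually_elim
      case (elim \<zeta>)
      show ?case
      proof (intro vec_tendstoI)
        fix l i
        from elim have "((\<lambda>r. poisson (\<lambda>\<zeta>. F \<zeta> *v axis i 1) (complex_of_real r * \<zeta>)) \<longlongrightarrow> F \<zeta> *v axis i 1) (at_left 1)" by blast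
        from tendsto_vec_nth[OF this, of l]
        show "((\<lambda>r. G (complex_of_real r * \<zeta>) $ l $ i) \<longlongrightarrow> F \<zeta> $ l $ i) (at_left 1)"
          by (simp add: G_def col)
      qed
    qed
  qed
  ultimately show ?thesis using F hol unfolding Hinf_def by blast
qed

section \<open>Nehari's theorem for matrix functions\<close>

text \<open>The bound for the norm of the Hankel operator in terms of its sesquilinear form, which involves no projection. The real part
  of the form suffices because \<open>h\<close> may be multiplied by unimodular constants.\<close>

definition hankel_bound :: "(complex \<Rightarrow> complex^'n::finite^'m::finite) \<Rightarrow> real \<Rightarrow> bool" where
  "hankel_bound \<Phi> r \<longleftrightarrow> (\<forall>f\<in>H2. \<forall>h\<in>H2_minus. ip (\<lambda>\<zeta>. \<Phi> \<zeta> *v f \<zeta>) h \<le> r * L2_norm f * L2_norm h)"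

lemma H2_zero_mean: "annih {(\<lambda>\<zeta>. (\<zeta> powi k) *s x) | k x. k \<in> {..0}} = {f \<in> H2. fourier_coeff f 0 = 0}"
  unfolding annih_monomials by (auto simp: H2_def order_le_less)

lemma hankel_form:
  assumes \<Phi>: "\<Phi> \<in> Linf" and f: "f \<in> L2"
  shows "hankel \<Phi> f \<in> H2_minus" "\<And>k. k \<in> H2_minus \<Longrightarrow> ip (hankel \<Phi> f) k = ip (\<lambda>\<zeta>. \<Phi> \<zeta> *v f \<zeta>) k"
  unfolding hankel_def using orth_proj_H2_minus[OF Linf_L2[OF assms]] by auto

text \<open>Testing the form with \<open>h\<close> equal to the image of \<open>f\<close>, whose norm cancels unless it is zero.\<close>

lemma hankel_norm_le:
  assumes \<Phi>: "\<Phi> \<in> Linf" and B: "hankel_bound \<Phi> r" and f: "f \<in> H2"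
  shows "L2_norm (hankel \<Phi> f) \<le> r * L2_norm f \<or> L2_norm (hankel \<Phi> f) = 0"
proof -
  note h = hankel_form[OF \<Phi> H2_L2[OF f]]
  have "(L2_norm (hankel \<Phi> f))\<^sup>2 \<le> r * L2_norm f * L2_norm (hankel \<Phi> f)"
    unfolding ip_self[symmetric] h(2)[OF h(1)] using B f h(1) by (auto simp: hankel_bound_def)
  then show ?thesis
    using L2_norm_nonneg[of "hankel \<Phi> f"] unfolding power2_eq_square mult_le_cancel_right by linarith
qed

text \<open>Dividing by \<open>\<zeta>\<close> moves the zeroth coefficient \<open>c\<close> of \<open>\<Phi> f\<close> into the range of the Hankel operator \<open>P\<close>. For \<open>f\<close> vanishing at
  the origin, \<open>c\<close> and \<open>P\<close> together only see \<open>f/\<zeta>\<close> through \<open>P\<close>, so \<open>|c f|\<^sup>2\<close> is bounded by the form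
  \<open>b f f = r\<^sub>1\<^sup>2 \<parallel>f\<parallel>\<^sup>2 - \<parallel>P f\<parallel>\<^sup>2\<close>. Composing \<open>c\<close> with the \<open>b\<close>-projection onto these functions extends the bound to all of
  \<open>H\<^sup>2\<close> and changes \<open>c\<close> only through the value at the origin, that is, by a constant matrix \<open>X\<close>.\<close>

lemma hankel_extension_step:
  fixes \<Phi> :: "complex \<Rightarrow> complex^'n::finite^'m::finite"
  assumes \<Phi>: "\<Phi> \<in> Linf" and B: "hankel_bound \<Phi> r0" and r: "0 \<le> r0" "r0 < r1"
  shows "\<exists>X. hankel_bound (\<lambda>\<zeta>. cscale (\<zeta> powi (-1)) (\<Phi> \<zeta> - X)) r1"
proof -
  define P where "P f = hankel \<Phi> f" for f
  define c where "c f = fourier_coeff (\<lambda>\<zeta>. \<Phi> \<zeta> *v f \<zeta>) 0" for f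
  define H0 where "H0 = {f \<in> H2. fourier_coeff f 0 = (0::complex^'n)}"
  have \<Phi>L: "(\<lambda>\<zeta>. \<Phi> \<zeta> *v f \<zeta>) \<in> L2" if "f \<in> H2" for f using Linf_L2[OF \<Phi> H2_L2[OF that]] .
  have Pm: "P f \<in> H2_minus" if "f \<in> H2" for f unfolding P_def using hankel_form(1)[OF \<Phi> H2_L2[OF that]] .
  have PL: "P f \<in> L2" if "f \<in> H2" for f using H2_minus_L2[OF Pm[OF that]] .
  have Pip: "ip (P f) k = ip (\<lambda>\<zeta>. \<Phi> \<zeta> *v f \<zeta>) k" if "f \<in> H2" "k \<in> H2_minus" for f k
    unfolding P_def using hankel_form(2)[OF \<Phi> H2_L2[OF that(1)] that(2)] .
  have Pbound: "(L2_norm (P f))\<^sup>2 \<le> r0\<^sup>2 * (L2_norm f)\<^sup>2" if "f \<in> H2" for f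
  proof -
    have "L2_norm (P f) \<le> r0 * L2_norm f" using hankel_norm_le[OF \<Phi> B that] r by (auto simp: P_def)
    then show ?thesis unfolding power_mult_distrib[symmetric] by (intro power_mono) auto
  qed
  have r2: "r0\<^sup>2 < r1\<^sup>2" using r by (intro power_strict_mono) auto
  define b where "b f g = r1\<^sup>2 * ip f g - ip (P f) (P g)" for f g
  have b: "semi_inner_space H2 b"
  proof
    fix f g h :: "complex \<Rightarrow> complex^'n" and a :: real
    assume f: "f \<in> H2" and g: "g \<in> H2"
    show "(\<lambda>x. f x + a *\<^sub>R g x) \<in> H2" using f g by (rule H2_lin)
    show "b f g = b g f" by (simp add: b_def ip_commute)
    assume h: "h \<in> H2"
    have "ip (P (\<lambda>x. f x + a *\<^sub>R g x)) (P h) = ip (\<lambda>\<zeta>. \<Phi> \<zeta> *v (f \<zeta> + a *\<^sub>R g \<zeta>)) (P h)"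
      by (rule Pip[OF H2_lin[OF f g] Pm[OF h]])
    also have "\<dots> = ip (\<lambda>\<zeta>. \<Phi> \<zeta> *v f \<zeta> + a *\<^sub>R (\<Phi> \<zeta> *v g \<zeta>)) (P h)"
      by (simp add: matrix_vector_right_distrib linear_cmul[OF bounded_linear.linear[OF bounded_linear_matrix]])
    also have "\<dots> = ip (P f) (P h) + a * ip (P g) (P h)"
      using f g h by (simp add: L2.lin \<Phi>L PL Pip Pm)
    finally show "b (\<lambda>x. f x + a *\<^sub>R g x) h = b f h + a * b g h"
      using f g h by (simp add: b_def L2.lin H2_L2 algebra_simps)
  next
    fix f :: "complex \<Rightarrow> complex^'n" assume f: "f \<in> H2"
    have "r0\<^sup>2 * (L2_norm f)\<^sup>2 \<le> r1\<^sup>2 * (L2_norm f)\<^sup>2" using r2 by (intro mult_right_mono) auto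
    then show "0 \<le> b f f" using Pbound[OF f] by (simp add: b_def ip_self)
  qed
  interpret b: semi_inner_space H2 b by (rule b)
  have b_cmult: "b (\<lambda>\<zeta>. a *s u \<zeta>) w = b u (\<lambda>\<zeta>. cnj a *s w \<zeta>)" if u: "u \<in> H2" and w: "w \<in> H2" for a u w
  proof -
    have one: "ip (P (\<lambda>\<zeta>. a *s u \<zeta>)) k = ip (P u) (\<lambda>\<zeta>. cnj a *s k \<zeta>)" if "u \<in> H2" "k \<in> H2_minus" for a u k
      unfolding Pip[OF H2_cmult[OF that(1)] that(2)] Pip[OF that(1) H2_minus_cmult[OF that(2)]]
        matrix_scalar_vec by (rule ip_scalar)
    have "ip (P u) (P (\<lambda>\<zeta>. cnj a *s w \<zeta>)) = ip (P w) (\<lambda>\<zeta>. a *s P u \<zeta>)"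
      using one[OF w Pm[OF u], of "cnj a"] by (simp add: ip_commute)
    also have "\<dots> = ip (P u) (\<lambda>\<zeta>. cnj a *s P w \<zeta>)"
      unfolding ip_commute[of "P w"] by (rule ip_scalar)
    finally show ?thesis
      using one[OF u Pm[OF w], of a] by (simp add: b_def ip_scalar)
  qed
  have H0_eq: "H0 = annih {(\<lambda>\<zeta>. (\<zeta> powi k) *s x) | k x. k \<in> {..0}}"
    unfolding H0_def H2_zero_mean ..
  have ex: "\<exists>v\<in>H0. \<forall>h\<in>H0. b (\<lambda>\<zeta>. f \<zeta> - v \<zeta>) h = 0" if "f \<in> H2" for f
    unfolding H0_eq
  proof (rule annih_projection_form[OF b monomials_L2 _ _ that, where c="r1\<^sup>2 - r0\<^sup>2" and C="r1\<^sup>2"])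
    show "annih {\<lambda>\<zeta>. \<zeta> powi k *s x |k x. k \<in> {..0}} \<subseteq> H2" unfolding H2_zero_mean by auto
    show "r1\<^sup>2 - r0\<^sup>2 > 0" using r2 by simp
    fix f :: "complex \<Rightarrow> complex^'n" assume f: "f \<in> H2"
    show "(r1\<^sup>2 - r0\<^sup>2) * (L2_norm f)\<^sup>2 \<le> b f f"
      using Pbound[OF f] by (simp add: b_def ip_self left_diff_distrib)
    show "b f f \<le> r1\<^sup>2 * (L2_norm f)\<^sup>2" by (simp add: b_def ip_self)
  qed (auto intro: H2_L2)
  have "\<exists>v. v \<in> H0 \<and> (\<forall>h\<in>H0. b (\<lambda>\<zeta>. axis j 1 - v \<zeta>) h = 0)" for j
    using ex[of "\<lambda>_. axis j 1"] by auto
  then obtain v where v: "\<And>j. v j \<in> H0" "\<And>j h. h \<in> H0 \<Longrightarrow> b (\<lambda>\<zeta>. axis j 1 - v j \<zeta>) h = 0" by metis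
  define u where "u j \<zeta> = axis j 1 - v j \<zeta>" for j \<zeta>
  have uH: "u j \<in> H2" for j
    unfolding u_def using v(1)[of j] by (intro H2_diff) (auto simp: H0_def)
  have u0: "fourier_coeff (u j) 0 = axis j 1" for j
    unfolding u_def using v(1)[of j] by (subst fourier_coeff_diff) (auto simp: H0_def H2_L2 fourier_coeff_const)
  \<comment> \<open>The columns of \<open>X\<close> make \<open>c f - X f(0)\<close> vanish on the \<open>b\<close>-complement, which the \<open>u j\<close> span.\<close>
  define X :: "complex^'n^'m" where "X = (\<chi> l j. c (u j) $ l)"
  have Xa: "X *v a = (\<Sum>j\<in>UNIV. a $ j *s c (u j))" for a
    by (simp add: X_def matrix_vector_mult_def vec_eq_iff mult.commute)
  \<comment> \<open>The bound for \<open>c\<close> and \<open>P\<close> together on functions vanishing at the origin: the image of \<open>w/\<zeta>\<close> under the Hankel operator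
    is \<open>(P w + c w)/\<zeta>\<close>.\<close>
  have restr: "(norm (c w))\<^sup>2 + (L2_norm (P w))\<^sup>2 \<le> r0\<^sup>2 * (L2_norm w)\<^sup>2" if w: "w \<in> H0" for w
  proof -
    have wH: "w \<in> H2" and w0: "fourier_coeff w 0 = 0" using w by (auto simp: H0_def)
    define w' where "w' \<zeta> = (\<zeta> powi (-1)) *s w \<zeta>" for \<zeta>
    have w'H: "w' \<in> H2"
    proof -
      have "fourier_coeff w' k = 0" if "k < 0" for k
        unfolding w'_def fourier_coeff_shift using w0 wH that by (cases "k = -1") (auto simp: H2_def)
      moreover have "w' \<in> L2" unfolding w'_def by (rule L2_mult_powi[OF H2_L2[OF wH]])
      ultimately show ?thesis by (simp add: H2_def)
    qed
    define k where "k \<zeta> = P w \<zeta> + c w" for \<zeta>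
    have kL: "k \<in> L2" unfolding k_def by (intro L2_add PL wH L2_const)
    define k' where "k' \<zeta> = (\<zeta> powi (-1)) *s k \<zeta>" for \<zeta>
    have k'L: "k' \<in> L2" unfolding k'_def by (rule L2_mult_powi[OF kL])
    have ipc: "ip f (\<lambda>_. x) = fourier_coeff f 0 \<bullet> x" if "f \<in> L2" for f and x :: "complex^'m"
      using fourier_coeff_inner[OF that, of 0 x] by simp
    have shift_ip: "ip (\<lambda>\<zeta>. (\<zeta> powi (-1)) *s f \<zeta>) (\<lambda>\<zeta>. (\<zeta> powi (-1)) *s g \<zeta>) = ip f g" for f g :: "complex \<Rightarrow> complex^'m"
      unfolding ip_def by (intro Bochner_Integration.integral_cong)
        (auto simp: inner_scalar_vec_left_right cnj_unimodular power_int_minus field_simps)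
    have "k' \<in> H2_minus"
      unfolding H2_minus_eq_annih annih_def
    proof (safe intro!: k'L)
      fix g :: "complex \<Rightarrow> complex^'m" assume g: "g \<in> H2"
      have "ip k' g = ip k (\<lambda>\<zeta>. (\<zeta> powi 1) *s g \<zeta>)"
        unfolding k'_def ip_def
        by (intro Bochner_Integration.integral_cong) (auto simp: inner_scalar_vec cnj_unimodular power_int_minus)
      also have "\<dots> = ip (P w) (\<lambda>\<zeta>. (\<zeta> powi 1) *s g \<zeta>) + ip (\<lambda>_. c w) (\<lambda>\<zeta>. (\<zeta> powi 1) *s g \<zeta>)"
        unfolding k_def using g by (intro ip_add_left PL wH L2_const L2_mult_powi H2_L2)
      also have "ip (P w) (\<lambda>\<zeta>. (\<zeta> powi 1) *s g \<zeta>) = 0"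
        by (rule H2_minus_ip[OF Pm[OF wH]]) (rule H2_shift[OF g], simp)
      also have "ip (\<lambda>_. c w) (\<lambda>\<zeta>. (\<zeta> powi 1) *s g \<zeta>) = fourier_coeff (\<lambda>\<zeta>. (\<zeta> powi 1) *s g \<zeta>) 0 \<bullet> c w"
        by (subst ip_commute) (rule ipc[OF L2_mult_powi[OF H2_L2[OF g]]])
      also have "fourier_coeff (\<lambda>\<zeta>. (\<zeta> powi 1) *s g \<zeta>) 0 = 0"
        unfolding fourier_coeff_shift using g by (simp add: H2_def)
      finally show "ip k' g = 0" by simp
    qed
    with B w'H have "ip (\<lambda>\<zeta>. \<Phi> \<zeta> *v w' \<zeta>) k' \<le> r0 * L2_norm w' * L2_norm k'" by (auto simp: hankel_bound_def)
    moreover have "ip (\<lambda>\<zeta>. \<Phi> \<zeta> *v w' \<zeta>) k' = ip (\<lambda>\<zeta>. \<Phi> \<zeta> *v w \<zeta>) k"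
      unfolding w'_def k'_def matrix_scalar_vec by (rule shift_ip)
    moreover have "ip (\<lambda>\<zeta>. \<Phi> \<zeta> *v w \<zeta>) k = (L2_norm (P w))\<^sup>2 + (norm (c w))\<^sup>2"
    proof -
      have "ip (\<lambda>\<zeta>. \<Phi> \<zeta> *v w \<zeta>) k = ip (\<lambda>\<zeta>. \<Phi> \<zeta> *v w \<zeta>) (P w) + ip (\<lambda>\<zeta>. \<Phi> \<zeta> *v w \<zeta>) (\<lambda>_. c w)"
        unfolding k_def by (intro ip_add_right \<Phi>L PL wH L2_const)
      then show ?thesis
        using Pip[OF wH Pm[OF wH]] by (simp add: ipc[OF \<Phi>L[OF wH]] c_def dot_square_norm ip_self)
    qed
    moreover have "L2_norm w' = L2_norm w" "L2_norm k' = L2_norm k"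
      unfolding w'_def k'_def using H2_L2[OF wH] kL by (auto intro!: L2_norm_unimodular simp: norm_power_int norm_inverse)
    moreover have "(L2_norm k)\<^sup>2 = (L2_norm (P w))\<^sup>2 + (norm (c w))\<^sup>2"
    proof -
      have "(L2_norm k)\<^sup>2 = ip (P w) (P w) + 2 * ip (P w) (\<lambda>_. c w) + ip (\<lambda>_. c w) (\<lambda>_. c w)"
        unfolding ip_self[symmetric] k_def using L2.quad_expand[OF PL[OF wH] L2_const, of 1 "c w"] by simp
      moreover have "ip (P w) (\<lambda>_. c w) = 0" by (rule H2_minus_ip[OF Pm[OF wH] H2_const])
      moreover have "ip (\<lambda>_. c w) (\<lambda>_. c w) = (norm (c w))\<^sup>2"
        by (simp add: ipc fourier_coeff_const dot_square_norm)
      ultimately show ?thesis by (simp add: ip_self)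
    qed
    ultimately have "(L2_norm k)\<^sup>2 \<le> r0 * L2_norm w * L2_norm k" by simp
    then have "L2_norm k \<le> r0 * L2_norm w"
      using r L2_norm_nonneg[of k] by (cases "L2_norm k = 0") (auto simp: power2_eq_square)
    then have "(L2_norm k)\<^sup>2 \<le> (r0 * L2_norm w)\<^sup>2" by (intro power_mono) auto
    then show ?thesis using \<open>(L2_norm k)\<^sup>2 = _\<close> by (simp add: power_mult_distrib)
  qed
  have key: "(norm (c f - X *v fourier_coeff f 0))\<^sup>2 + (L2_norm (P f))\<^sup>2 \<le> r1\<^sup>2 * (L2_norm f)\<^sup>2" if f: "f \<in> H2" for f
  proof -
    define a where "a = fourier_coeff f 0"
    define s where "s \<zeta> = (\<Sum>j\<in>UNIV. a $ j *s u j \<zeta>)" for \<zeta>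
    have sH: "s \<in> H2" unfolding s_def by (intro H2_sum H2_cmult uH)
    define w where "w \<zeta> = f \<zeta> - s \<zeta>" for \<zeta>
    have wH: "w \<in> H2" unfolding w_def by (intro H2_diff f sH)
    have s0: "fourier_coeff s 0 = a"
      unfolding s_def
      by (subst fourier_coeff_sum) (auto simp: L2_cmult H2_L2[OF uH] fourier_coeff_cmult u0 basis_expansion)
    have "fourier_coeff w 0 = fourier_coeff f 0 - fourier_coeff s 0"
      unfolding w_def by (rule fourier_coeff_diff[OF H2_L2[OF f] H2_L2[OF sH]])
    then have w0: "w \<in> H0" using wH s0 by (simp add: H0_def a_def)
    have bs: "b s h = 0" if h: "h \<in> H0" for h
    proof -
      have hH: "h \<in> H2" using h by (simp add: H0_def)
      have ch: "(\<lambda>\<zeta>. a *s h \<zeta>) \<in> H0" for a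
        using h by (auto simp: H0_def H2_cmult fourier_coeff_cmult H2_L2)
      have "b (\<lambda>\<zeta>. \<Sum>j\<in>A. a $ j *s u j \<zeta>) h = (\<Sum>j\<in>A. b (\<lambda>\<zeta>. a $ j *s u j \<zeta>) h)" if "finite A" for A
        using that
      proof (induction A rule: finite_induct)
        case empty
        have "b (\<lambda>_. 0) h = 0" using b.lin[OF H2_zero H2_zero hH, of 1] by simp
        then show ?case by simp
      next
        case (insert j A)
        have "b (\<lambda>\<zeta>. a $ j *s u j \<zeta> + 1 *\<^sub>R (\<Sum>i\<in>A. a $ i *s u i \<zeta>)) h
            = b (\<lambda>\<zeta>. a $ j *s u j \<zeta>) h + 1 * b (\<lambda>\<zeta>. \<Sum>i\<in>A. a $ i *s u i \<zeta>) h"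
          by (rule b.lin[OF H2_cmult[OF uH] H2_sum[OF H2_cmult[OF uH]] hH])
        with insert show ?case by simp
      qed
      moreover have "b (\<lambda>\<zeta>. a $ j *s u j \<zeta>) h = 0" for j
      proof -
        have uj: "u j = (\<lambda>\<zeta>. axis j 1 - v j \<zeta>)" by (simp add: u_def fun_eq_iff)
        have "b (\<lambda>\<zeta>. a $ j *s u j \<zeta>) h = b (u j) (\<lambda>\<zeta>. cnj (a $ j) *s h \<zeta>)"
          by (rule b_cmult[OF uH hH])
        also have "\<dots> = 0" unfolding uj by (rule v(2)[OF ch])
        finally show ?thesis .
      qed
      ultimately show ?thesis unfolding s_def[abs_def] by simp
    qed
    have "b f f = b w w + 2 * b w s + b s s"
      using b.quad_expand[OF wH sH, of 1] by (simp add: w_def)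
    moreover have "b w s = 0" using bs[OF w0] b.sym[OF wH sH] by simp
    ultimately have bf: "b w w \<le> b f f" using b.nonneg[OF sH] by simp
    have cw: "c f - X *v a = c w"
    proof -
      have "c f = fourier_coeff (\<lambda>\<zeta>. \<Phi> \<zeta> *v w \<zeta> + (\<Sum>j\<in>UNIV. a $ j *s (\<Phi> \<zeta> *v u j \<zeta>))) 0"
        unfolding c_def
      proof (intro arg_cong2[where f=fourier_coeff] ext refl)
        fix \<zeta>
        have "\<Phi> \<zeta> *v f \<zeta> = \<Phi> \<zeta> *v w \<zeta> + \<Phi> \<zeta> *v s \<zeta>"
          unfolding matrix_vector_right_distrib[symmetric] by (simp add: w_def)
        also have "\<Phi> \<zeta> *v s \<zeta> = (\<Sum>j\<in>UNIV. a $ j *s (\<Phi> \<zeta> *v u j \<zeta>))"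
          unfolding s_def linear_sum[OF bounded_linear.linear[OF bounded_linear_matrix]] matrix_scalar_vec ..
        finally show "\<Phi> \<zeta> *v f \<zeta> = \<Phi> \<zeta> *v w \<zeta> + (\<Sum>j\<in>UNIV. a $ j *s (\<Phi> \<zeta> *v u j \<zeta>))" .
      qed
      also have "\<dots> = c w + (\<Sum>j\<in>UNIV. a $ j *s c (u j))"
      proof -
        have "fourier_coeff (\<lambda>\<zeta>. \<Sum>j\<in>UNIV. a $ j *s (\<Phi> \<zeta> *v u j \<zeta>)) 0 = (\<Sum>j\<in>UNIV. a $ j *s c (u j))"
          unfolding c_def fourier_coeff_cmult[OF \<Phi>L[OF uH], symmetric]
          by (intro fourier_coeff_sum L2_cmult \<Phi>L uH)
        then show ?thesis
          unfolding c_def by (subst fourier_coeff_add) (auto intro!: \<Phi>L wH uH L2_sum L2_cmult)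
      qed
      finally show ?thesis by (simp add: Xa)
    qed
    have "(norm (c w))\<^sup>2 \<le> r0\<^sup>2 * (L2_norm w)\<^sup>2 - (L2_norm (P w))\<^sup>2" using restr[OF w0] by simp
    also have "\<dots> \<le> b w w"
      using r2 by (simp add: b_def ip_self mult_right_mono)
    also have "\<dots> \<le> b f f" by (rule bf)
    finally show ?thesis using cw by (simp add: a_def b_def ip_self)
  qed
  have "hankel_bound (\<lambda>\<zeta>. cscale (\<zeta> powi (-1)) (\<Phi> \<zeta> - X)) r1"
    unfolding hankel_bound_def
  proof (intro ballI)
    fix f :: "complex \<Rightarrow> complex^'n" and h :: "complex \<Rightarrow> complex^'m" assume f: "f \<in> H2" and h: "h \<in> H2_minus"
    have hL: "h \<in> L2" using h by (rule H2_minus_L2)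
    \<comment> \<open>In \<open>\<zeta> h = h' + d\<close> the constant \<open>d\<close> pairs with the zeroth coefficient and \<open>h'\<close> with the old Hankel operator.\<close>
    define d where "d = fourier_coeff h (-1)"
    define zh where "zh \<zeta> = (\<zeta> powi 1) *s h \<zeta>" for \<zeta>
    define h' where "h' \<zeta> = zh \<zeta> - d" for \<zeta>
    have zhL: "zh \<in> L2" unfolding zh_def by (rule L2_mult_powi[OF hL])
    have h'L: "h' \<in> L2" unfolding h'_def by (intro L2_diff zhL L2_const)
    have ipc: "ip g (\<lambda>_. x) = fourier_coeff g 0 \<bullet> x" if "g \<in> L2" for g and x :: "complex^'m"
      using fourier_coeff_inner[OF that, of 0 x] by simp
    have h': "h' \<in> H2_minus"
      unfolding H2_minus_eq_annih annih_def
    proof (safe intro!: h'L)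
      fix g :: "complex \<Rightarrow> complex^'m" assume g: "g \<in> H2"
      have gL: "g \<in> L2" using g by (rule H2_L2)
      define g0 where "g0 = fourier_coeff g 0"
      define g1 where "g1 \<zeta> = (\<zeta> powi (-1)) *s (g \<zeta> - g0)" for \<zeta>
      have g1: "g1 \<in> H2"
      proof -
        have "fourier_coeff g1 k = 0" if "k < 0" for k
          unfolding g1_def fourier_coeff_shift fourier_coeff_diff[OF gL L2_const] fourier_coeff_const
          using g that by (cases "k = -1") (auto simp: H2_def g0_def)
        moreover have "g1 \<in> L2" unfolding g1_def by (intro L2_mult_powi L2_diff gL L2_const)
        ultimately show ?thesis by (simp add: H2_def)
      qed
      have "ip zh g = ip zh (\<lambda>\<zeta>. (g \<zeta> - g0) + g0)" by simp
      also have "\<dots> = ip zh (\<lambda>\<zeta>. g \<zeta> - g0) + ip zh (\<lambda>_. g0)"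
        by (intro ip_add_right zhL L2_diff gL L2_const)
      also have "ip zh (\<lambda>\<zeta>. g \<zeta> - g0) = ip h g1"
        unfolding zh_def g1_def ip_def
        by (intro Bochner_Integration.integral_cong) (auto simp: inner_scalar_vec cnj_unimodular power_int_minus)
      also have "ip h g1 = 0" by (rule H2_minus_ip[OF h g1])
      also have "ip zh (\<lambda>_. g0) = d \<bullet> g0"
        unfolding ipc[OF zhL] unfolding zh_def fourier_coeff_shift d_def by simp
      finally have "ip zh g = d \<bullet> g0" by simp
      moreover have "ip (\<lambda>_. d) g = d \<bullet> g0"
        by (subst ip_commute) (simp add: ipc[OF gL] g0_def inner_commute)
      ultimately show "ip h' g = 0"
        unfolding h'_def by (simp add: ip_diff_left zhL gL)
    qed
    define y where "y \<zeta> = \<Phi> \<zeta> *v f \<zeta> - X *v f \<zeta>" for \<zeta>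
    have XL: "(\<lambda>\<zeta>. X *v f \<zeta>) \<in> H2" by (rule H2_matrix[OF f])
    have yL: "y \<in> L2" unfolding y_def by (intro L2_diff \<Phi>L[OF f] H2_L2[OF XL])
    have "ip (\<lambda>\<zeta>. cscale (\<zeta> powi (-1)) (\<Phi> \<zeta> - X) *v f \<zeta>) h = ip y zh"
      unfolding y_def zh_def ip_def cscale_mult matrix_vector_mult_diff_rdistrib
      by (intro Bochner_Integration.integral_cong) (auto simp: inner_diff_left inner_scalar_vec cnj_unimodular power_int_minus)
    also have "\<dots> = ip y (\<lambda>\<zeta>. h' \<zeta> + d)" by (simp add: h'_def)
    also have "\<dots> = ip y h' + ip y (\<lambda>_. d)" by (intro ip_add_right yL h'L L2_const)
    also have "ip y h' = ip (P f) h'"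
      unfolding y_def using H2_minus_ip[OF h' XL] Pip[OF f h']
      by (simp add: ip_diff_left \<Phi>L f H2_L2[OF XL] h'L ip_commute[of h'])
    also have "ip y (\<lambda>_. d) = (c f - X *v fourier_coeff f 0) \<bullet> d"
      unfolding ipc[OF yL] unfolding y_def c_def
      by (simp add: fourier_coeff_diff \<Phi>L f H2_L2[OF XL] fourier_coeff_matrix H2_L2[OF f])
    also have "ip (P f) h' + (c f - X *v fourier_coeff f 0) \<bullet> d
        \<le> L2_norm (P f) * L2_norm h' + norm (c f - X *v fourier_coeff f 0) * norm d"
      using L2_cauchy_schwarz[OF PL[OF f] h'L] norm_cauchy_schwarz[of "c f - X *v fourier_coeff f 0" d] by simp
    also have "\<dots> \<le> sqrt ((L2_norm (P f))\<^sup>2 + (norm (c f - X *v fourier_coeff f 0))\<^sup>2) * sqrt ((L2_norm h')\<^sup>2 + (norm d)\<^sup>2)"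
    proof -
      have cs: "p * q + s * t \<le> sqrt (p\<^sup>2 + s\<^sup>2) * sqrt (q\<^sup>2 + t\<^sup>2)" for p q s t :: real
      proof -
        have "(p * q + s * t)\<^sup>2 + (p * t - s * q)\<^sup>2 = (p\<^sup>2 + s\<^sup>2) * (q\<^sup>2 + t\<^sup>2)" by algebra
        then have "(p * q + s * t)\<^sup>2 \<le> (p\<^sup>2 + s\<^sup>2) * (q\<^sup>2 + t\<^sup>2)" by (smt (verit) zero_le_power2)
        then show ?thesis unfolding real_sqrt_mult[symmetric] by (rule real_le_rsqrt)
      qed
      show ?thesis by (rule cs)
    qed
    also have "\<dots> \<le> (r1 * L2_norm f) * L2_norm h"
    proof (intro mult_mono)
      have "(L2_norm (P f))\<^sup>2 + (norm (c f - X *v fourier_coeff f 0))\<^sup>2 \<le> (r1 * L2_norm f)\<^sup>2"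
        using key[OF f] by (simp add: power_mult_distrib)
      then show "sqrt ((L2_norm (P f))\<^sup>2 + (norm (c f - X *v fourier_coeff f 0))\<^sup>2) \<le> r1 * L2_norm f"
        using r by (intro real_le_lsqrt) auto
      have "(L2_norm h)\<^sup>2 = (L2_norm zh)\<^sup>2"
        unfolding zh_def using hL by (subst L2_norm_unimodular) (auto simp: norm_power_int)
      also have "zh = (\<lambda>\<zeta>. h' \<zeta> + 1 *\<^sub>R d)" by (simp add: h'_def fun_eq_iff)
      also have "(L2_norm (\<lambda>\<zeta>. h' \<zeta> + 1 *\<^sub>R d))\<^sup>2 = (L2_norm h')\<^sup>2 + (norm d)\<^sup>2"
        unfolding ip_self[symmetric] L2.quad_expand[OF h'L L2_const]
        by (simp add: H2_minus_ip[OF h' H2_const] ipc fourier_coeff_const dot_square_norm)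
      finally have "(L2_norm h)\<^sup>2 = (L2_norm h')\<^sup>2 + (norm d)\<^sup>2" .
      from this[symmetric] show "sqrt ((L2_norm h')\<^sup>2 + (norm d)\<^sup>2) \<le> L2_norm h" by simp
    qed (use r in auto)
    finally show "ip (\<lambda>\<zeta>. cscale (\<zeta> powi (-1)) (\<Phi> \<zeta> - X) *v f \<zeta>) h \<le> r1 * L2_norm f * L2_norm h" .
  qed
  then show ?thesis by blast
qed

lemma trig_poly_L2: "trig_poly t \<Longrightarrow> f \<in> L2 \<Longrightarrow> (\<lambda>\<zeta>. t \<zeta> *s f \<zeta>) \<in> L2"
proof -
  assume t: "trig_poly t" and f: "f \<in> L2"
  from trig_poly_bounded[OF t] obtain B where "t \<in> borel_measurable \<mu>" "\<forall>\<zeta>. norm \<zeta> = 1 \<longrightarrow> norm (t \<zeta>) \<le> B" by auto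
  then show ?thesis by (intro L2_mult[OF f, where C=B]) auto
qed

text \<open>The least frequency of \<open>t\<close> serves as \<open>a\<close>. The point is that \<open>a\<close> depends neither on \<open>g\<close> nor on \<open>k\<close>.\<close>

lemma trig_poly_order:
  assumes "trig_poly t"
  shows "\<exists>a. \<forall>g\<in>(L2 :: (complex \<Rightarrow> complex^'n::finite) set). \<forall>k. (\<forall>j<k. fourier_coeff g j = 0) \<longrightarrow>
     (\<forall>j<k + a. fourier_coeff (\<lambda>\<zeta>. t \<zeta> *s g \<zeta>) j = 0)"
  using assms
proof (induction rule: trig_poly.induct)
  case (monom b m)
  show ?case
  proof (intro exI[of _ m] ballI allI impI)
    fix g :: "complex \<Rightarrow> complex^'n" and k j
    assume g: "g \<in> L2" and "\<forall>j<k. fourier_coeff g j = 0" "j < k + m"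
    then have "fourier_coeff (\<lambda>\<zeta>. b *s ((\<zeta> powi m) *s g \<zeta>)) j = 0"
      unfolding fourier_coeff_cmult[OF L2_mult_powi[OF g]] fourier_coeff_shift by simp
    then show "fourier_coeff (\<lambda>\<zeta>. (b * \<zeta> powi m) *s g \<zeta>) j = 0" by (simp add: vector_smult_assoc)
  qed
next
  case (add p q)
  then obtain a1 a2 where a: "\<forall>g\<in>(L2 :: (complex \<Rightarrow> complex^'n) set). \<forall>k. (\<forall>j<k. fourier_coeff g j = 0) \<longrightarrow> (\<forall>j<k + a1. fourier_coeff (\<lambda>\<zeta>. p \<zeta> *s g \<zeta>) j = 0)"
    "\<forall>g\<in>(L2 :: (complex \<Rightarrow> complex^'n) set). \<forall>k. (\<forall>j<k. fourier_coeff g j = 0) \<longrightarrow> (\<forall>j<k + a2. fourier_coeff (\<lambda>\<zeta>. q \<zeta> *s g \<zeta>) j = 0)"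
    by blast
  show ?case
  proof (intro exI[of _ "min a1 a2"] ballI allI impI)
    fix g :: "complex \<Rightarrow> complex^'n" and k j
    assume g: "g \<in> L2" and "\<forall>j<k. fourier_coeff g j = 0" "j < k + min a1 a2"
    then have "fourier_coeff (\<lambda>\<zeta>. p \<zeta> *s g \<zeta>) j = 0" "fourier_coeff (\<lambda>\<zeta>. q \<zeta> *s g \<zeta>) j = 0" using a by auto
    then show "fourier_coeff (\<lambda>\<zeta>. (p \<zeta> + q \<zeta>) *s g \<zeta>) j = 0"
      unfolding vector_sadd_rdistrib
      by (subst fourier_coeff_add) (auto intro: trig_poly_L2 add.hyps g)
  qed
next
  case (cong p q)
  have "fourier_coeff (\<lambda>\<zeta>. q \<zeta> *s g \<zeta>) j = fourier_coeff (\<lambda>\<zeta>. p \<zeta> *s g \<zeta>) j" for g :: "complex \<Rightarrow> complex^'n" and j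
    unfolding fourier_coeff_def by (intro Bochner_Integration.integral_cong) (simp_all add: cong.hyps)
  then show ?case using cong.IH by simp
qed

lemma vec_lambda_measurable:
  fixes f :: "'l::finite \<Rightarrow> 'i::finite \<Rightarrow> 'a \<Rightarrow> complex"
  assumes "\<And>l i. f l i \<in> borel_measurable M"
  shows "(\<lambda>\<zeta>. (\<chi> l i. f l i \<zeta>) :: complex^'i^'l) \<in> borel_measurable M"
proof (subst borel_measurable_euclidean_space, intro ballI)
  fix b :: "complex^'i^'l" assume "b \<in> Basis"
  then obtain l i c where "b = axis l (axis i c)" by (auto simp: Basis_vec_def)
  moreover have [measurable]: "f l i \<in> borel_measurable M" by (rule assms)
  ultimately show "(\<lambda>\<zeta>. (\<chi> l i. f l i \<zeta>) \<bullet> b) \<in> borel_measurable M" by (simp add: inner_axis)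
qed

text \<open>Iterating the extension step yields \<open>\<zeta>\<^sup>-\<^sup>k (\<Phi> - F\<^sub>k)\<close> for polynomials \<open>F\<^sub>k\<close> of degree less than \<open>k\<close> whose coefficients no longer change.
  For large \<open>k\<close> the factor \<open>\<zeta>\<^sup>-\<^sup>k\<close> moves any given pair of trigonometric polynomials into \<open>H\<^sup>2\<close> and its complement, so in the
  limit multiplication by \<open>\<Psi> = \<Phi> - F\<close> is bounded by \<open>r\<close> on trigonometric polynomials, hence pointwise.\<close>

lemma nehari:
  fixes \<Phi> :: "complex \<Rightarrow> complex^'n::finite^'m::finite"
  assumes \<Phi>: "\<Phi> \<in> Linf" and B: "hankel_bound \<Phi> r0" and r: "0 \<le> r0" "r0 < r"
  shows "\<exists>F\<in>Hinf. AE \<zeta> in \<mu>. mat_norm (\<Phi> \<zeta> - F \<zeta>) \<le> r"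
proof -
  \<comment> \<open>The extension step needs a strictly larger bound each time; these increase from \<open>r0\<close> and stay below \<open>r\<close>.\<close>
  define \<rho> where "\<rho> k = r - (r - r0) / 2 ^ k" for k :: nat
  have \<rho>: "0 \<le> \<rho> k" "\<rho> k < \<rho> (Suc k)" "\<rho> k \<le> r" for k
  proof -
    have "(r - r0) / 2 ^ k \<le> (r - r0) / 1" using r by (intro divide_left_mono) auto
    then have "(r - r0) / 2 ^ k \<le> r - r0" by (simp only: div_by_1)
    then show "0 \<le> \<rho> k" using r(1) unfolding \<rho>_def by linarith
    show "\<rho> k < \<rho> (Suc k)" using r by (simp add: \<rho>_def field_simps)
    show "\<rho> k \<le> r" using r by (simp add: \<rho>_def)
  qed
  have "\<exists>\<Phi>s. \<forall>k. (\<Phi>s k \<in> Linf \<and> hankel_bound (\<Phi>s k) (\<rho> k) \<and> (k = 0 \<longrightarrow> \<Phi>s k = \<Phi>)) \<and>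
      (\<exists>X. \<Phi>s (Suc k) = (\<lambda>\<zeta>. cscale (\<zeta> powi (-1)) (\<Phi>s k \<zeta> - X)))"
  proof (rule dependent_nat_choice)
    show "\<exists>\<Psi>. \<Psi> \<in> Linf \<and> hankel_bound \<Psi> (\<rho> 0) \<and> (0 = (0::nat) \<longrightarrow> \<Psi> = \<Phi>)"
      using \<Phi> B by (auto simp: \<rho>_def)
    fix \<Psi> :: "complex \<Rightarrow> complex^'n^'m" and k
    assume \<Psi>: "\<Psi> \<in> Linf \<and> hankel_bound \<Psi> (\<rho> k) \<and> (k = 0 \<longrightarrow> \<Psi> = \<Phi>)"
    then obtain X where "hankel_bound (\<lambda>\<zeta>. cscale (\<zeta> powi (-1)) (\<Psi> \<zeta> - X)) (\<rho> (Suc k))"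
      using hankel_extension_step[of \<Psi> "\<rho> k" "\<rho> (Suc k)"] \<rho> by blast
    moreover have "(\<lambda>\<zeta>. cscale (\<zeta> powi (-1)) (\<Psi> \<zeta> - X)) \<in> Linf"
      using \<Psi> by (intro Linf_cscale_powi Linf_diff Linf_const) auto
    ultimately show "\<exists>\<Psi>'. (\<Psi>' \<in> Linf \<and> hankel_bound \<Psi>' (\<rho> (Suc k)) \<and> (Suc k = 0 \<longrightarrow> \<Psi>' = \<Phi>)) \<and>
        (\<exists>X. \<Psi>' = (\<lambda>\<zeta>. cscale (\<zeta> powi (-1)) (\<Psi> \<zeta> - X)))" by blast
  qed
  then obtain \<Phi>s where S: "\<And>k. \<Phi>s k \<in> Linf" "\<And>k. hankel_bound (\<Phi>s k) (\<rho> k)" "\<Phi>s 0 = \<Phi>"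
    "\<And>k. \<exists>X. \<Phi>s (Suc k) = (\<lambda>\<zeta>. cscale (\<zeta> powi (-1)) (\<Phi>s k \<zeta> - X))" by blast
  then obtain X where X: "\<And>k. \<Phi>s (Suc k) = (\<lambda>\<zeta>. cscale (\<zeta> powi (-1)) (\<Phi>s k \<zeta> - X k))" by metis
  \<comment> \<open>The column of \<open>\<Phi> - F\<^sub>k\<close> in direction \<open>x\<close>.\<close>
  define R where "R k x \<zeta> = (\<zeta> powi int k) *s (\<Phi>s k \<zeta> *v x)" for k x \<zeta>
  have RL: "R k x \<in> L2" for k x
    unfolding R_def by (intro L2_mult_powi Linf_L2 S L2_const)
  have \<Phi>L: "(\<lambda>\<zeta>. \<Phi> \<zeta> *v x) \<in> L2" for x by (intro Linf_L2 \<Phi> L2_const)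
  have R_eq: "R k x \<zeta> = \<Phi> \<zeta> *v x - (\<Sum>j<k. (\<zeta> powi int j) *s (X j *v x))" if \<zeta>: "norm \<zeta> = 1" for k x \<zeta>
  proof (induction k)
    case 0
    then show ?case by (simp add: R_def S(3))
  next
    case (Suc k)
    have "\<zeta> \<noteq> 0" using \<zeta> by auto
    then have e: "\<zeta> powi int (Suc k) * \<zeta> powi (-1) = \<zeta> powi int k"
      by (subst power_int_add[symmetric]) auto
    have "R (Suc k) x \<zeta> = (\<zeta> powi int k) *s (\<Phi>s k \<zeta> *v x - X k *v x)"
      unfolding R_def X cscale_mult matrix_vector_mult_diff_rdistrib vector_smult_assoc e ..
    also have "\<dots> = R k x \<zeta> - (\<zeta> powi int k) *s (X k *v x)"
      by (simp add: R_def vector_ssub_ldistrib)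
    finally show ?case using Suc.IH by simp
  qed
  \<comment> \<open>The coefficients of the limit \<open>\<Psi> x\<close>.\<close>
  define d where "d x j = fourier_coeff (\<lambda>\<zeta>. \<Phi> \<zeta> *v x) j - (if 0 \<le> j then X (nat j) *v x else 0)" for x j
  have R_coeff: "fourier_coeff (R k x) j = d x j" if j: "j < int k" for k x j
  proof -
    have PL: "(\<lambda>\<zeta>. \<Sum>i<k. (\<zeta> powi int i) *s (X i *v x)) \<in> L2" by (intro L2_sum L2_monom)
    have "fourier_coeff (R k x) j = fourier_coeff (\<lambda>\<zeta>. \<Phi> \<zeta> *v x - (\<Sum>i<k. (\<zeta> powi int i) *s (X i *v x))) j"
      using R_eq by (intro fourier_coeff_cong_AE RL L2_diff \<Phi>L PL AE_I2) simp
    also have "\<dots> = fourier_coeff (\<lambda>\<zeta>. \<Phi> \<zeta> *v x) j - (\<Sum>i<k. if j = int i then X i *v x else 0)"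
      unfolding fourier_coeff_diff[OF \<Phi>L PL] fourier_coeff_sum[OF L2_monom] fourier_coeff_monom ..
    also have "(\<Sum>i<k. if j = int i then X i *v x else 0) = (if 0 \<le> j then X (nat j) *v x else 0)"
    proof (cases "0 \<le> j")
      case True
      then have "(\<Sum>i<k. if j = int i then X i *v x else 0) = (\<Sum>i<k. if nat j = i then X i *v x else 0)"
        by (intro sum.cong) auto
      also have "\<dots> = X (nat j) *v x" using j True by (subst sum.delta') auto
      finally show ?thesis using True by simp
    qed (auto intro: sum.neutral)
    finally show ?thesis by (simp add: d_def)
  qed
  \<comment> \<open>Multiplying the first polynomial by \<open>\<zeta>\<^sup>n\<close> puts it into \<open>H\<^sup>2\<close>; the second then has to be multiplied by \<open>\<zeta>\<^sup>n\<^sup>-\<^sup>k\<close>.\<close>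
  have bound: "\<exists>k0. \<forall>k\<ge>k0. ip (\<lambda>\<zeta>. t \<zeta> *s R k x \<zeta>) (trig_sum {-int N..int N} e)
      \<le> r * L2_norm (\<lambda>\<zeta>. t \<zeta> *s x) * L2_norm (trig_sum {-int N..int N} e)"
    if t: "trig_poly t" for t x N e
  proof -
    let ?q = "trig_sum {-int N..int N} e"
    have txL: "(\<lambda>\<zeta>. t \<zeta> *s x) \<in> L2" by (intro trig_poly_L2 t L2_const)
    obtain a where a: "\<forall>j<a. fourier_coeff (\<lambda>\<zeta>. t \<zeta> *s x) j = 0"
    proof -
      obtain a where "\<forall>g\<in>(L2 :: (complex \<Rightarrow> complex^'n) set). \<forall>k. (\<forall>j<k. fourier_coeff g j = 0) \<longrightarrow>
         (\<forall>j<k + a. fourier_coeff (\<lambda>\<zeta>. t \<zeta> *s g \<zeta>) j = 0)"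
        using trig_poly_order[OF t] by blast
      from bspec[OF this L2_const[of x], rule_format, of 0] show ?thesis
        by (intro that[of a]) (simp add: fourier_coeff_const)
    qed
    define n where "n = max 0 (- a)"
    define f where "f \<zeta> = (\<zeta> powi n) *s (t \<zeta> *s x)" for \<zeta>
    have fL: "f \<in> L2" unfolding f_def by (rule L2_mult_powi[OF txL])
    have "fourier_coeff f j = 0" if "j < 0" for j
      unfolding f_def fourier_coeff_shift using a that by (simp add: n_def)
    with fL have fH: "f \<in> H2" by (simp add: H2_def)
    have nf: "L2_norm f = L2_norm (\<lambda>\<zeta>. t \<zeta> *s x)"
      unfolding f_def using txL by (intro L2_norm_unimodular) (auto simp: norm_power_int)
    have "ip (\<lambda>\<zeta>. t \<zeta> *s R k x \<zeta>) ?q \<le> r * L2_norm (\<lambda>\<zeta>. t \<zeta> *s x) * L2_norm ?q"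
      if k: "k \<ge> nat (n + int N + 1)" for k
    proof -
      define h where "h \<zeta> = (\<zeta> powi (n - int k)) *s ?q \<zeta>" for \<zeta>
      have hL: "h \<in> L2" unfolding h_def by (rule L2_mult_powi[OF L2_trig_sum])
      have "h \<in> H2_minus"
        unfolding H2_minus_eq_annih annih_def
      proof (safe intro!: hL)
        fix g :: "complex \<Rightarrow> complex^'m" assume g: "g \<in> H2"
        have "ip h g = ip ?q (\<lambda>\<zeta>. (\<zeta> powi (int k - n)) *s g \<zeta>)"
          unfolding h_def ip_def
          by (intro Bochner_Integration.integral_cong)
            (auto simp: inner_scalar_vec cnj_powi_unimodular simp del: complex_cnj_power_int)
        also have "\<dots> = ip (\<lambda>\<zeta>. (\<zeta> powi (int k - n)) *s g \<zeta>) ?q" by (rule ip_commute)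
        also have "\<dots> = (\<Sum>j\<in>{-int N..int N}. fourier_coeff g (j - (int k - n)) \<bullet> e j)"
          by (simp add: ip_trig_sum L2_mult_powi H2_L2[OF g] fourier_coeff_shift)
        also have "\<dots> = 0"
        proof (intro sum.neutral ballI)
          fix j assume "j \<in> {-int N..int N}"
          then have "j - (int k - n) < 0" using k unfolding nat_le_iff by simp
          then have "fourier_coeff g (j - (int k - n)) = 0" using g unfolding H2_def by blast
          then show "fourier_coeff g (j - (int k - n)) \<bullet> e j = 0" by simp
        qed
        finally show "ip h g = 0" .
      qed
      then have "ip (\<lambda>\<zeta>. \<Phi>s k \<zeta> *v f \<zeta>) h \<le> \<rho> k * L2_norm f * L2_norm h"
        using S(2)[of k] fH by (simp add: hankel_bound_def)
      also have "\<dots> \<le> r * L2_norm f * L2_norm h" using \<rho>(3)[of k] by (intro mult_right_mono) auto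
      also have "L2_norm h = L2_norm ?q"
        unfolding h_def by (intro L2_norm_unimodular) (auto simp: norm_power_int)
      also have "ip (\<lambda>\<zeta>. \<Phi>s k \<zeta> *v f \<zeta>) h = ip (\<lambda>\<zeta>. t \<zeta> *s R k x \<zeta>) ?q"
        unfolding ip_def
      proof (intro Bochner_Integration.integral_cong refl)
        fix \<zeta> assume "\<zeta> \<in> space \<mu>"
        then have \<zeta>: "norm \<zeta> = 1" "\<zeta> \<noteq> 0" by auto
        have "(\<Phi>s k \<zeta> *v f \<zeta>) \<bullet> h \<zeta> = ((cnj (\<zeta> powi (n - int k)) * (\<zeta> powi n * t \<zeta>)) *s (\<Phi>s k \<zeta> *v x)) \<bullet> ?q \<zeta>"
          unfolding f_def h_def matrix_scalar_vec vector_smult_assoc inner_scalar_vec_left_right by (simp add: mult_ac)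
        also have "cnj (\<zeta> powi (n - int k)) * (\<zeta> powi n * t \<zeta>) = t \<zeta> * \<zeta> powi int k"
        proof -
          have "cnj (\<zeta> powi (n - int k)) * \<zeta> powi n = \<zeta> powi int k"
            unfolding cnj_powi_unimodular[OF \<zeta>(1)] using \<zeta>(2) by (simp add: power_int_add[symmetric])
          then show ?thesis by (metis mult.assoc mult.commute)
        qed
        finally show "(\<Phi>s k \<zeta> *v f \<zeta>) \<bullet> h \<zeta> = (t \<zeta> *s R k x \<zeta>) \<bullet> ?q \<zeta>"
          by (simp add: R_def vector_smult_assoc)
      qed
      finally show ?thesis by (simp add: nf)
    qed
    then show ?thesis by blast
  qed
  \<comment> \<open>The case \<open>t = 1\<close>, with the partial sum of the limit itself as the second polynomial.\<close>
  have dbound: "(\<Sum>j\<in>{-int N..int N}. (norm (d x j))\<^sup>2) \<le> (r * norm x)\<^sup>2" for x N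
  proof -
    let ?q = "trig_sum {-int N..int N} (d x)"
    obtain k0 where k0: "\<forall>k\<ge>k0. ip (\<lambda>\<zeta>. 1 *s R k x \<zeta>) ?q \<le> r * L2_norm (\<lambda>\<zeta>. 1 *s x) * L2_norm ?q"
      using bound[OF trig_poly_const[of 1]] by blast
    define k where "k = max k0 (Suc N)"
    have "(L2_norm ?q)\<^sup>2 = (\<Sum>j\<in>{-int N..int N}. (norm (d x j))\<^sup>2)" by (simp add: L2_norm_trig_sum)
    also have "\<dots> = (\<Sum>j\<in>{-int N..int N}. fourier_coeff (R k x) j \<bullet> d x j)"
      by (intro sum.cong) (auto simp: R_coeff k_def dot_square_norm)
    also have "\<dots> = ip (R k x) ?q" by (simp add: ip_trig_sum RL)
    also have "\<dots> \<le> r * L2_norm (\<lambda>_. x) * L2_norm ?q"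
      using k0[rule_format, of k] by (simp add: k_def)
    also have "L2_norm (\<lambda>_. x) = norm x" using circle.prob_space by (simp add: L2_norm_def)
    finally have "(L2_norm ?q)\<^sup>2 \<le> r * norm x * L2_norm ?q" .
    then have "L2_norm ?q \<le> r * norm x"
      using L2_norm_nonneg[of ?q] r by (cases "L2_norm ?q = 0") (auto simp: power2_eq_square)
    then have "(L2_norm ?q)\<^sup>2 \<le> (r * norm x)\<^sup>2" by (intro power_mono) auto
    then show ?thesis by (simp add: L2_norm_trig_sum)
  qed
  have "\<exists>D\<in>L2. \<forall>j. fourier_coeff D j = d x j" for x
    using riesz_fischer[OF dbound[of x]] by metis
  then obtain D where D: "\<And>x. D x \<in> L2" "\<And>x j. fourier_coeff (D x) j = d x j" by metis
  define \<Psi> :: "complex \<Rightarrow> complex^'n^'m" where "\<Psi> \<zeta> = (\<chi> l i. D (axis i 1) \<zeta> $ l)" for \<zeta>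
  note [measurable] = D(1)[THEN L2_measurable]
  have \<Psi>m [measurable]: "\<Psi> \<in> borel_measurable \<mu>"
    unfolding \<Psi>_def by (rule vec_lambda_measurable) measurable
  have \<Psi>x: "(\<lambda>\<zeta>. \<Psi> \<zeta> *v x) = (\<lambda>\<zeta>. \<Sum>i\<in>UNIV. x $ i *s D (axis i 1) \<zeta>)" for x
    by (simp add: \<Psi>_def matrix_vector_mult_def vec_eq_iff fun_eq_iff mult.commute)
  have \<Psi>L: "(\<lambda>\<zeta>. \<Psi> \<zeta> *v x) \<in> L2" for x unfolding \<Psi>x by (intro L2_sum L2_cmult D)
  have \<Psi>c: "fourier_coeff (\<lambda>\<zeta>. \<Psi> \<zeta> *v x) j = d x j" for x j
  proof -
    have lin: "A *v x = (\<Sum>i\<in>UNIV. x $ i *s (A *v axis i 1))" for A :: "complex^'n^'m"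
    proof -
      have "A *v x = A *v (\<Sum>i\<in>UNIV. x $ i *s axis i 1)" by (simp only: basis_expansion)
      then show ?thesis
        by (simp only: linear_sum[OF bounded_linear.linear[OF bounded_linear_matrix]] matrix_scalar_vec)
    qed
    have f\<Phi>: "fourier_coeff (\<lambda>\<zeta>. \<Phi> \<zeta> *v x) j = (\<Sum>i\<in>UNIV. x $ i *s fourier_coeff (\<lambda>\<zeta>. \<Phi> \<zeta> *v axis i 1) j)"
      unfolding fourier_coeff_cmult[OF \<Phi>L, symmetric]
      by (subst fourier_coeff_sum[symmetric]) (auto intro!: L2_cmult \<Phi>L simp: lin[symmetric])
    have "fourier_coeff (\<lambda>\<zeta>. \<Psi> \<zeta> *v x) j = (\<Sum>i\<in>UNIV. x $ i *s d (axis i 1) j)"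
      unfolding \<Psi>x D(2)[symmetric] fourier_coeff_cmult[OF D(1), symmetric]
      by (intro fourier_coeff_sum L2_cmult D)
    also have "\<dots> = d x j"
      unfolding d_def f\<Phi> by (cases "0 \<le> j") (simp_all add: lin[of "X (nat j)"] vector_ssub_ldistrib sum_subtractf)
    finally show ?thesis .
  qed
  have mult: "L2_norm (\<lambda>\<zeta>. t \<zeta> *s (\<Psi> \<zeta> *v x)) \<le> r * L2_norm (\<lambda>\<zeta>. t \<zeta> *s x)" if t: "trig_poly t" for t x
  proof -
    define g where "g \<zeta> = t \<zeta> *s (\<Psi> \<zeta> *v x)" for \<zeta>
    have gL: "g \<in> L2" unfolding g_def by (rule trig_poly_L2[OF t \<Psi>L])
    define T where "T N = trig_sum {-int N..int N} (fourier_coeff g)" for N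
    obtain a where a: "\<forall>g\<in>(L2 :: (complex \<Rightarrow> complex^'m) set). \<forall>k. (\<forall>j<k. fourier_coeff g j = 0) \<longrightarrow>
     (\<forall>j<k + a. fourier_coeff (\<lambda>\<zeta>. t \<zeta> *s g \<zeta>) j = 0)" using trig_poly_order[OF t] by blast
    have T: "L2_norm (T N) \<le> r * L2_norm (\<lambda>\<zeta>. t \<zeta> *s x)" for N
    proof -
      obtain k0 where k0: "\<forall>k\<ge>k0. ip (\<lambda>\<zeta>. t \<zeta> *s R k x \<zeta>) (T N) \<le> r * L2_norm (\<lambda>\<zeta>. t \<zeta> *s x) * L2_norm (T N)"
        using bound[OF t] unfolding T_def by blast
      define k where "k = max k0 (nat (int N + 1 - a))"
      have dL: "(\<lambda>\<zeta>. \<Psi> \<zeta> *v x - R k x \<zeta>) \<in> L2" by (intro L2_diff \<Psi>L RL)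
      have "\<forall>j<int k. fourier_coeff (\<lambda>\<zeta>. \<Psi> \<zeta> *v x - R k x \<zeta>) j = 0"
        by (simp add: fourier_coeff_diff \<Psi>L RL \<Psi>c R_coeff)
      with a dL have 0: "fourier_coeff (\<lambda>\<zeta>. t \<zeta> *s (\<Psi> \<zeta> *v x - R k x \<zeta>)) j = 0" if "j < int k + a" for j
        using that by blast
      have "ip (\<lambda>\<zeta>. t \<zeta> *s (\<Psi> \<zeta> *v x - R k x \<zeta>)) (T N) = 0"
        unfolding T_def ip_trig_sum[OF trig_poly_L2[OF t dL]]
        by (intro sum.neutral ballI) (subst 0, auto simp: k_def)
      moreover have "ip (\<lambda>\<zeta>. t \<zeta> *s (\<Psi> \<zeta> *v x - R k x \<zeta>)) (T N) = ip g (T N) - ip (\<lambda>\<zeta>. t \<zeta> *s R k x \<zeta>) (T N)"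
        unfolding vector_ssub_ldistrib g_def
        by (intro ip_diff_left trig_poly_L2 t \<Psi>L RL) (simp add: T_def)
      moreover have "ip g (T N) = (L2_norm (T N))\<^sup>2"
        unfolding T_def by (simp add: ip_trig_sum gL L2_norm_trig_sum dot_square_norm)
      ultimately have "(L2_norm (T N))\<^sup>2 \<le> r * L2_norm (\<lambda>\<zeta>. t \<zeta> *s x) * L2_norm (T N)"
        using k0[rule_format, of k] by (simp add: k_def)
      then show ?thesis
        using L2_norm_nonneg[of "T N"] r by (cases "L2_norm (T N) = 0") (auto simp: power2_eq_square)
    qed
    have "L2_norm g \<le> L2_norm (\<lambda>\<zeta>. T N \<zeta> - g \<zeta>) + r * L2_norm (\<lambda>\<zeta>. t \<zeta> *s x)" for N
    proof -
      have "L2_norm (\<lambda>\<zeta>. T N \<zeta> - (T N \<zeta> - g \<zeta>)) \<le> L2_norm (T N) + L2_norm (\<lambda>\<zeta>. T N \<zeta> - g \<zeta>)"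
        by (intro L2_norm_triangle_diff L2_diff gL) (simp_all add: T_def)
      then show ?thesis using T[of N] by simp
    qed
    moreover have "(\<lambda>N. L2_norm (\<lambda>\<zeta>. T N \<zeta> - g \<zeta>) + r * L2_norm (\<lambda>\<zeta>. t \<zeta> *s x)) \<longlonglongrightarrow> 0 + r * L2_norm (\<lambda>\<zeta>. t \<zeta> *s x)"
      unfolding T_def by (intro tendsto_intros fourier_series_L2 gL)
    ultimately have "L2_norm g \<le> 0 + r * L2_norm (\<lambda>\<zeta>. t \<zeta> *s x)" by (intro LIMSEQ_le_const) auto
    then show ?thesis by (simp add: g_def[abs_def])
  qed
  have pointwise: "AE \<zeta> in \<mu>. norm (\<Psi> \<zeta> *v x) \<le> r * norm x" for x
  proof -
    have int: "integrable \<mu> (\<lambda>\<zeta>. (norm (\<Psi> \<zeta> *v x))\<^sup>2)" by (rule L2_integrable[OF \<Psi>L])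
    have "AE \<zeta> in \<mu>. 0 \<le> (r * norm x)\<^sup>2 - (norm (\<Psi> \<zeta> *v x))\<^sup>2"
    proof (rule nonneg_AE_of_square_weights)
      show "integrable \<mu> (\<lambda>\<zeta>. (r * norm x)\<^sup>2 - (norm (\<Psi> \<zeta> *v x))\<^sup>2)" using int by simp
      fix p :: "complex \<Rightarrow> real" assume p: "real_polynomial_function p"
      have t: "trig_poly (\<lambda>\<zeta>. complex_of_real (p \<zeta>))" by (rule real_polynomial_trig[OF p])
      have i1: "integrable \<mu> (\<lambda>\<zeta>. (p \<zeta>)\<^sup>2 * (norm x)\<^sup>2)"
        using L2_integrable[OF trig_poly_L2[OF t L2_const[of x]]] by (simp add: power_mult_distrib)
      have i2: "integrable \<mu> (\<lambda>\<zeta>. (p \<zeta>)\<^sup>2 * (norm (\<Psi> \<zeta> *v x))\<^sup>2)"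
        using L2_integrable[OF trig_poly_L2[OF t \<Psi>L[of x]]] by (simp add: power_mult_distrib)
      have "(L2_norm (\<lambda>\<zeta>. complex_of_real (p \<zeta>) *s (\<Psi> \<zeta> *v x)))\<^sup>2 \<le> (r * L2_norm (\<lambda>\<zeta>. complex_of_real (p \<zeta>) *s x))\<^sup>2"
        by (intro power_mono mult[OF t]) simp
      then have "(\<integral>\<zeta>. (p \<zeta>)\<^sup>2 * (norm (\<Psi> \<zeta> *v x))\<^sup>2 \<partial>\<mu>) \<le> r\<^sup>2 * (\<integral>\<zeta>. (p \<zeta>)\<^sup>2 * (norm x)\<^sup>2 \<partial>\<mu>)"
        unfolding power_mult_distrib L2_norm_def
        by (simp add: integral_nonneg_AE power_mult_distrib)
      also have "\<dots> = (\<integral>\<zeta>. r\<^sup>2 * ((p \<zeta>)\<^sup>2 * (norm x)\<^sup>2) \<partial>\<mu>)" by (rule integral_mult_right_zero[symmetric])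
      finally have "0 \<le> (\<integral>\<zeta>. r\<^sup>2 * ((p \<zeta>)\<^sup>2 * (norm x)\<^sup>2) \<partial>\<mu>) - (\<integral>\<zeta>. (p \<zeta>)\<^sup>2 * (norm (\<Psi> \<zeta> *v x))\<^sup>2 \<partial>\<mu>)"
        by simp
      also have "\<dots> = (\<integral>\<zeta>. r\<^sup>2 * ((p \<zeta>)\<^sup>2 * (norm x)\<^sup>2) - (p \<zeta>)\<^sup>2 * (norm (\<Psi> \<zeta> *v x))\<^sup>2 \<partial>\<mu>)"
        by (intro Bochner_Integration.integral_diff[symmetric] integrable_mult_right i1 i2)
      also have "\<dots> = (\<integral>\<zeta>. (p \<zeta>)\<^sup>2 * ((r * norm x)\<^sup>2 - (norm (\<Psi> \<zeta> *v x))\<^sup>2) \<partial>\<mu>)"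
        by (intro Bochner_Integration.integral_cong) (auto simp: power_mult_distrib algebra_simps)
      finally show "0 \<le> (\<integral>\<zeta>. (p \<zeta>)\<^sup>2 * ((r * norm x)\<^sup>2 - (norm (\<Psi> \<zeta> *v x))\<^sup>2) \<partial>\<mu>)" .
    qed
    then show ?thesis
    proof eventually_elim
      case (elim \<zeta>)
      then have "(norm (\<Psi> \<zeta> *v x))\<^sup>2 \<le> (r * norm x)\<^sup>2" by simp
      then show ?case using r by (intro power2_le_imp_le[of "norm (\<Psi> \<zeta> *v x)"]) auto
    qed
  qed
  \<comment> \<open>The exceptional null set must not depend on the vector.\<close>
  obtain Q :: "(complex^'n) set" where Q: "countable Q" "\<And>U. open U \<Longrightarrow> U \<noteq> {} \<Longrightarrow> \<exists>q\<in>Q. q \<in> U"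
    by (rule countable_dense_setE) blast
  have "AE \<zeta> in \<mu>. \<forall>x\<in>Q. norm (\<Psi> \<zeta> *v x) \<le> r * norm x"
    using Q(1) pointwise by (subst AE_ball_countable) auto
  then have \<Psi>r: "AE \<zeta> in \<mu>. mat_norm (\<Psi> \<zeta>) \<le> r"
  proof eventually_elim
    case (elim \<zeta>)
    show ?case
    proof (rule mat_norm_le, rule ccontr)
      fix x assume "\<not> norm (\<Psi> \<zeta> *v x) \<le> r * norm x"
      then have ne: "{x. r * norm x < norm (\<Psi> \<zeta> *v x)} \<noteq> {}" by (auto simp: not_le)
      have "open {x. r * norm x < norm (\<Psi> \<zeta> *v x)}"
        by (intro open_Collect_less continuous_intros)
      from Q(2)[OF this ne] obtain q where "q \<in> Q" "r * norm q < norm (\<Psi> \<zeta> *v q)" by blast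
      with elim show False by force
    qed
  qed
  then have \<Psi>Linf: "\<Psi> \<in> Linf" unfolding Linf_def using \<Psi>m by auto
  have "(\<lambda>\<zeta>. \<Phi> \<zeta> - \<Psi> \<zeta>) \<in> Hinf"
  proof (rule Hinf_of_columns_H2[OF Linf_diff[OF \<Phi> \<Psi>Linf]])
    fix x
    show "(\<lambda>\<zeta>. (\<Phi> \<zeta> - \<Psi> \<zeta>) *v x) \<in> H2"
      unfolding matrix_vector_mult_diff_rdistrib
      by (simp add: H2_def L2_diff \<Phi>L \<Psi>L fourier_coeff_diff \<Psi>c d_def)
  qed
  with \<Psi>r show ?thesis by (intro bexI[of _ "\<lambda>\<zeta>. \<Phi> \<zeta> - \<Psi> \<zeta>"]) auto
qed

section \<open>Multiplication by bounded analytic functions\<close>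

text \<open>The power series of \<open>\<phi>\<close> converges absolutely on the circle of radius \<open>r\<close>, and multiplication by powers preserves \<open>H\<^sup>2\<close>.\<close>

lemma H2_dilation_mult:
  fixes f :: "complex \<Rightarrow> complex^'n::finite"
  assumes \<phi>: "\<phi> holomorphic_on ball 0 1" and f: "f \<in> H2" and r: "0 \<le> r" "r < 1"
  shows "(\<lambda>\<zeta>. \<phi> (complex_of_real r * \<zeta>) *s f \<zeta>) \<in> H2"
proof -
  have fL: "f \<in> L2" using f by (rule H2_L2)
  define a where "a n = (deriv ^^ n) \<phi> 0 / fact n" for n
  have ser: "(\<lambda>n. a n * w ^ n) sums \<phi> w" if "norm w < 1" for w
    using holomorphic_power_series[OF \<phi>, of w] that by (simp add: a_def)
  have "summable (\<lambda>n. a n * complex_of_real ((1 + r) / 2) ^ n)"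
    using ser[of "complex_of_real ((1 + r) / 2)"] r by (intro sums_summable) (simp add: norm_divide del: of_real_divide of_real_add)
  then have summ: "summable (\<lambda>n. norm (a n * complex_of_real r ^ n))"
    by (rule powser_insidea) (use r in \<open>simp add: del: of_real_divide of_real_add\<close>)
  define t where "t n \<zeta> = (a n * complex_of_real r ^ n) *s ((\<zeta> powi int n) *s f \<zeta>)" for n \<zeta>
  have tH: "t n \<in> H2" for n unfolding t_def by (intro H2_cmult H2_shift f) simp
  have t_norm: "norm (t n \<zeta>) = norm (f \<zeta>) * norm (a n * complex_of_real r ^ n)" if "norm \<zeta> = 1" for n \<zeta>
    using that unfolding t_def norm_scalar_vec by (simp add: norm_power norm_mult)
  have t_sums: "(\<lambda>n. t n \<zeta>) sums (\<phi> (complex_of_real r * \<zeta>) *s f \<zeta>)" if "norm \<zeta> = 1" for \<zeta>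
  proof -
    have "(\<lambda>n. a n * (complex_of_real r * \<zeta>) ^ n) sums \<phi> (complex_of_real r * \<zeta>)"
      using r that by (intro ser) (simp add: norm_mult)
    from bounded_linear.sums[OF bounded_bilinear.bounded_linear_left[OF bounded_bilinear_scalar_vec] this, of "f \<zeta>"]
    show ?thesis by (simp add: t_def vector_smult_assoc power_mult_distrib mult.assoc)
  qed
  have cont: "continuous_on (sphere 0 1) (\<lambda>\<zeta>. \<phi> (complex_of_real r * \<zeta>))"
    by (intro continuous_on_compose2[OF holomorphic_on_imp_continuous_on[OF \<phi>]] continuous_intros)
      (use r in \<open>auto simp: norm_mult\<close>)
  have "compact ((\<lambda>\<zeta>. \<phi> (complex_of_real r * \<zeta>)) ` sphere 0 1)" by (intro compact_continuous_image cont) auto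
  from compact_imp_bounded[OF this]
  obtain C where "\<forall>w\<in>(\<lambda>\<zeta>. \<phi> (complex_of_real r * \<zeta>)) ` sphere 0 1. norm w \<le> C"
    unfolding bounded_iff by blast
  then have C: "norm (\<phi> (complex_of_real r * \<zeta>)) \<le> C" if "norm \<zeta> = 1" for \<zeta> using that by auto
  have L: "(\<lambda>\<zeta>. \<phi> (complex_of_real r * \<zeta>) *s f \<zeta>) \<in> L2"
    by (rule L2_mult[OF fL continuous_on_measurable_circle[OF cont], of C]) (use C in auto)
  have "fourier_coeff (\<lambda>\<zeta>. \<phi> (complex_of_real r * \<zeta>) *s f \<zeta>) k = 0" if k: "k < 0" for k
  proof -
    have L': "(\<lambda>\<zeta>. (\<zeta> powi (- k)) *s t n \<zeta>) \<in> L2" for n by (intro L2_mult_powi H2_L2 tH)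
    have nt: "norm ((\<zeta> powi (- k)) *s t n \<zeta>) = norm (f \<zeta>) * norm (a n * complex_of_real r ^ n)" if "norm \<zeta> = 1" for n \<zeta>
      using t_norm[OF that, of n] that by (simp add: norm_power_int)
    have "(\<lambda>n. \<integral>\<zeta>. (\<zeta> powi (- k)) *s t n \<zeta> \<partial>\<mu>) sums (\<integral>\<zeta>. (\<Sum>n. (\<zeta> powi (- k)) *s t n \<zeta>) \<partial>\<mu>)"
    proof (rule sums_integral)
      show "integrable \<mu> (\<lambda>\<zeta>. (\<zeta> powi (- k)) *s t n \<zeta>)" for n by (rule L2_integrable_vec[OF L'])
      show "AE \<zeta> in \<mu>. summable (\<lambda>n. norm ((\<zeta> powi (- k)) *s t n \<zeta>))"
        by (rule AE_I2) (subst nt, simp_all add: summable_mult[OF summ] summ del: norm_scalar_vec norm_mult norm_power)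
      have "(\<integral>\<zeta>. norm ((\<zeta> powi (- k)) *s t n \<zeta>) \<partial>\<mu>) = (\<integral>\<zeta>. norm (f \<zeta>) * norm (a n * complex_of_real r ^ n) \<partial>\<mu>)" for n
        by (rule Bochner_Integration.integral_cong[OF refl], rule nt) simp
      also have "\<dots> n = (\<integral>\<zeta>. norm (f \<zeta>) \<partial>\<mu>) * norm (a n * complex_of_real r ^ n)" for n
        by (rule integral_mult_left_zero)
      finally show "summable (\<lambda>n. \<integral>\<zeta>. norm ((\<zeta> powi (- k)) *s t n \<zeta>) \<partial>\<mu>)"
        using summable_mult[OF summ] by simp
    qed
    moreover have "(\<integral>\<zeta>. (\<zeta> powi (- k)) *s t n \<zeta> \<partial>\<mu>) = 0" for n
      using tH[of n] k by (simp add: H2_def fourier_coeff_def)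
    moreover have "(\<integral>\<zeta>. (\<Sum>n. (\<zeta> powi (- k)) *s t n \<zeta>) \<partial>\<mu>)
       = fourier_coeff (\<lambda>\<zeta>. \<phi> (complex_of_real r * \<zeta>) *s f \<zeta>) k"
      unfolding fourier_coeff_def
    proof (intro Bochner_Integration.integral_cong refl)
      fix \<zeta> assume "\<zeta> \<in> space \<mu>"
      then have "norm \<zeta> = 1" by simp
      from bounded_linear.sums[OF bounded_bilinear.bounded_linear_right[OF bounded_bilinear_scalar_vec] t_sums[OF this], of "\<zeta> powi (- k)"]
      show "(\<Sum>n. (\<zeta> powi (- k)) *s t n \<zeta>) = (\<zeta> powi (- k)) *s (\<phi> (complex_of_real r * \<zeta>) *s f \<zeta>)"
        by (rule sums_unique[symmetric])
    qed
    ultimately have "(\<lambda>n. 0) sums fourier_coeff (\<lambda>\<zeta>. \<phi> (complex_of_real r * \<zeta>) *s f \<zeta>) k"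
      by (simp only:)
    from sums_unique2[OF this sums_zero] show ?thesis .
  qed
  with L show ?thesis by (simp add: H2_def)
qed

lemma matrix_vec_entries:
  fixes A :: "complex^'n::finite^'m::finite"
  shows "A *v x = (\<Sum>l\<in>UNIV. \<Sum>j\<in>UNIV. A $ l $ j *s ((\<chi> l' j'. if l' = l \<and> j' = j then 1 else 0) *v x))"
proof (rule vec_eq_iff[THEN iffD2], rule allI)
  fix i
  have e: "((\<chi> l' j'. if l' = l \<and> j' = j then 1 else 0) *v x :: complex^'m) $ i = (if i = l then x $ j else 0)" for l j
  proof (cases "i = l")
    case True
    have "(\<Sum>j'\<in>UNIV. (if j' = j then 1 else 0) * x $ j') = (\<Sum>j'\<in>UNIV. if j' = j then x $ j' else 0)"
      by (rule sum.cong) auto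
    then show ?thesis using True by (simp add: matrix_vector_mult_def)
  qed (simp add: matrix_vector_mult_def)
  have "(\<Sum>l\<in>UNIV. \<Sum>j\<in>UNIV. A $ l $ j * (if i = l then x $ j else 0))
      = (\<Sum>l\<in>UNIV. if i = l then \<Sum>j\<in>UNIV. A $ l $ j * x $ j else 0)"
    by (rule sum.cong) auto
  then show "(A *v x) $ i = (\<Sum>l\<in>UNIV. \<Sum>j\<in>UNIV. A $ l $ j *s ((\<chi> l' j'. if l' = l \<and> j' = j then 1 else 0) *v x)) $ i"
    by (simp add: e) (simp add: matrix_vector_mult_def)
qed

text \<open>The products with the dilations of the analytic function lie in \<open>H\<^sup>2\<close>; dominated convergence reaches the boundary values.\<close>

lemma Hinf_mult_H2:
  fixes F :: "complex \<Rightarrow> complex^'n::finite^'m::finite"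
  assumes F: "F \<in> Hinf" and f: "f \<in> H2"
  shows "(\<lambda>\<zeta>. F \<zeta> *v f \<zeta>) \<in> H2"
proof -
  have FL: "F \<in> Linf" using F by (simp add: Hinf_def)
  have fL: "f \<in> L2" using f by (rule H2_L2)
  obtain G :: "complex \<Rightarrow> complex^'n^'m" where G: "\<And>i j. (\<lambda>z. G z $ i $ j) holomorphic_on ball 0 1" "bounded (G ` ball 0 1)"
    "AE \<zeta> in \<mu>. ((\<lambda>r. G (complex_of_real r * \<zeta>)) \<longlongrightarrow> F \<zeta>) (at_left 1)"
    using F unfolding Hinf_def by auto
  obtain B where "B > 0" "\<forall>A\<in>G ` ball 0 1. norm A \<le> B"
    using G(2) unfolding bounded_pos by blast
  then have B: "norm (G z) \<le> B" if "norm z < 1" for z using that by auto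
  obtain K where K: "K > 0" "\<And>(A::complex^'n^'m) x. norm (A *v x) \<le> norm A * norm x * K"
    using bounded_bilinear.pos_bounded[OF bounded_bilinear_matrix_vec] by metis
  define r where "r n = 1 - 1 / real (Suc n)" for n
  have r: "0 \<le> r n" "r n < 1" for n by (auto simp: r_def)
  have r_lim: "filterlim r (at_left 1) sequentially"
  proof -
    have "r \<longlonglongrightarrow> 1 - 0" unfolding r_def by (intro tendsto_intros LIMSEQ_Suc lim_1_over_n)
    moreover have "r n \<noteq> 1" for n using r(2)[of n] by simp
    ultimately show ?thesis unfolding filterlim_at by (simp add: r)
  qed
  define X where "X n \<zeta> = G (complex_of_real (r n) * \<zeta>) *v f \<zeta>" for n \<zeta>
  have XH: "X n \<in> H2" for n
    unfolding X_def by (subst matrix_vec_entries) (intro H2_sum H2_dilation_mult G H2_matrix f r)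
  have bound: "norm (X n \<zeta>) \<le> B * norm (f \<zeta>) * K" if "norm \<zeta> = 1" for n \<zeta>
  proof -
    have "norm (complex_of_real (r n) * \<zeta>) < 1" using r[of n] that by (simp add: norm_mult)
    then have "norm (G (complex_of_real (r n) * \<zeta>)) * norm (f \<zeta>) * K \<le> B * norm (f \<zeta>) * K"
      using K(1) by (intro mult_right_mono B) auto
    then show ?thesis unfolding X_def using K(2) order_trans by blast
  qed
  have "fourier_coeff (\<lambda>\<zeta>. F \<zeta> *v f \<zeta>) k = 0" if k: "k < 0" for k
  proof -
    have "(\<lambda>n. \<integral>\<zeta>. (\<zeta> powi (- k)) *s X n \<zeta> \<partial>\<mu>) \<longlonglongrightarrow> (\<integral>\<zeta>. (\<zeta> powi (- k)) *s (F \<zeta> *v f \<zeta>) \<partial>\<mu>)"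
    proof (rule integral_dominated_convergence[where w="\<lambda>\<zeta>. B * norm (f \<zeta>) * K"])
      note [measurable] = L2_measurable[OF H2_L2[OF XH]] L2_measurable[OF Linf_L2[OF FL fL]]
      show "(\<lambda>\<zeta>. (\<zeta> powi (- k)) *s (F \<zeta> *v f \<zeta>)) \<in> borel_measurable \<mu>" by measurable
      show "(\<lambda>\<zeta>. (\<zeta> powi (- k)) *s X n \<zeta>) \<in> borel_measurable \<mu>" for n by measurable
      show "integrable \<mu> (\<lambda>\<zeta>. B * norm (f \<zeta>) * K)" using L2_integrable_vec[OF fL] by simp
      show "AE \<zeta> in \<mu>. norm ((\<zeta> powi (- k)) *s X n \<zeta>) \<le> B * norm (f \<zeta>) * K" for n
        using bound by (intro AE_I2) (simp add: norm_power_int)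
      show "AE \<zeta> in \<mu>. (\<lambda>n. (\<zeta> powi (- k)) *s X n \<zeta>) \<longlonglongrightarrow> (\<zeta> powi (- k)) *s (F \<zeta> *v f \<zeta>)"
        using G(3)
      proof eventually_elim
        case (elim \<zeta>)
        from filterlim_compose[OF elim r_lim] show ?case
          unfolding X_def by (intro tendsto_intros)
      qed
    qed
    moreover have "(\<integral>\<zeta>. (\<zeta> powi (- k)) *s X n \<zeta> \<partial>\<mu>) = 0" for n
      using XH[of n] k by (simp add: H2_def fourier_coeff_def)
    ultimately show ?thesis by (simp add: fourier_coeff_def LIMSEQ_const_iff)
  qed
  then show ?thesis using Linf_L2[OF FL fL] by (simp add: H2_def)
qed

section \<open>Maximizing vectors of the Hankel operator\<close>

lemma hankel_lin:
  assumes \<Phi>: "\<Phi> \<in> Linf" and f: "f \<in> L2" and g: "g \<in> L2"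
  shows "AE \<zeta> in \<mu>. hankel \<Phi> (\<lambda>\<xi>. a *s f \<xi> + b *s g \<xi>) \<zeta> = a *s hankel \<Phi> f \<zeta> + b *s hankel \<Phi> g \<zeta>"
proof -
  let ?s = "\<lambda>\<xi>. a *s f \<xi> + b *s g \<xi>"
  have sL: "?s \<in> L2" by (intro L2_add L2_cmult f g)
  define D where "D \<zeta> = hankel \<Phi> ?s \<zeta> - (a *s hankel \<Phi> f \<zeta> + b *s hankel \<Phi> g \<zeta>)" for \<zeta>
  note hm = hankel_form(1)[OF \<Phi>]
  have D: "D \<in> H2_minus" unfolding D_def by (intro H2_minus_diff H2_minus_add H2_minus_cmult hm sL f g)
  have DL: "D \<in> L2" by (rule H2_minus_L2[OF D])
  have hL: "hankel \<Phi> u \<in> L2" if "u \<in> L2" for u by (rule H2_minus_L2[OF hm[OF that]])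
  have one: "ip (\<lambda>\<zeta>. c *s hankel \<Phi> u \<zeta>) D = ip (\<lambda>\<zeta>. c *s (\<Phi> \<zeta> *v u \<zeta>)) D" if "u \<in> L2" for c u
    unfolding ip_scalar by (rule hankel_form(2)[OF \<Phi> that H2_minus_cmult[OF D]])
  have "ip (hankel \<Phi> ?s) D = ip (\<lambda>\<zeta>. \<Phi> \<zeta> *v ?s \<zeta>) D" by (rule hankel_form(2)[OF \<Phi> sL D])
  also have "\<dots> = ip (\<lambda>\<zeta>. a *s (\<Phi> \<zeta> *v f \<zeta>) + b *s (\<Phi> \<zeta> *v g \<zeta>)) D"
    by (simp only: matrix_vector_right_distrib matrix_scalar_vec)
  also have "\<dots> = ip (\<lambda>\<zeta>. a *s hankel \<Phi> f \<zeta>) D + ip (\<lambda>\<zeta>. b *s hankel \<Phi> g \<zeta>) D"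
    unfolding one[OF f] one[OF g] by (intro ip_add_left L2_cmult Linf_L2 \<Phi> f g DL)
  also have "\<dots> = ip (\<lambda>\<zeta>. a *s hankel \<Phi> f \<zeta> + b *s hankel \<Phi> g \<zeta>) D"
    by (intro ip_add_left[symmetric] L2_cmult hL f g DL)
  finally have "ip D D = 0"
    unfolding D_def[abs_def] by (subst ip_diff_left) (auto intro!: L2_add L2_cmult hL f g sL DL simp: D_def[abs_def, symmetric])
  then have "AE \<zeta> in \<mu>. D \<zeta> = 0" using L2_norm_eq_0_iff[OF DL] by (simp add: ip_self)
  then show ?thesis by eventually_elim (simp add: D_def)
qed

lemma hankel_le:
  assumes \<Phi>: "\<Phi> \<in> Linf" and f: "f \<in> L2"
  shows "L2_norm (hankel \<Phi> f) \<le> L2_norm (\<lambda>\<zeta>. \<Phi> \<zeta> *v f \<zeta>)"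
    and "(L2_norm (\<lambda>\<zeta>. \<Phi> \<zeta> *v f \<zeta> - hankel \<Phi> f \<zeta>))\<^sup>2 = (L2_norm (\<lambda>\<zeta>. \<Phi> \<zeta> *v f \<zeta>))\<^sup>2 - (L2_norm (hankel \<Phi> f))\<^sup>2"
proof -
  let ?y = "\<lambda>\<zeta>. \<Phi> \<zeta> *v f \<zeta>" and ?h = "hankel \<Phi> f"
  note h = hankel_form[OF \<Phi> f]
  have hL: "?h \<in> L2" by (rule H2_minus_L2[OF h(1)])
  have "ip ?y ?h = ip ?h ?h" using h(2)[OF h(1)] by simp
  then show *: "(L2_norm (\<lambda>\<zeta>. ?y \<zeta> - ?h \<zeta>))\<^sup>2 = (L2_norm ?y)\<^sup>2 - (L2_norm ?h)\<^sup>2"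
    using L2.quad_expand[OF Linf_L2[OF \<Phi> f] hL, of "-1"] by (simp add: ip_self)
  have "0 \<le> (L2_norm (\<lambda>\<zeta>. ?y \<zeta> - ?h \<zeta>))\<^sup>2" by simp
  then have "(L2_norm ?h)\<^sup>2 \<le> (L2_norm ?y)\<^sup>2" unfolding * by simp
  then show "L2_norm ?h \<le> L2_norm ?y" by (rule power2_le_imp_le) simp
qed

lemma compact_operator_zero: "compact_operator H2 (H2_minus :: (complex \<Rightarrow> complex^'m::finite) set) (\<lambda>(f :: complex \<Rightarrow> complex^'n::finite) \<zeta>. 0)"
proof -
  have "(\<lambda>_. 0) \<in> (H2_minus :: (complex \<Rightarrow> complex^'m) set)" by (simp add: H2_minus_eq_annih)
  moreover have "L2_norm (\<lambda>_. 0 :: complex^'m) = 0" by (simp add: L2_norm_def)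
  ultimately show ?thesis
    unfolding compact_operator_def L2_operator_def
    by (auto intro!: exI[of _ 0] exI[of _ "\<lambda>n. n"] bexI[of _ "\<lambda>_. 0"] simp: strict_mono_def)
qed

text \<open>A compact perturbation \<open>T = H - K\<close> has norm \<open>a\<close> smaller than \<open>\<rho> = \<parallel>\<Phi>\<parallel>\<close>. For unit vectors \<open>F m\<close>, \<open>F n\<close> of a maximizing
  sequence on which \<open>K\<close> converges, the parallelogram law makes \<open>\<parallel>H (F m - F n)\<parallel>\<close> at least about \<open>\<rho> \<parallel>F m - F n\<parallel>\<close>, whereas
  \<open>K\<close> contributes little, so it is at most about \<open>a \<parallel>F m - F n\<parallel>\<close>. Hence the sequence is Cauchy, without any weak compactness.\<close>

lemma hankel_norm_attained:
  fixes \<Phi> :: "complex \<Rightarrow> complex^'n::finite^'m::finite"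
  assumes \<Phi>: "\<Phi> \<in> Linf" and ess: "essential_norm H2 H2_minus (hankel \<Phi>) < Linf_norm \<Phi>"
    and big: "\<And>r. 0 \<le> r \<Longrightarrow> r < Linf_norm \<Phi> \<Longrightarrow> \<not> hankel_bound \<Phi> r"
  shows "0 < Linf_norm \<Phi> \<and> (\<exists>f\<in>H2. L2_norm f = 1 \<and> L2_norm (hankel \<Phi> f) = Linf_norm \<Phi>)"
proof -
  define \<rho> where "\<rho> = Linf_norm \<Phi>"
  define H where "H = hankel \<Phi>"
  have Hm: "H f \<in> H2_minus" and HL: "H f \<in> L2" if "f \<in> H2" for f
    using hankel_form(1)[OF \<Phi> H2_L2[OF that]] by (auto simp: H_def H2_minus_L2)
  have Hle: "L2_norm (H f) \<le> \<rho> * L2_norm f" if "f \<in> H2" for f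
    using hankel_le(1)[OF \<Phi> H2_L2[OF that]] Linf_L2_norm[OF \<Phi> H2_L2[OF that]] by (simp add: H_def \<rho>_def)
  have Hlin: "AE \<zeta> in \<mu>. H (\<lambda>\<xi>. a *s f \<xi> + b *s g \<xi>) \<zeta> = a *s H f \<zeta> + b *s H g \<zeta>" if "f \<in> H2" "g \<in> H2" for a b f g
    unfolding H_def by (rule hankel_lin[OF \<Phi> H2_L2[OF that(1)] H2_L2[OF that(2)]])
  obtain K where K: "compact_operator H2 H2_minus K" "operator_norm H2 (\<lambda>f \<zeta>. H f \<zeta> - K f \<zeta>) < \<rho>"
  proof -
    have "{K. compact_operator H2 H2_minus K} \<noteq> ({} :: ((complex \<Rightarrow> complex^'n) \<Rightarrow> complex \<Rightarrow> complex^'m) set)"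
      using compact_operator_zero by blast
    with cInf_lessD[OF _ ess[unfolded essential_norm_def]] show ?thesis
      using that by (auto simp: H_def \<rho>_def)
  qed
  have Km: "K f \<in> H2_minus" and KL: "K f \<in> L2" if "f \<in> H2" for f
    using K(1) that by (auto simp: compact_operator_def L2_operator_def H2_minus_L2)
  have Klin: "AE \<zeta> in \<mu>. K (\<lambda>\<xi>. a *s f \<xi> + b *s g \<xi>) \<zeta> = a *s K f \<zeta> + b *s K g \<zeta>" if "f \<in> H2" "g \<in> H2" for a b f g
    using K(1) that by (auto simp: compact_operator_def L2_operator_def)
  obtain C where C: "\<And>f. f \<in> H2 \<Longrightarrow> L2_norm (K f) \<le> C * L2_norm f"
    using K(1) unfolding compact_operator_def L2_operator_def by blast
  define T where "T f \<zeta> = H f \<zeta> - K f \<zeta>" for f \<zeta>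
  have TL: "T f \<in> L2" if "f \<in> H2" for f unfolding T_def by (intro L2_diff HL KL that)
  define a where "a = operator_norm H2 (\<lambda>f \<zeta>. H f \<zeta> - K f \<zeta>)"
  have T1: "L2_norm (T f) \<le> (\<rho> + C) * L2_norm f" if "f \<in> H2" for f
    using L2_norm_triangle_diff[OF HL[OF that] KL[OF that]] Hle[OF that] C[OF that]
    by (simp add: T_def[abs_def] distrib_right)
  have T2: "L2_norm (T f) \<le> a" if "f \<in> H2" "L2_norm f \<le> 1" for f
    unfolding a_def operator_norm_def T_def[abs_def, symmetric]
  proof (rule cSUP_upper)
    show "f \<in> {f \<in> H2. L2_norm f \<le> 1}" using that by simp
    show "bdd_above ((\<lambda>f. L2_norm (T f)) ` {f \<in> H2. L2_norm f \<le> 1})"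
    proof (rule bdd_aboveI2)
      fix f :: "complex \<Rightarrow> complex^'n" assume f: "f \<in> {f \<in> H2. L2_norm f \<le> 1}"
      have "(\<rho> + C) * L2_norm f \<le> \<bar>\<rho> + C\<bar> * 1" using f by (intro mult_mono) auto
      then show "L2_norm (T f) \<le> \<bar>\<rho> + C\<bar>" using T1[of f] f by simp
    qed
  qed
  have "L2_norm (\<lambda>_. 0 :: complex^'n) \<le> 1" by (simp add: L2_norm_def)
  from order_trans[OF L2_norm_nonneg T2[OF H2_zero this]] have a0: "0 \<le> a" .
  have a\<rho>: "a < \<rho>" using K(2) by (simp add: a_def)
  have hom: "AE \<zeta> in \<mu>. T (\<lambda>\<xi>. c *s f \<xi> + d *s g \<xi>) \<zeta> = c *s T f \<zeta> + d *s T g \<zeta>" if "f \<in> H2" "g \<in> H2" for c d f g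
    using Hlin[OF that, of c d] Klin[OF that, of c d]
    by eventually_elim (simp add: T_def vector_ssub_ldistrib)
  have T3: "L2_norm (T f) \<le> a * L2_norm f" if f: "f \<in> H2" for f
  proof (cases "L2_norm f = 0")
    case True
    then show ?thesis using T1[OF f] by simp
  next
    case False
    define c where "c = complex_of_real (1 / L2_norm f)"
    have cf: "(\<lambda>\<xi>. c *s f \<xi>) \<in> H2" by (rule H2_cmult[OF f])
    have "L2_norm (T (\<lambda>\<xi>. c *s f \<xi>)) = L2_norm (\<lambda>\<zeta>. c *s T f \<zeta>)"
      using hom[OF f f, of c 0] by (intro L2_norm_cong_AE TL cf L2_cmult f) simp
    also have "\<dots> = L2_norm (T f) / L2_norm f" using False by (simp add: L2_norm_cmult c_def norm_divide)
    finally have "L2_norm (T (\<lambda>\<xi>. c *s f \<xi>)) = L2_norm (T f) / L2_norm f" .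
    moreover have "L2_norm (\<lambda>\<xi>. c *s f \<xi>) \<le> 1"
      using False unfolding L2_norm_cmult by (simp add: c_def norm_divide)
    ultimately have "L2_norm (T f) / L2_norm f \<le> a" using T2[OF cf] by metis
    moreover have "0 < L2_norm f" using False L2_norm_nonneg[of f] by linarith
    ultimately show ?thesis by (simp add: pos_divide_le_eq)
  qed
  have pos: "0 < \<rho>" using a0 a\<rho> by simp
  have "\<exists>f\<in>H2. L2_norm f = 1 \<and> \<rho> - 1 / real (Suc n) < L2_norm (H f)" for n
  proof -
    define s where "s = max 0 (\<rho> - 1 / real (Suc n))"
    have "\<not> hankel_bound \<Phi> s" using pos by (intro big) (auto simp: s_def \<rho>_def)
    then obtain f h where f: "f \<in> H2" "h \<in> H2_minus" "s * L2_norm f * L2_norm h < ip (\<lambda>\<zeta>. \<Phi> \<zeta> *v f \<zeta>) h"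
      by (auto simp: hankel_bound_def not_le)
    have "ip (\<lambda>\<zeta>. \<Phi> \<zeta> *v f \<zeta>) h = ip (H f) h"
      unfolding H_def using hankel_form(2)[OF \<Phi> H2_L2[OF f(1)] f(2)] by simp
    also have "\<dots> \<le> L2_norm (H f) * L2_norm h"
      using L2_cauchy_schwarz[OF HL[OF f(1)] H2_minus_L2[OF f(2)]] by simp
    finally have "(s * L2_norm f) * L2_norm h < L2_norm (H f) * L2_norm h" using f(3) by simp
    then have lt: "s * L2_norm f < L2_norm (H f)"
      using L2_norm_nonneg[of h] by (simp add: mult_less_cancel_right)
    have nf: "L2_norm f \<noteq> 0" using lt Hle[OF f(1)] by auto
    define c where "c = complex_of_real (1 / L2_norm f)"
    have cf: "(\<lambda>\<xi>. c *s f \<xi>) \<in> H2" by (rule H2_cmult[OF f(1)])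
    have nH: "L2_norm (H (\<lambda>\<xi>. c *s f \<xi>)) = L2_norm (\<lambda>\<zeta>. c *s H f \<zeta>)"
      using Hlin[OF f(1) f(1), of c 0] by (intro L2_norm_cong_AE HL cf L2_cmult f) simp
    have "s < L2_norm (H (\<lambda>\<xi>. c *s f \<xi>))"
    proof -
      have "0 < L2_norm f" using nf L2_norm_nonneg[of f] by linarith
      then show ?thesis unfolding nH L2_norm_cmult using lt by (simp add: c_def norm_divide pos_less_divide_eq)
    qed
    moreover have "L2_norm (\<lambda>\<xi>. c *s f \<xi>) = 1" using nf by (simp add: L2_norm_cmult c_def norm_divide)
    ultimately show ?thesis using cf by (intro bexI[of _ "\<lambda>\<xi>. c *s f \<xi>"]) (auto simp: s_def)
  qed
  then obtain f0 where f0: "\<And>n. f0 n \<in> H2" "\<And>n. L2_norm (f0 n) = 1" "\<And>n. \<rho> - 1 / real (Suc n) < L2_norm (H (f0 n))"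
    by metis
  obtain g s where g: "g \<in> H2_minus" "strict_mono s" "(\<lambda>k. L2_norm (\<lambda>\<zeta>. K (f0 (s k)) \<zeta> - g \<zeta>)) \<longlonglongrightarrow> 0"
  proof -
    have "(\<forall>k. f0 k \<in> H2) \<and> (\<exists>C. \<forall>k. L2_norm (f0 k) \<le> C)" using f0 by (auto intro!: exI[of _ 1])
    with K(1) show ?thesis using that unfolding compact_operator_def by blast
  qed
  define F where "F n = f0 (s n)" for n
  have F: "F n \<in> H2" "L2_norm (F n) = 1" for n by (simp_all add: F_def f0)
  have FL: "F n \<in> L2" for n by (rule H2_L2[OF F(1)])
  have HF: "(\<lambda>n. L2_norm (H (F n))) \<longlonglongrightarrow> \<rho>"
  proof (rule tendsto_sandwich[of "\<lambda>n. \<rho> - 1 / real (Suc n)" _ _ "\<lambda>_. \<rho>"])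
    show "\<forall>\<^sub>F n in sequentially. \<rho> - 1 / real (Suc n) \<le> L2_norm (H (F n))"
    proof (intro always_eventually allI)
      fix n
      have "1 / real (Suc (s n)) \<le> 1 / real (Suc n)"
        using seq_suble[OF g(2), of n] by (intro divide_left_mono) auto
      then show "\<rho> - 1 / real (Suc n) \<le> L2_norm (H (F n))" using f0(3)[of "s n"] by (simp add: F_def)
    qed
    show "\<forall>\<^sub>F n in sequentially. L2_norm (H (F n)) \<le> \<rho>" using Hle[OF F(1)] F(2) by simp
    show "(\<lambda>n. \<rho> - 1 / real (Suc n)) \<longlonglongrightarrow> \<rho>"
      using tendsto_diff[OF tendsto_const[of \<rho>] LIMSEQ_Suc[OF lim_1_over_n]] by simp
  qed simp
  define k where "k n = L2_norm (\<lambda>\<zeta>. K (F n) \<zeta> - g \<zeta>)" for n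
  \<comment> \<open>Twice the defect of \<open>F n\<close> from being maximizing, and the cost of replacing \<open>K (F n)\<close> by its limit \<open>g\<close>.\<close>
  define \<epsilon> where "\<epsilon> n = 2 * (\<rho>\<^sup>2 - (L2_norm (H (F n)))\<^sup>2) + 4 * a * k n + 2 * (k n)\<^sup>2" for n
  have "\<epsilon> \<longlonglongrightarrow> 2 * (\<rho>\<^sup>2 - \<rho>\<^sup>2) + 4 * a * 0 + 2 * 0\<^sup>2"
    unfolding \<epsilon>_def k_def F_def by (intro tendsto_intros HF[unfolded F_def] g(3))
  then have \<epsilon>: "\<epsilon> \<longlonglongrightarrow> 0" by simp
  have key: "(\<rho>\<^sup>2 - a\<^sup>2) * (L2_norm (\<lambda>\<zeta>. F m \<zeta> - F n \<zeta>))\<^sup>2 \<le> \<epsilon> m + \<epsilon> n" for m n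
  proof -
    let ?D = "\<lambda>\<zeta>. F m \<zeta> - F n \<zeta>" and ?S = "\<lambda>\<zeta>. F m \<zeta> + F n \<zeta>"
    define d where "d = L2_norm ?D"
    have DH: "?D \<in> H2" and SH: "?S \<in> H2" by (intro H2_diff H2_add F)+
    have d2: "d \<le> 2" unfolding d_def using L2_norm_triangle_diff[OF FL FL, of m n] F(2) by simp
    have d0: "0 \<le> d" by (simp add: d_def)
    have plF: "(L2_norm ?S)\<^sup>2 = 4 - d\<^sup>2"
      using L2.parallelogram[OF FL FL, of m n] F(2) by (simp add: ip_self d_def)
    have plH: "(L2_norm (\<lambda>\<zeta>. H (F m) \<zeta> - H (F n) \<zeta>))\<^sup>2 + (L2_norm (\<lambda>\<zeta>. H (F m) \<zeta> + H (F n) \<zeta>))\<^sup>2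
        = 2 * (L2_norm (H (F m)))\<^sup>2 + 2 * (L2_norm (H (F n)))\<^sup>2"
      using L2.parallelogram[OF HL[OF F(1)] HL[OF F(1)], of m n] by (simp add: ip_self)
    have HS: "L2_norm (\<lambda>\<zeta>. H (F m) \<zeta> + H (F n) \<zeta>) = L2_norm (H ?S)"
      using Hlin[OF F(1) F(1), of 1 m 1 n] by (intro L2_norm_cong_AE L2_add HL F SH) auto
    have "L2_norm (\<lambda>\<zeta>. H (F m) \<zeta> + H (F n) \<zeta>) \<le> \<rho> * L2_norm ?S"
      unfolding HS by (rule Hle[OF SH])
    then have "(L2_norm (\<lambda>\<zeta>. H (F m) \<zeta> + H (F n) \<zeta>))\<^sup>2 \<le> (\<rho> * L2_norm ?S)\<^sup>2" by (rule power_mono) simp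
    then have up: "(L2_norm (\<lambda>\<zeta>. H (F m) \<zeta> + H (F n) \<zeta>))\<^sup>2 \<le> \<rho>\<^sup>2 * (4 - d\<^sup>2)"
      by (simp add: power_mult_distrib plF)
    have kL: "(\<lambda>\<zeta>. K (F m) \<zeta> - K (F n) \<zeta>) \<in> L2" by (intro L2_diff KL F)
    have kmn: "L2_norm (\<lambda>\<zeta>. K (F m) \<zeta> - K (F n) \<zeta>) \<le> k m + k n"
      using L2_norm_triangle_diff[OF L2_diff[OF KL[OF F(1)] H2_minus_L2[OF g(1)]] L2_diff[OF KL[OF F(1)] H2_minus_L2[OF g(1)]], of m n]
      by (simp add: k_def)
    have "L2_norm (\<lambda>\<zeta>. H (F m) \<zeta> - H (F n) \<zeta>) = L2_norm (\<lambda>\<zeta>. T ?D \<zeta> + (K (F m) \<zeta> - K (F n) \<zeta>))"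
      using hom[OF F(1) F(1), of 1 m "-1" n]
      by (intro L2_norm_cong_AE L2_diff L2_add TL DH HL KL F) (auto simp: T_def elim!: eventually_mono)
    also have "\<dots> \<le> a * d + (k m + k n)"
      using L2_norm_triangle[OF TL[OF DH] kL] T3[OF DH] kmn by (simp add: d_def)
    finally have "(L2_norm (\<lambda>\<zeta>. H (F m) \<zeta> - H (F n) \<zeta>))\<^sup>2 \<le> (a * d + (k m + k n))\<^sup>2" by (rule power_mono) simp
    also have "\<dots> = a\<^sup>2 * d\<^sup>2 + 2 * a * d * (k m + k n) + (k m + k n)\<^sup>2" by (simp add: power2_sum power_mult_distrib)
    also have "2 * a * d * (k m + k n) \<le> 2 * a * 2 * (k m + k n)"
      using d2 a0 by (intro mult_right_mono mult_left_mono) (auto simp: k_def)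
    also have "(k m + k n)\<^sup>2 \<le> 2 * (k m)\<^sup>2 + 2 * (k n)\<^sup>2"
      using sum_squares_bound[of "k m" "k n"] by (simp add: power2_sum)
    finally have "(L2_norm (\<lambda>\<zeta>. H (F m) \<zeta> - H (F n) \<zeta>))\<^sup>2
       \<le> a\<^sup>2 * d\<^sup>2 + 2 * a * 2 * (k m + k n) + (2 * (k m)\<^sup>2 + 2 * (k n)\<^sup>2)" by simp
    with up plH show ?thesis unfolding \<epsilon>_def d_def[symmetric] by (simp add: algebra_simps)
  qed
  have gap: "0 < \<rho>\<^sup>2 - a\<^sup>2" using a0 a\<rho> power_strict_mono[of a \<rho> 2] by simp
  have "\<exists>f\<in>H2. (\<lambda>n. L2_norm (\<lambda>\<zeta>. F n \<zeta> - f \<zeta>)) \<longlonglongrightarrow> 0"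
    unfolding H2_eq_annih
  proof (rule annih_complete[OF monomials_L2 F(1)[unfolded H2_eq_annih]])
    fix e :: real assume e: "e > 0"
    then have "(\<rho>\<^sup>2 - a\<^sup>2) * e\<^sup>2 / 2 > 0" using gap by simp
    from order_tendstoD(2)[OF \<epsilon> this] obtain N where N: "\<And>n. n \<ge> N \<Longrightarrow> \<epsilon> n < (\<rho>\<^sup>2 - a\<^sup>2) * e\<^sup>2 / 2"
      by (auto simp: eventually_sequentially)
    have "L2_norm (\<lambda>\<zeta>. F m \<zeta> - F n \<zeta>) < e" if "m \<ge> N" "n \<ge> N" for m n
    proof -
      have "(\<rho>\<^sup>2 - a\<^sup>2) * (L2_norm (\<lambda>\<zeta>. F m \<zeta> - F n \<zeta>))\<^sup>2 < (\<rho>\<^sup>2 - a\<^sup>2) * e\<^sup>2"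
        using key[of m n] N[OF that(1)] N[OF that(2)] by linarith
      then have "(L2_norm (\<lambda>\<zeta>. F m \<zeta> - F n \<zeta>))\<^sup>2 < e\<^sup>2" using gap by simp
      then show ?thesis using e by (intro power2_less_imp_less[of _ e]) auto
    qed
    then show "\<exists>N. \<forall>m\<ge>N. \<forall>n\<ge>N. L2_norm (\<lambda>\<zeta>. F m \<zeta> - F n \<zeta>) < e" by blast
  qed
  then obtain f where f: "f \<in> H2" "(\<lambda>n. L2_norm (\<lambda>\<zeta>. F n \<zeta> - f \<zeta>)) \<longlonglongrightarrow> 0" by blast
  have fL: "f \<in> L2" by (rule H2_L2[OF f(1)])
  have "L2_norm f \<le> 1 + L2_norm (\<lambda>\<zeta>. F n \<zeta> - f \<zeta>)" for n
    using L2_norm_triangle_diff[OF FL[of n] L2_diff[OF FL[of n] fL]] F(2)[of n] by simp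
  moreover have "(\<lambda>n. 1 + L2_norm (\<lambda>\<zeta>. F n \<zeta> - f \<zeta>)) \<longlonglongrightarrow> 1 + 0" by (intro tendsto_intros f)
  ultimately have f_le: "L2_norm f \<le> 1 + 0" by (intro LIMSEQ_le_const) auto
  have "L2_norm (H (F n)) \<le> L2_norm (H f) + \<rho> * L2_norm (\<lambda>\<zeta>. F n \<zeta> - f \<zeta>)" for n
  proof -
    have DH: "(\<lambda>\<zeta>. F n \<zeta> - f \<zeta>) \<in> H2" by (intro H2_diff F f)
    have "L2_norm (H (F n)) = L2_norm (\<lambda>\<zeta>. H f \<zeta> + H (\<lambda>\<zeta>. F n \<zeta> - f \<zeta>) \<zeta>)"
      using Hlin[OF F(1) f(1), of 1 n "-1"]
      by (intro L2_norm_cong_AE L2_add HL DH F f) (auto elim!: eventually_mono)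
    also have "\<dots> \<le> L2_norm (H f) + \<rho> * L2_norm (\<lambda>\<zeta>. F n \<zeta> - f \<zeta>)"
      using L2_norm_triangle[OF HL[OF f(1)] HL[OF DH]] Hle[OF DH] by simp
    finally show ?thesis .
  qed
  moreover have "(\<lambda>n. L2_norm (H f) + \<rho> * L2_norm (\<lambda>\<zeta>. F n \<zeta> - f \<zeta>)) \<longlonglongrightarrow> L2_norm (H f) + \<rho> * 0"
    by (intro tendsto_intros f)
  ultimately have "\<rho> \<le> L2_norm (H f) + \<rho> * 0" using HF by (intro LIMSEQ_le[of "\<lambda>n. L2_norm (H (F n))"]) auto
  then have ge: "\<rho> \<le> L2_norm (H f)" by simp
  then have "\<rho> * 1 \<le> \<rho> * L2_norm f" using Hle[OF f(1)] by simp
  then have "L2_norm f = 1" using f_le pos by simp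
  moreover from this have "L2_norm (H f) = \<rho>" using ge Hle[OF f(1)] by simp
  ultimately show ?thesis using f(1) pos unfolding H_def \<rho>_def by blast
qed

section \<open>Badly approximable matrix functions\<close>

text \<open>The Toeplitz image and \<open>\<Phi> f\<close> have the same inner products with \<open>H\<^sup>2\<close>, whichever representative of the projection
  was chosen.\<close>

lemma ker_toeplitz_iff:
  assumes \<Phi>: "\<Phi> \<in> Linf" and f: "f \<in> H2"
  shows "f \<in> ker_toeplitz \<Phi> \<longleftrightarrow> (\<lambda>\<zeta>. \<Phi> \<zeta> *v f \<zeta>) \<in> H2_minus"
proof -
  let ?y = "\<lambda>\<zeta>. \<Phi> \<zeta> *v f \<zeta>"
  have yL: "?y \<in> L2" by (rule Linf_L2[OF \<Phi> H2_L2[OF f]])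
  define t where "t = toeplitz \<Phi> f"
  have t: "t \<in> H2" "\<And>k. k \<in> H2 \<Longrightarrow> ip t k = ip ?y k"
    unfolding t_def toeplitz_def using orth_proj_H2[OF yL] by auto
  have tL: "t \<in> L2" by (rule H2_L2[OF t(1)])
  have "(AE \<zeta> in \<mu>. t \<zeta> = 0) \<longleftrightarrow> ?y \<in> H2_minus"
  proof
    assume 0: "AE \<zeta> in \<mu>. t \<zeta> = 0"
    have "ip ?y k = 0" if k: "k \<in> H2" for k
    proof -
      have "ip t k = ip (\<lambda>_. 0) k" by (rule ip_cong_AE) (use 0 tL H2_L2[OF k] in auto)
      then show ?thesis using t(2)[OF k] by simp
    qed
    then show "?y \<in> H2_minus" using yL by (simp add: H2_minus_eq_annih annih_def)
  next
    assume "?y \<in> H2_minus"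
    then have "ip t t = 0" using t(2)[OF t(1)] H2_minus_ip[OF _ t(1)] by simp
    then show "AE \<zeta> in \<mu>. t \<zeta> = 0" using L2_norm_eq_0_iff[OF tL] by (simp add: ip_self)
  qed
  then show ?thesis using f by (simp add: ker_toeplitz_def t_def)
qed

lemma Hinf_Linf: "F \<in> Hinf \<Longrightarrow> F \<in> Linf"
  by (simp add: Hinf_def)

lemma zero_Hinf: "(\<lambda>_. 0) \<in> Hinf"
  by (rule Hinf_of_columns_H2[OF Linf_const]) simp

lemma badly_approximable_iff:
  assumes \<Phi>: "\<Phi> \<in> Linf"
  shows "badly_approximable \<Phi> \<longleftrightarrow> (\<forall>F\<in>Hinf. Linf_norm \<Phi> \<le> Linf_norm (\<lambda>\<zeta>. \<Phi> \<zeta> - F \<zeta>))"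
proof -
  let ?D = "\<lambda>F. Linf_norm (\<lambda>\<zeta>. \<Phi> \<zeta> - F \<zeta>)"
  have bdd: "bdd_below (?D ` Hinf)"
    using Linf_norm_ereal(2)[OF Linf_diff[OF \<Phi> Hinf_Linf]] by (auto intro!: bdd_belowI[of _ 0])
  have le: "(INF F\<in>Hinf. ?D F) \<le> Linf_norm \<Phi>"
    using cINF_lower[OF bdd zero_Hinf] by simp
  show ?thesis
  proof
    assume "badly_approximable \<Phi>"
    then show "\<forall>F\<in>Hinf. Linf_norm \<Phi> \<le> ?D F"
      unfolding badly_approximable_def using cINF_lower[OF bdd] by auto
  next
    assume "\<forall>F\<in>Hinf. Linf_norm \<Phi> \<le> ?D F"
    then have "Linf_norm \<Phi> \<le> (INF F\<in>Hinf. ?D F)"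
      using zero_Hinf by (intro cINF_greatest) auto
    with le show "badly_approximable \<Phi>" unfolding badly_approximable_def by simp
  qed
qed

text \<open>\<open>F f\<close> is orthogonal to \<open>\<Phi> f\<close>, so \<open>\<Phi> f\<close> is no larger than the image of \<open>f\<close> under multiplication by \<open>\<Phi> - F\<close>.\<close>

lemma badly_approximable_sufficient:
  assumes \<Phi>: "\<Phi> \<in> Linf" and c: "AE \<zeta> in \<mu>. mat_norm (\<Phi> \<zeta>) = c"
    and f: "f \<in> ker_toeplitz \<Phi>" and max: "AE \<zeta> in \<mu>. maximizing_vector (\<Phi> \<zeta>) (f \<zeta>)"
  shows "badly_approximable \<Phi>"
  unfolding badly_approximable_iff[OF \<Phi>]
proof
  fix F :: "complex \<Rightarrow> complex^'a^'b" assume F: "F \<in> Hinf"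
  define D where "D \<zeta> = \<Phi> \<zeta> - F \<zeta>" for \<zeta>
  have D: "D \<in> Linf" unfolding D_def by (intro Linf_diff \<Phi> Hinf_Linf F)
  have fH: "f \<in> H2" using f by (simp add: ker_toeplitz_def)
  have fL: "f \<in> L2" by (rule H2_L2[OF fH])
  define y where "y \<zeta> = \<Phi> \<zeta> *v f \<zeta>" for \<zeta>
  have y: "y \<in> H2_minus" using f ker_toeplitz_iff[OF \<Phi> fH] by (simp add: y_def[abs_def])
  have yL: "y \<in> L2" by (rule H2_minus_L2[OF y])
  have f0: "L2_norm f > 0"
  proof -
    have "\<not> (AE \<zeta> in \<mu>. f \<zeta> = 0)"
    proof
      assume "AE \<zeta> in \<mu>. f \<zeta> = 0"
      with max have "AE \<zeta> in \<mu>. False" by eventually_elim (simp add: maximizing_vector_def)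
      then show False by simp
    qed
    then show ?thesis using L2_norm_eq_0_iff[OF fL] L2_norm_nonneg[of f] by linarith
  qed
  have "(L2_norm y)\<^sup>2 = (\<integral>\<zeta>. c\<^sup>2 * (norm (f \<zeta>))\<^sup>2 \<partial>\<mu>)"
  proof -
    note [measurable] = fL yL
    have "(L2_norm y)\<^sup>2 = (\<integral>\<zeta>. (norm (y \<zeta>))\<^sup>2 \<partial>\<mu>)" by (simp add: L2_norm_def integral_nonneg_AE)
    also have "\<dots> = (\<integral>\<zeta>. c\<^sup>2 * (norm (f \<zeta>))\<^sup>2 \<partial>\<mu>)"
    proof (rule integral_cong_AE)
      show "AE \<zeta> in \<mu>. (norm (y \<zeta>))\<^sup>2 = c\<^sup>2 * (norm (f \<zeta>))\<^sup>2"
        using c max by eventually_elim (simp add: maximizing_vector_def y_def power_mult_distrib)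
    qed measurable
    finally show ?thesis .
  qed
  also have "\<dots> = (c * L2_norm f)\<^sup>2"
    by (simp add: L2_norm_def integral_nonneg_AE power_mult_distrib)
  finally have ny2: "(L2_norm y)\<^sup>2 = (c * L2_norm f)\<^sup>2" .
  have c0: "0 \<le> c"
  proof -
    have "AE \<zeta> in \<mu>. 0 \<le> c" using c by eventually_elim (metis mat_norm_nonneg)
    then show ?thesis by (simp add: circle.AE_const)
  qed
  then have ny: "L2_norm y = c * L2_norm f" using ny2 f0 by (simp add: power2_eq_iff_nonneg)
  have "(L2_norm y)\<^sup>2 \<le> Linf_norm D * L2_norm f * L2_norm y"
  proof -
    have FH: "(\<lambda>\<zeta>. F \<zeta> *v f \<zeta>) \<in> H2" by (rule Hinf_mult_H2[OF F fH])
    have "ip y y = ip (\<lambda>\<zeta>. D \<zeta> *v f \<zeta> + F \<zeta> *v f \<zeta>) y"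
      by (simp add: y_def[abs_def] D_def matrix_vector_mult_diff_rdistrib)
    also have "\<dots> = ip (\<lambda>\<zeta>. D \<zeta> *v f \<zeta>) y + ip (\<lambda>\<zeta>. F \<zeta> *v f \<zeta>) y"
      by (intro ip_add_left Linf_L2 D fL yL H2_L2[OF FH])
    also have "ip (\<lambda>\<zeta>. F \<zeta> *v f \<zeta>) y = 0" using H2_minus_ip[OF y FH] by (simp add: ip_commute)
    also have "ip (\<lambda>\<zeta>. D \<zeta> *v f \<zeta>) y + 0 \<le> L2_norm (\<lambda>\<zeta>. D \<zeta> *v f \<zeta>) * L2_norm y"
      using L2_cauchy_schwarz[OF Linf_L2[OF D fL] yL] by simp
    also have "\<dots> \<le> (Linf_norm D * L2_norm f) * L2_norm y"
      by (intro mult_right_mono Linf_L2_norm D fL) simp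
    finally show ?thesis by (simp add: ip_self)
  qed
  then have "c \<le> Linf_norm D"
  proof (cases "c = 0")
    case True
    then show ?thesis using Linf_norm_ereal(2)[OF D] by simp
  next
    case False
    then have "c * L2_norm f > 0" using c0 f0 by simp
    then have "c * L2_norm f \<le> Linf_norm D * L2_norm f"
      using \<open>(L2_norm y)\<^sup>2 \<le> _\<close> unfolding ny power2_eq_square by (simp add: mult_le_cancel_right)
    then show ?thesis using f0 by simp
  qed
  moreover have "Linf_norm \<Phi> \<le> c" using c by (intro Linf_norm_le \<Phi>) auto
  ultimately show "Linf_norm \<Phi> \<le> Linf_norm (\<lambda>\<zeta>. \<Phi> \<zeta> - F \<zeta>)" by (simp add: D_def[abs_def])
qed

text \<open>A smaller bound for the Hankel operator would yield a better approximation, so the norm of \<open>\<Phi>\<close> is attained by the Hankel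
  operator at some \<open>f\<close>, with equality at every point.\<close>

lemma badly_approximable_necessary:
  assumes \<Phi>: "\<Phi> \<in> Linf" and ess: "essential_norm H2 H2_minus (hankel \<Phi>) < Linf_norm \<Phi>"
    and bad: "badly_approximable \<Phi>"
  obtains f where "f \<in> ker_toeplitz \<Phi>" "AE \<zeta> in \<mu>. mat_norm (\<Phi> \<zeta>) = Linf_norm \<Phi>"
    "AE \<zeta> in \<mu>. maximizing_vector (\<Phi> \<zeta>) (f \<zeta>)"
proof -
  define \<rho> where "\<rho> = Linf_norm \<Phi>"
  have big: "\<not> hankel_bound \<Phi> r" if r: "0 \<le> r" "r < Linf_norm \<Phi>" for r
  proof
    assume B: "hankel_bound \<Phi> r"
    define r' where "r' = (r + Linf_norm \<Phi>) / 2"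
    obtain F where F: "F \<in> Hinf" "AE \<zeta> in \<mu>. mat_norm (\<Phi> \<zeta> - F \<zeta>) \<le> r'"
      using nehari[OF \<Phi> B r(1), of r'] r by (auto simp: r'_def)
    have "Linf_norm (\<lambda>\<zeta>. \<Phi> \<zeta> - F \<zeta>) \<le> r'" by (rule Linf_norm_le[OF Linf_diff[OF \<Phi> Hinf_Linf[OF F(1)]] F(2)])
    moreover have "Linf_norm \<Phi> \<le> Linf_norm (\<lambda>\<zeta>. \<Phi> \<zeta> - F \<zeta>)"
      using bad F(1) unfolding badly_approximable_iff[OF \<Phi>] by blast
    ultimately show False using r by (simp add: r'_def)
  qed
  from hankel_norm_attained[OF \<Phi> ess big] obtain f where pos: "0 < \<rho>"
    and f: "f \<in> H2" "L2_norm f = 1" "L2_norm (hankel \<Phi> f) = \<rho>" by (auto simp: \<rho>_def)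
  have fL: "f \<in> L2" by (rule H2_L2[OF f(1)])
  define y where "y \<zeta> = \<Phi> \<zeta> *v f \<zeta>" for \<zeta>
  have yL: "y \<in> L2" unfolding y_def by (rule Linf_L2[OF \<Phi> fL])
  have ny: "L2_norm y = \<rho>"
    using hankel_le(1)[OF \<Phi> fL] Linf_L2_norm[OF \<Phi> fL] f by (simp add: y_def[abs_def] \<rho>_def)
  note hm = hankel_form(1)[OF \<Phi> fL]
  have hL: "hankel \<Phi> f \<in> L2" by (rule H2_minus_L2[OF hm])
  have "L2_norm (\<lambda>\<zeta>. y \<zeta> - hankel \<Phi> f \<zeta>) = 0"
    using hankel_le(2)[OF \<Phi> fL] ny f(3) by (simp add: y_def[abs_def])
  then have eq: "AE \<zeta> in \<mu>. y \<zeta> = hankel \<Phi> f \<zeta>"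
    using L2_norm_eq_0_iff[OF L2_diff[OF yL hL]] by simp
  have "y \<in> H2_minus"
    unfolding H2_minus_eq_annih annih_def
  proof (safe intro!: yL)
    fix g :: "complex \<Rightarrow> complex^'b" assume g: "g \<in> H2"
    have "ip y g = ip (hankel \<Phi> f) g" by (rule ip_cong_AE) (use eq yL hL H2_L2[OF g] in auto)
    then show "ip y g = 0" using H2_minus_ip[OF hm g] by simp
  qed
  then have ker: "f \<in> ker_toeplitz \<Phi>" using ker_toeplitz_iff[OF \<Phi> f(1)] by (simp add: y_def[abs_def])
  have nz: "AE \<zeta> in \<mu>. f \<zeta> \<noteq> 0"
    using f(2) L2_norm_eq_0_iff[OF fL] by (intro H2_nonvanishing f) auto
  have le: "AE \<zeta> in \<mu>. norm (y \<zeta>) \<le> \<rho> * norm (f \<zeta>)"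
    using Linf_mult_AE[OF \<Phi>] by eventually_elim (simp add: y_def \<rho>_def)
  have "AE \<zeta> in \<mu>. \<rho>\<^sup>2 * (norm (f \<zeta>))\<^sup>2 - (norm (y \<zeta>))\<^sup>2 = 0"
  proof -
    let ?w = "\<lambda>\<zeta>. \<rho>\<^sup>2 * (norm (f \<zeta>))\<^sup>2 - (norm (y \<zeta>))\<^sup>2"
    have int: "integrable \<mu> ?w"
      by (intro Bochner_Integration.integrable_diff integrable_mult_right L2_integrable fL yL)
    have nn: "AE \<zeta> in \<mu>. 0 \<le> ?w \<zeta>"
      using le by eventually_elim (metis diff_ge_0_iff_ge norm_ge_zero power_mono power_mult_distrib)
    have "(\<integral>\<zeta>. ?w \<zeta> \<partial>\<mu>) = \<rho>\<^sup>2 * (\<integral>\<zeta>. (norm (f \<zeta>))\<^sup>2 \<partial>\<mu>) - (\<integral>\<zeta>. (norm (y \<zeta>))\<^sup>2 \<partial>\<mu>)"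
      using L2_integrable[OF fL] L2_integrable[OF yL] by simp
    also have "\<dots> = \<rho>\<^sup>2 * (L2_norm f)\<^sup>2 - (L2_norm y)\<^sup>2" by (simp add: L2_norm_def integral_nonneg_AE)
    also have "\<dots> = 0" using f ny by simp
    finally show ?thesis using integral_nonneg_eq_0_iff_AE[OF int nn] by simp
  qed
  then have norm_eq: "AE \<zeta> in \<mu>. norm (y \<zeta>) = \<rho> * norm (f \<zeta>)"
  proof eventually_elim
    case (elim \<zeta>)
    then have "(\<rho> * norm (f \<zeta>))\<^sup>2 = (norm (y \<zeta>))\<^sup>2" by (simp add: power_mult_distrib)
    then show ?case using pos by (simp add: power2_eq_iff_nonneg)
  qed
  have const: "AE \<zeta> in \<mu>. mat_norm (\<Phi> \<zeta>) = \<rho>"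
    using norm_eq nz Linf_norm_AE[OF \<Phi>]
  proof eventually_elim
    case (elim \<zeta>)
    have "\<rho> * norm (f \<zeta>) \<le> mat_norm (\<Phi> \<zeta>) * norm (f \<zeta>)"
      using norm_matrix_le[of "\<Phi> \<zeta>" "f \<zeta>"] elim(1) by (simp add: y_def)
    then show ?case using elim(2,3) by (simp add: \<rho>_def)
  qed
  have max: "AE \<zeta> in \<mu>. maximizing_vector (\<Phi> \<zeta>) (f \<zeta>)"
    using const norm_eq nz by eventually_elim (simp add: maximizing_vector_def y_def)
  show ?thesis using ker const max by (intro that) (simp_all add: \<rho>_def)
qed

theorem theorem6p1:
  fixes \<Phi> :: "complex \<Rightarrow> complex ^ 'n::finite ^ 'm::finite"
  assumes "\<Phi> \<in> Linf"
    and "essential_norm H2 H2_minus (hankel \<Phi>) < Linf_norm \<Phi>"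
  shows "badly_approximable \<Phi> \<longleftrightarrow>
    (\<exists>c. AE \<zeta> in circle_measure. mat_norm (\<Phi> \<zeta>) = c) \<and>
    (\<exists>f\<in>ker_toeplitz \<Phi>. AE \<zeta> in circle_measure. maximizing_vector (\<Phi> \<zeta>) (f \<zeta>))"
proof
  assume "badly_approximable \<Phi>"
  from badly_approximable_necessary[OF assms this] show "(\<exists>c. AE \<zeta> in circle_measure. mat_norm (\<Phi> \<zeta>) = c) \<and>
    (\<exists>f\<in>ker_toeplitz \<Phi>. AE \<zeta> in circle_measure. maximizing_vector (\<Phi> \<zeta>) (f \<zeta>))" by blast
next
  assume "(\<exists>c. AE \<zeta> in circle_measure. mat_norm (\<Phi> \<zeta>) = c) \<and>
    (\<exists>f\<in>ker_toeplitz \<Phi>. AE \<zeta> in circle_measure. maximizing_vector (\<Phi> \<zeta>) (f \<zeta>))"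
  then show "badly_approximable \<Phi>" using badly_approximable_sufficient[OF assms(1)] by blast
qed

end
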